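(* Let $\nu\in\mathbb{N}_0$ and let $r_{\nu+1/2}$ be the Matérn kernel of order $\nu+1/2$ on $\mathbb{R}$. Define the functions $$\psi^{+}_{m,\nu}(t)=\frac{\nu!}{\sqrt{(2\nu)!}}\frac{m!}{(m+\nu+1)!}(2t)^{\nu+1}\mathrm{L}_m^{(\nu+1)}(2t)e^{-t}\mathbf{1}_{[0,\infty)}(t)\quad\text{for } m\in\mathbb{N}_0,$$ $$\psi^{-}_{m,\nu}(t)=(-1)^\nu\psi^{+}_{m,\nu}(-t)\quad\text{for } m\in\mathbb{N}_0,$$ $$\psi^{0}_{m,\nu}(t)=\frac{1}{\sqrt2}\frac{\nu!}{\sqrt{(2\nu)!}}\sum_{k=0}^{\nu+1}\binom{\nu+1}{k}(-1)^k\varphi_{m+k-\nu-1}(t)\quad\text{for } m=0,\ldots,\nu.$$ Then these functions together form an orthonormal basis of the reproducing kernel Hilbert space of $r_{\nu+1/2}$, and, with pointwise convergence, $$r_{\nu+1/2}(t,u)=\sum_{m=0}^{\nu}\psi^{0}_{m,\nu}(t)\psi^{0}_{m,\nu}(u)+\sum_{m=0}^\infty\psi^{-}_{m,\nu}(t)\psi^{-}_{m,\nu}(u)+\sum_{m=0}^\infty\psi^{+}_{m,\nu}(t)\psi^{+}_{m,\nu}(u)$$ for all $t,u\in\mathbb{R}$.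
   Context: The Matérn kernel of order $\alpha>0$ is $r_\alpha(t,u)=\frac{2^{1-\alpha}}{\Gamma(\alpha)}|t-u|^\alpha\mathrm{K}_\alpha(|t-u|)$ for $t,u\in\mathbb{R}$ (with the value at $t=u$ defined by continuity), where $\Gamma$ is the Gamma function and $\mathrm{K}_\alpha$ the modified Bessel function of the second kind of order $\alpha$. For $\eta\in\mathbb{N}_0$, the associated Laguerre polynomial is $\mathrm{L}_m^{(\eta)}(t)=\sum_{k=0}^m\binom{m+\eta}{m-k}\frac{(-1)^k}{k!}t^k$, and $\mathrm{L}_m=\mathrm{L}_m^{(0)}$. The Laguerre functions $\{\varphi_m\}_{m\in\mathbb{Z}}$ are $\varphi_m(t)=\sqrt2\,\mathrm{L}_m(2t)e^{-t}\mathbf{1}_{[0,\infty)}(t)$ and $\varphi_{-m-1}(t)=-\sqrt2\,\mathrm{L}_m(-2t)e^{t}\mathbf{1}_{(-\infty,0)}(t)$ for $m\in\mathbb{N}_0$, where $\mathbf{1}_A$ is the indicator function of $A$. $\mathbb{N}_0=\{0,1,2,\ldots\}$. *)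

theory Defs
  imports "HOL-Analysis.Analysis"
begin

definition bessel_I :: "real \<Rightarrow> real \<Rightarrow> real" where
  "bessel_I \<alpha> x = (\<Sum>k. (x / 2) powr (2 * real k + \<alpha>) * rGamma (real k + \<alpha> + 1) / fact k)"

text \<open>For integer order the defining quotient is \<open>0/0\<close> and is replaced, as usual, by its limit
  in the order. Only positive arguments are meaningful.\<close>
definition bessel_K :: "real \<Rightarrow> real \<Rightarrow> real" where
  "bessel_K \<alpha> x =
     (let q = (\<lambda>\<beta>. pi / 2 * (bessel_I (- \<beta>) x - bessel_I \<beta> x) / sin (\<beta> * pi))
      in if \<alpha> \<in> \<int> then Lim (at \<alpha>) q else q \<alpha>)"

definition matern_profile :: "real \<Rightarrow> real \<Rightarrow> real" where
  "matern_profile \<alpha> x = 2 powr (1 - \<alpha>) / Gamma \<alpha> * x powr \<alpha> * bessel_K \<alpha> x"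

definition matern :: "real \<Rightarrow> real \<Rightarrow> real \<Rightarrow> real" where
  "matern \<alpha> t u =
     (if t = u then Lim (at_right 0) (matern_profile \<alpha>) else matern_profile \<alpha> \<bar>t - u\<bar>)"

definition laguerre :: "nat \<Rightarrow> nat \<Rightarrow> real \<Rightarrow> real" where
  "laguerre \<eta> m t = (\<Sum>k\<le>m. real ((m + \<eta>) choose (m - k)) * ((-1) ^ k / fact k) * t ^ k)"

definition laguerre_fun :: "int \<Rightarrow> real \<Rightarrow> real" where
  "laguerre_fun n t =
     (if 0 \<le> n
      then sqrt 2 * laguerre 0 (nat n) (2 * t) * exp (- t) * indicator {0..} t
      else - sqrt 2 * laguerre 0 (nat (- n - 1)) (- 2 * t) * exp t * indicator {..<0} t)"

definition psi_plus :: "nat \<Rightarrow> nat \<Rightarrow> real \<Rightarrow> real" where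
  "psi_plus \<nu> m t =
     fact \<nu> / sqrt (fact (2 * \<nu>)) * (fact m / fact (m + \<nu> + 1)) * (2 * t) ^ (\<nu> + 1)
       * laguerre (\<nu> + 1) m (2 * t) * exp (- t) * indicator {0..} t"

definition psi_minus :: "nat \<Rightarrow> nat \<Rightarrow> real \<Rightarrow> real" where
  "psi_minus \<nu> m t = (-1) ^ \<nu> * psi_plus \<nu> m (- t)"

definition psi_zero :: "nat \<Rightarrow> nat \<Rightarrow> real \<Rightarrow> real" where
  "psi_zero \<nu> m t =
     1 / sqrt 2 * (fact \<nu> / sqrt (fact (2 * \<nu>)))
       * (\<Sum>k\<le>\<nu> + 1. real ((\<nu> + 1) choose k) * (-1) ^ k
            * laguerre_fun (int m + int k - int \<nu> - 1) t)"

text \<open>The three families of functions are combined into a single indexed family, so that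
  orthonormality includes orthogonality between different families.\<close>
datatype psi_index = Zero nat | Minus nat | Plus nat

fun psi :: "nat \<Rightarrow> psi_index \<Rightarrow> real \<Rightarrow> real" where
  "psi \<nu> (Zero m) = psi_zero \<nu> m"
| "psi \<nu> (Minus m) = psi_minus \<nu> m"
| "psi \<nu> (Plus m) = psi_plus \<nu> m"

definition psi_indices :: "nat \<Rightarrow> psi_index set" where
  "psi_indices \<nu> = Zero ` {..\<nu>} \<union> range Minus \<union> range Plus"

text \<open>A real Hilbert space of functions: a set \<open>H\<close> of functions with pointwise operations and an
  inner product \<open>ip\<close>, whose values outside \<open>H\<close> are irrelevant.\<close>
locale function_hilbert_space =
  fixes H :: "('a \<Rightarrow> real) set"
    and ip :: "('a \<Rightarrow> real) \<Rightarrow> ('a \<Rightarrow> real) \<Rightarrow> real"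
  assumes zero_mem: "(\<lambda>x. 0) \<in> H"
    and add_mem: "f \<in> H \<Longrightarrow> g \<in> H \<Longrightarrow> (\<lambda>x. f x + g x) \<in> H"
    and scale_mem: "f \<in> H \<Longrightarrow> (\<lambda>x. c * f x) \<in> H"
    and ip_commute: "f \<in> H \<Longrightarrow> g \<in> H \<Longrightarrow> ip f g = ip g f"
    and ip_add: "f \<in> H \<Longrightarrow> g \<in> H \<Longrightarrow> h \<in> H \<Longrightarrow> ip (\<lambda>x. f x + g x) h = ip f h + ip g h"
    and ip_scale: "f \<in> H \<Longrightarrow> g \<in> H \<Longrightarrow> ip (\<lambda>x. c * f x) g = c * ip f g"
    and ip_nonneg: "f \<in> H \<Longrightarrow> 0 \<le> ip f f"
    and ip_definite: "f \<in> H \<Longrightarrow> ip f f = 0 \<Longrightarrow> f = (\<lambda>x. 0)"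
    and complete:
      "(\<And>n. F n \<in> H) \<Longrightarrow>
       (\<And>\<epsilon>. \<epsilon> > 0 \<Longrightarrow> \<exists>N. \<forall>m\<ge>N. \<forall>n\<ge>N.
          sqrt (ip (\<lambda>x. F m x - F n x) (\<lambda>x. F m x - F n x)) < \<epsilon>) \<Longrightarrow>
       \<exists>f\<in>H. (\<lambda>n. sqrt (ip (\<lambda>x. F n x - f x) (\<lambda>x. F n x - f x))) \<longlonglongrightarrow> 0"

text \<open>\<open>(H, ip)\<close> is the reproducing kernel Hilbert space of \<open>K\<close>; by the Moore-Aronszajn theorem
  the set \<open>H\<close>, and \<open>ip\<close> on \<open>H\<close>, are determined by \<open>K\<close>.\<close>
locale rkhs = function_hilbert_space H ip
  for H :: "('a \<Rightarrow> real) set"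
    and ip :: "('a \<Rightarrow> real) \<Rightarrow> ('a \<Rightarrow> real) \<Rightarrow> real"
    and K :: "'a \<Rightarrow> 'a \<Rightarrow> real" +
  assumes kernel_mem: "(\<lambda>s. K s t) \<in> H"
    and reproducing: "f \<in> H \<Longrightarrow> ip f (\<lambda>s. K s t) = f t"

definition orthonormal_basis ::
  "('a \<Rightarrow> real) set \<Rightarrow> (('a \<Rightarrow> real) \<Rightarrow> ('a \<Rightarrow> real) \<Rightarrow> real) \<Rightarrow> 'i set \<Rightarrow> ('i \<Rightarrow> 'a \<Rightarrow> real) \<Rightarrow> bool"
  where
  "orthonormal_basis H ip I e \<longleftrightarrow>
     (\<forall>i\<in>I. e i \<in> H) \<and>
     (\<forall>i\<in>I. \<forall>j\<in>I. ip (e i) (e j) = (if i = j then 1 else 0)) \<and>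
     (\<forall>f\<in>H. \<forall>\<epsilon>>0. \<exists>J c. finite J \<and> J \<subseteq> I \<and>
        sqrt (ip (\<lambda>x. f x - (\<Sum>j\<in>J. c j * e j x)) (\<lambda>x. f x - (\<Sum>j\<in>J. c j * e j x))) < \<epsilon>)"

end

theory Submission imports Defs begin

text \<open>The functions of the three families are one sequence indexed by the integers. Let \<open>\<kappa>\<close> be the common
factor \<open>\<nu>! / sqrt (2\<nu>)!\<close>. By a contiguity relation for Laguerre polynomials, all of them are \<open>\<kappa>\<close> times
the \<open>(\<nu>+1)\<close>-st backward difference, in the integer index, of \<open>\<lambda>\<^sub>n(t) = L\<^sub>n(2t) exp(-t)\<close> for
\<open>n \<ge> 0\<close> and \<open>\<lambda>\<^sub>n = 0\<close> for \<open>n < 0\<close>, read on \<open>t \<ge> 0\<close>; on \<open>t \<le> 0\<close> the same functions appear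
reflected, with the index reversed and with the sign \<open>(-1)\<^sup>\<nu>\<close>. So everything reduces to the half-line and to the differences
\<open>a\<^sup>p\<^sub>n\<close> (\<open>lag_diff\<close>).

The kernel expansion rests on a telescoping identity. The differences satisfy \<open>D a\<^sup>p\<^sup>+\<^sup>1\<^sub>n = a\<^sup>p\<^sub>n\<^sub>-\<^sub>1 + a\<^sup>p\<^sub>n\<close> while
\<open>a\<^sup>p\<^sup>+\<^sup>1\<^sub>n = a\<^sup>p\<^sub>n\<^sub>-\<^sub>1 - a\<^sup>p\<^sub>n\<close>. Hence the derivative of a product \<open>a\<^sup>p\<^sup>+\<^sup>1\<^sub>n(t+s) a\<^sup>p\<^sup>+\<^sup>1\<^sub>n(u+s)\<close>
with respect to \<open>s\<close> is a telescoping difference, and the \<open>N\<close>-th partial sum of the products changes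
along diagonals only through \<open>-2 a\<^sup>p\<^sub>N\<^sub>-\<^sub>1(t+s) a\<^sup>p\<^sub>N\<^sub>-\<^sub>1(u+s)\<close> (\<open>partial_kernel_deriv\<close>). These
boundary terms vanish in the limit because \<open>a\<^sup>p\<^sub>N \<rightarrow> 0\<close> in \<open>L\<^sup>2(0,T)\<close>. For \<open>p = 0\<close> this holds since
neighbouring \<open>\<lambda>\<^sub>N\<close> become indistinguishable on \<open>(0,T)\<close>, whereas averages of many of them are small
by orthogonality on the half-line (\<open>l2_vanishing_lag_diff_0\<close>); the higher differences inherit it. So the infinite sum depends on \<open>t - u\<close> only
(\<open>partial_kernel_tendsto\<close>), and evaluating it at \<open>u = 0\<close>, where all but \<open>p + 1\<close> of the terms vanish, gives a
finite sum.
For arguments of opposite signs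
the sum is finite from the start and is evaluated by the same telescoping (\<open>lag_diff_reflection_sum\<close>).

It remains to recognize the Matern kernel. For half-integer order the Bessel series combine to an entire function
\<open>y\<^sub>n\<close> with \<open>y\<^sub>0 = exp(-x)\<close> and, for \<open>n \<ge> 1\<close>, \<open>y\<^sub>n(0) = 1\<close>, \<open>y\<^sub>n'(0) = 0\<close> and
\<open>y\<^sub>n'' = y\<^sub>n - (2n/(2n-1)) y\<^sub>n\<^sub>-\<^sub>1\<close>. The suitably scaled finite sum satisfies the
same initial value problems, so the two agree (\<open>partial_kernel_eq_matern\<close>).

As for the orthonormal basis, an expansion of a kernel in products \<open>e\<^sub>i(s) e\<^sub>i(t)\<close> exhibits the \<open>e\<^sub>i\<close> as an
orthonormal basis as soon as no nontrivial square-summable combination of them vanishes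
identically: the combinations with square-summable coefficients, with the inner product of the
coefficients, then form the reproducing kernel Hilbert space (\<open>rkhs_synth\<close>), which is unique
(\<open>rkhs_unique\<close>). The independence follows by integrating a vanishing combination against \<open>\<lambda>\<^sub>n\<close>:
the coefficients are annihilated by an iterated difference operator, hence polynomial in the
index, hence zero because they tend to zero (\<open>lag_diff_independent\<close>).\<close>

section \<open>Reproducing kernels determine their spaces\<close>

text \<open>The quadratic form behind the Cauchy-Schwarz inequality. Stated for real numbers, it serves both for
the inner product and for a minimization over one parameter.\<close>
lemma discriminant_bound:
  fixes a b d :: real
  assumes "\<And>c. 0 \<le> a + 2 * c * b + c\<^sup>2 * d" and "0 \<le> d"
  shows "b\<^sup>2 \<le> a * d"
proof (cases "d = 0")
  case True
  have "b = 0"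
  proof (rule ccontr)
    assume "b \<noteq> 0"
    \<comment> \<open>For \<open>d = 0\<close> the form is affine in \<open>c\<close>; this \<open>c\<close> gives it the value \<open>-1\<close>.\<close>
    then have "a + 2 * (- (a + 1) / (2 * b)) * b + (- (a + 1) / (2 * b))\<^sup>2 * d = - 1"
      using True by (simp add: field_simps)
    with assms(1)[of "- (a + 1) / (2 * b)"] show False by linarith
  qed
  with True show ?thesis by simp
next
  case False
  with assms(2) have "0 < d" by simp
  \<comment> \<open>The minimizer of the quadratic form is \<open>c = - b / d\<close>.\<close>
  have "a + 2 * (- b / d) * b + (- b / d)\<^sup>2 * d = a - b\<^sup>2 / d"
    using False by (simp add: field_simps power2_eq_square)
  with assms(1)[of "- b / d"] have "b\<^sup>2 / d \<le> a" by linarith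
  with \<open>0 < d\<close> show ?thesis by (simp add: pos_divide_le_eq)
qed

lemma null_sequence_if_square_le:
  fixes a b :: "nat \<Rightarrow> real"
  assumes "\<And>n. (a n)\<^sup>2 \<le> b n" and "b \<longlonglongrightarrow> 0"
  shows "a \<longlonglongrightarrow> 0"
proof -
  have "(\<lambda>n. sqrt (b n)) \<longlonglongrightarrow> 0"
    using tendsto_real_sqrt[OF assms(2)] by simp
  moreover have "norm (a n) \<le> sqrt (b n)" for n
    using real_le_rsqrt[of "\<bar>a n\<bar>"] assms(1) by simp
  ultimately show ?thesis
    by (intro Lim_null_comparison[of a "\<lambda>n. sqrt (b n)"] always_eventually allI)
qed

context function_hilbert_space
begin

lemma diff_mem: "f \<in> H \<Longrightarrow> g \<in> H \<Longrightarrow> (\<lambda>x. f x - g x) \<in> H"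
  using add_mem[OF _ scale_mem[of g "- 1"], of f] by simp

lemma sum_mem: "finite J \<Longrightarrow> (\<And>j. j \<in> J \<Longrightarrow> g j \<in> H) \<Longrightarrow> (\<lambda>x. \<Sum>j\<in>J. c j * g j x) \<in> H"
  by (induction J rule: finite_induct) (simp_all add: zero_mem add_mem scale_mem)

lemma ip_add_scaled:
  assumes "f \<in> H" "g \<in> H" "h \<in> H"
  shows "ip (\<lambda>x. f x + c * g x) h = ip f h + c * ip g h"
  using assms by (simp add: ip_add scale_mem ip_scale)

lemma norm_add_scaled:
  assumes "f \<in> H" "g \<in> H"
  shows "ip (\<lambda>x. f x + c * g x) (\<lambda>x. f x + c * g x) = ip f f + 2 * c * ip f g + c\<^sup>2 * ip g g"
proof -
  have m: "(\<lambda>x. f x + c * g x) \<in> H"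
    using assms by (simp add: add_mem scale_mem)
  have "ip f (\<lambda>x. f x + c * g x) = ip f f + c * ip f g"
    "ip g (\<lambda>x. f x + c * g x) = ip f g + c * ip g g"
    using assms m by (simp_all add: ip_commute[OF _ m] ip_add_scaled ip_commute[of g f])
  with assms m show ?thesis
    by (simp add: ip_add_scaled power2_eq_square algebra_simps)
qed

lemma norm_diff:
  assumes "f \<in> H" "g \<in> H"
  shows "ip (\<lambda>x. f x - g x) (\<lambda>x. f x - g x) = ip f f - 2 * ip f g + ip g g"
  using norm_add_scaled[OF assms, of "- 1"] by simp

lemma norm_diff_le:
  assumes "f \<in> H" "g \<in> H" "h \<in> H"
  shows "ip (\<lambda>x. f x - h x) (\<lambda>x. f x - h x)
    \<le> 2 * ip (\<lambda>x. f x - g x) (\<lambda>x. f x - g x) + 2 * ip (\<lambda>x. g x - h x) (\<lambda>x. g x - h x)"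
proof -
  define a b where "a = (\<lambda>x. f x - g x)" and "b = (\<lambda>x. g x - h x)"
  have ab: "a \<in> H" "b \<in> H" using assms by (simp_all add: a_def b_def diff_mem)
  have "(\<lambda>x. f x - h x) = (\<lambda>x. a x + 1 * b x)" by (simp add: a_def b_def)
  then have "ip (\<lambda>x. f x - h x) (\<lambda>x. f x - h x) = ip a a + 2 * ip a b + ip b b"
    using norm_add_scaled[OF ab, of 1] by simp
  moreover have "0 \<le> ip a a - 2 * ip a b + ip b b"
    using norm_diff[OF ab] ip_nonneg[OF diff_mem[OF ab]] by simp
  ultimately show ?thesis by (simp add: a_def b_def)
qed

text \<open>Completeness in terms of squared norms, which avoids square roots in the applications.\<close>
lemma complete_if_small:
  assumes F: "\<And>n. F n \<in> H" and r: "r \<longlonglongrightarrow> 0"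
    and le: "\<And>m n. ip (\<lambda>x. F m x - F n x) (\<lambda>x. F m x - F n x) \<le> r m + r n"
  obtains f where "f \<in> H" "(\<lambda>n. ip (\<lambda>x. F n x - f x) (\<lambda>x. F n x - f x)) \<longlonglongrightarrow> 0"
proof -
  have "\<exists>f\<in>H. (\<lambda>n. sqrt (ip (\<lambda>x. F n x - f x) (\<lambda>x. F n x - f x))) \<longlonglongrightarrow> 0"
  proof (rule complete[OF F])
    fix e :: real assume "e > 0"
    then have "e\<^sup>2 / 2 > 0" by simp
    with r obtain N where N: "\<And>n. n \<ge> N \<Longrightarrow> r n < e\<^sup>2 / 2"
      by (metis (no_types, lifting) eventually_sequentially order_tendstoD(2))
    have "sqrt (ip (\<lambda>x. F m x - F n x) (\<lambda>x. F m x - F n x)) < e" if "m \<ge> N" "n \<ge> N" for m n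
    proof -
      have "ip (\<lambda>x. F m x - F n x) (\<lambda>x. F m x - F n x) < e\<^sup>2"
        using le[of m n] N[OF that(1)] N[OF that(2)] by linarith
      with \<open>e > 0\<close> show ?thesis
        by (metis less_eq_real_def real_sqrt_less_iff real_sqrt_unique)
    qed
    then show "\<exists>N. \<forall>m\<ge>N. \<forall>n\<ge>N. sqrt (ip (\<lambda>x. F m x - F n x) (\<lambda>x. F m x - F n x)) < e"
      by blast
  qed
  then obtain f where f: "f \<in> H"
    "(\<lambda>n. sqrt (ip (\<lambda>x. F n x - f x) (\<lambda>x. F n x - f x))) \<longlonglongrightarrow> 0" by blast
  have "(\<lambda>n. (sqrt (ip (\<lambda>x. F n x - f x) (\<lambda>x. F n x - f x)))\<^sup>2) \<longlonglongrightarrow> 0\<^sup>2"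
    by (intro tendsto_power f)
  then have "(\<lambda>n. ip (\<lambda>x. F n x - f x) (\<lambda>x. F n x - f x)) \<longlonglongrightarrow> 0"
    using F f(1) by (simp add: ip_nonneg diff_mem)
  with f(1) show ?thesis by (rule that)
qed

end

text \<open>Adding one section at a time makes inner products with elements of the span computable by
induction, from the reproducing property alone.\<close>
inductive_set kernel_span :: "('a \<Rightarrow> 'a \<Rightarrow> real) \<Rightarrow> ('a \<Rightarrow> real) set" for K where
  zero: "(\<lambda>x. 0) \<in> kernel_span K"
| add_section: "g \<in> kernel_span K \<Longrightarrow> (\<lambda>x. g x + c * K x t) \<in> kernel_span K"

lemma kernel_span_add:
  assumes "g \<in> kernel_span K" "f \<in> kernel_span K"
  shows "(\<lambda>x. f x + g x) \<in> kernel_span K"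
  using assms
proof (induction g rule: kernel_span.induct)
  case (add_section g c t)
  from kernel_span.add_section[OF add_section.IH[OF add_section.prems], of c t]
  show ?case by (simp add: add.assoc)
qed simp

lemma kernel_span_scale: "g \<in> kernel_span K \<Longrightarrow> (\<lambda>x. c * g x) \<in> kernel_span K"
proof (induction g rule: kernel_span.induct)
  case zero
  then show ?case by (simp add: kernel_span.zero)
next
  case (add_section g d t)
  from kernel_span.add_section[OF add_section.IH, of "c * d" t]
  show ?case by (simp add: algebra_simps)
qed

context rkhs
begin

lemma kernel_span_mem: "g \<in> kernel_span K \<Longrightarrow> g \<in> H"
  by (induction g rule: kernel_span.induct) (simp_all add: zero_mem add_mem scale_mem kernel_mem)

lemma ip_section: "h \<in> H \<Longrightarrow> ip (\<lambda>s. K s t) h = h t"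
  using ip_commute[OF kernel_mem, of h t] reproducing[of h t] by simp

lemma kernel_diag_nonneg: "0 \<le> K t t"
  using ip_nonneg[OF kernel_mem[of t]] reproducing[OF kernel_mem[of t], of t] by simp

lemma eval_bound: "h \<in> H \<Longrightarrow> (h t)\<^sup>2 \<le> ip h h * K t t"
proof (rule discriminant_bound)
  fix c assume h: "h \<in> H"
  have "0 \<le> ip (\<lambda>x. h x + c * K x t) (\<lambda>x. h x + c * K x t)"
    using h by (intro ip_nonneg add_mem scale_mem kernel_mem)
  then show "0 \<le> ip h h + 2 * c * h t + c\<^sup>2 * K t t"
    using norm_add_scaled[OF h kernel_mem] h by (simp add: reproducing kernel_mem)
qed (rule kernel_diag_nonneg)

lemma pointwise_limit:
  assumes "\<And>n. F n \<in> H" "f \<in> H" "(\<lambda>n. ip (\<lambda>x. F n x - f x) (\<lambda>x. F n x - f x)) \<longlonglongrightarrow> 0"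
  shows "(\<lambda>n. F n t) \<longlonglongrightarrow> f t"
proof -
  have "(\<lambda>n. F n t - f t) \<longlonglongrightarrow> 0"
  proof (rule null_sequence_if_square_le)
    show "(F n t - f t)\<^sup>2 \<le> ip (\<lambda>x. F n x - f x) (\<lambda>x. F n x - f x) * K t t" for n
      using eval_bound[OF diff_mem[OF assms(1,2)]] by simp
    show "(\<lambda>n. ip (\<lambda>x. F n x - f x) (\<lambda>x. F n x - f x) * K t t) \<longlonglongrightarrow> 0"
      using tendsto_mult_right[OF assms(3), of "K t t"] by simp
  qed
  then show ?thesis by (simp add: LIM_zero_iff)
qed

text \<open>A minimizing sequence for the distance from \<open>f\<close> to the span is Cauchy by the parallelogram law. Near
the minimum, moving along a section \<open>K(\<cdot>, t)\<close> cannot decrease the distance much, and this bounds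
the pointwise error at \<open>t\<close>. Hence the sequence converges to \<open>f\<close> at every point, and its
limit in \<open>H\<close> is \<open>f\<close>.\<close>
lemma kernel_span_dense:
  assumes f: "f \<in> H"
  obtains G where "\<And>n. G n \<in> kernel_span K"
    and "(\<lambda>n. ip (\<lambda>x. G n x - f x) (\<lambda>x. G n x - f x)) \<longlonglongrightarrow> 0"
proof -
  define N where "N h = ip (\<lambda>x. f x - h x) (\<lambda>x. f x - h x)" for h
  define d where "d = (INF g\<in>kernel_span K. N g)"
  have bdd: "bdd_below (N ` kernel_span K)"
    by (rule bdd_belowI2[of _ 0]) (auto simp: N_def ip_nonneg diff_mem f kernel_span_mem)
  have dle: "d \<le> N g" if "g \<in> kernel_span K" for g
    unfolding d_def by (rule cINF_lower[OF bdd that])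
  have "\<exists>g\<in>kernel_span K. N g < d + 1 / real (Suc n)" for n
  proof -
    have "\<exists>y\<in>N ` kernel_span K. y < d + 1 / real (Suc n)"
      unfolding d_def by (rule cInf_lessD) (auto intro: kernel_span.zero)
    then show ?thesis by auto
  qed
  then obtain G where G: "\<And>n. G n \<in> kernel_span K" "\<And>n. N (G n) < d + 1 / real (Suc n)"
    by metis
  have GH: "G n \<in> H" for n by (rule kernel_span_mem[OF G(1)])
  have lim: "(\<lambda>n. c * (1 / real (Suc n))) \<longlonglongrightarrow> 0" for c
    using tendsto_mult_left[OF LIMSEQ_inverse_real_of_nat, of c] by (simp add: inverse_eq_divide)
  obtain p where p: "p \<in> H" "(\<lambda>n. ip (\<lambda>x. G n x - p x) (\<lambda>x. G n x - p x)) \<longlonglongrightarrow> 0"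
  proof (rule complete_if_small[OF GH lim[of 2]])
    fix m n
    define a b where "a = (\<lambda>x. f x - G m x)" and "b = (\<lambda>x. f x - G n x)"
    have ab: "a \<in> H" "b \<in> H" using GH f by (simp_all add: a_def b_def diff_mem)
    \<comment> \<open>The midpoint lies in the span, so the parallelogram law bounds the distance of \<open>G m\<close> and \<open>G n\<close>.\<close>
    define g where "g = (\<lambda>x. (1 / 2) * (G m x + G n x))"
    have g: "g \<in> kernel_span K"
      unfolding g_def by (intro kernel_span_scale kernel_span_add G)
    have "(\<lambda>x. (1 / 2) * (a x + 1 * b x)) = (\<lambda>x. f x - g x)"
      by (simp add: a_def b_def g_def fun_eq_iff field_simps)
    then have "N g = ip (\<lambda>x. (1 / 2) * (a x + 1 * b x)) (\<lambda>x. (1 / 2) * (a x + 1 * b x))"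
      by (simp add: N_def)
    also have "\<dots> = (1 / 4) * ip (\<lambda>x. a x + 1 * b x) (\<lambda>x. a x + 1 * b x)"
    proof -
      have s: "(\<lambda>x. a x + 1 * b x) \<in> H" using ab by (simp add: add_mem)
      show ?thesis
        by (simp only: ip_scale[OF s scale_mem[OF s]] ip_commute[OF s scale_mem[OF s]] ip_scale[OF s s])
    qed
    also have "\<dots> = (ip a a + 2 * ip a b + ip b b) / 4"
      using norm_add_scaled[OF ab, of 1] by simp
    finally have "4 * d \<le> ip a a + 2 * ip a b + ip b b" using dle[OF g] by simp
    moreover have "ip a a < d + 1 / real (Suc m)" "ip b b < d + 1 / real (Suc n)"
      using G(2) by (simp_all add: N_def a_def b_def)
    moreover have "ip (\<lambda>x. G m x - G n x) (\<lambda>x. G m x - G n x) = ip a a - 2 * ip a b + ip b b"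
    proof -
      have "(\<lambda>x. G m x - G n x) = (\<lambda>x. b x - a x)" by (simp add: a_def b_def)
      then show ?thesis using norm_diff[OF ab(2,1)] ab by (simp add: ip_commute[of b a])
    qed
    ultimately show "ip (\<lambda>x. G m x - G n x) (\<lambda>x. G m x - G n x)
        \<le> 2 * (1 / real (Suc m)) + 2 * (1 / real (Suc n))" by linarith
  qed
  have "f = p"
  proof
    fix t
    have "(G n t - f t)\<^sup>2 \<le> K t t * (1 / real (Suc n))" for n
    proof -
      have a: "(\<lambda>x. f x - G n x) \<in> H" using GH f by (simp add: diff_mem)
      have "(f t - G n t)\<^sup>2 \<le> (N (G n) - d) * K t t"
      proof (rule discriminant_bound)
        fix c
        have "(\<lambda>x. G n x + (- c) * K x t) \<in> kernel_span K"
          by (rule kernel_span.add_section[OF G(1)])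
        then have "d \<le> N (\<lambda>x. G n x + (- c) * K x t)" by (rule dle)
        also have "\<dots> = ip (\<lambda>x. (f x - G n x) + c * K x t) (\<lambda>x. (f x - G n x) + c * K x t)"
          by (simp add: N_def algebra_simps)
        finally show "0 \<le> N (G n) - d + 2 * c * (f t - G n t) + c\<^sup>2 * K t t"
          using a by (simp add: norm_add_scaled kernel_mem reproducing N_def)
      qed (rule kernel_diag_nonneg)
      also have "\<dots> \<le> (1 / real (Suc n)) * K t t"
        using G(2)[of n] kernel_diag_nonneg by (intro mult_right_mono) auto
      finally show ?thesis by (simp add: power2_commute mult.commute)
    qed
    then have "(\<lambda>n. G n t - f t) \<longlonglongrightarrow> 0"
      by (rule null_sequence_if_square_le[OF _ lim])
    then have "(\<lambda>n. G n t) \<longlonglongrightarrow> f t" by (simp add: LIM_zero_iff)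
    moreover have "(\<lambda>n. G n t) \<longlonglongrightarrow> p t" by (rule pointwise_limit[OF GH p])
    ultimately show "f t = p t" by (rule LIMSEQ_unique)
  qed
  with p G(1) that show ?thesis by blast
qed

end

lemma kernel_span_ip_unique:
  assumes "rkhs H ip K" "rkhs H' ip' K" "g \<in> kernel_span K" "h \<in> kernel_span K"
  shows "ip g h = ip' g h"
proof -
  interpret A: rkhs H ip K by fact
  interpret B: rkhs H' ip' K by fact
  from assms(3) show ?thesis
  proof (induction g rule: kernel_span.induct)
    case zero
    show ?case
      using A.ip_scale[OF A.zero_mem A.kernel_span_mem[OF assms(4)], of 0]
        B.ip_scale[OF B.zero_mem B.kernel_span_mem[OF assms(4)], of 0] by simp
  next
    case (add_section g c t)
    then show ?case
      using A.kernel_span_mem[OF assms(4)] B.kernel_span_mem[OF assms(4)]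
      by (simp add: A.ip_add_scaled B.ip_add_scaled A.kernel_span_mem B.kernel_span_mem
          A.kernel_mem B.kernel_mem A.ip_section B.ip_section)
  qed
qed

text \<open>Two spaces with the same kernel agree on the span of the sections. Approximation by the span and
completeness of the other space carry the agreement over to all of \<open>H\<close>.\<close>
lemma rkhs_subset_isometric:
  assumes "rkhs H ip K" "rkhs H' ip' K" "f \<in> H"
  shows "f \<in> H' \<and> ip f f = ip' f f"
proof -
  interpret A: rkhs H ip K by fact
  interpret B: rkhs H' ip' K by fact
  obtain G where G: "\<And>n. G n \<in> kernel_span K"
    and lim: "(\<lambda>n. ip (\<lambda>x. G n x - f x) (\<lambda>x. G n x - f x)) \<longlonglongrightarrow> 0"
    using A.kernel_span_dense[OF assms(3)] by blast
  have GA: "G n \<in> H" and GB: "G n \<in> H'" for n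
    using G by (auto intro: A.kernel_span_mem B.kernel_span_mem)
  have lim2: "(\<lambda>n. 2 * ip (\<lambda>x. G n x - f x) (\<lambda>x. G n x - f x)) \<longlonglongrightarrow> 0"
    using tendsto_mult_left[OF lim, of 2] by simp
  obtain p where p: "p \<in> H'" "(\<lambda>n. ip' (\<lambda>x. G n x - p x) (\<lambda>x. G n x - p x)) \<longlonglongrightarrow> 0"
  proof (rule B.complete_if_small[OF GB lim2])
    fix m n
    have "(\<lambda>x. G m x - G n x) \<in> kernel_span K"
      using kernel_span_add[OF kernel_span_scale[OF G[of n], of "- 1"] G[of m]] by simp
    then have "ip' (\<lambda>x. G m x - G n x) (\<lambda>x. G m x - G n x)
        = ip (\<lambda>x. G m x - G n x) (\<lambda>x. G m x - G n x)"
      using kernel_span_ip_unique[OF assms(1,2)] by metis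
    also have "\<dots> \<le> 2 * ip (\<lambda>x. G m x - f x) (\<lambda>x. G m x - f x) + 2 * ip (\<lambda>x. f x - G n x) (\<lambda>x. f x - G n x)"
      by (rule A.norm_diff_le[OF GA assms(3) GA])
    also have "ip (\<lambda>x. f x - G n x) (\<lambda>x. f x - G n x) = ip (\<lambda>x. G n x - f x) (\<lambda>x. G n x - f x)"
      by (simp add: A.norm_diff GA assms(3) A.ip_commute[OF GA assms(3)])
    finally show "ip' (\<lambda>x. G m x - G n x) (\<lambda>x. G m x - G n x)
       \<le> 2 * ip (\<lambda>x. G m x - f x) (\<lambda>x. G m x - f x) + 2 * ip (\<lambda>x. G n x - f x) (\<lambda>x. G n x - f x)" .
  qed
  have pf: "p = f"
    using LIMSEQ_unique[OF B.pointwise_limit[OF GB p] A.pointwise_limit[OF GA assms(3) lim]] by blast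
  have normlim: "(\<lambda>n. J (G n) (G n)) \<longlonglongrightarrow> J f f"
    if "function_hilbert_space V J" "\<And>n. G n \<in> V" "f \<in> V"
      "(\<lambda>n. J (\<lambda>x. G n x - f x) (\<lambda>x. G n x - f x)) \<longlonglongrightarrow> 0" for V J
  proof -
    interpret C: function_hilbert_space V J by fact
    have cross: "(\<lambda>n. J (\<lambda>x. G n x - f x) f) \<longlonglongrightarrow> 0"
    proof -
      have "(J (\<lambda>x. G n x - f x) f)\<^sup>2 \<le> J (\<lambda>x. G n x - f x) (\<lambda>x. G n x - f x) * J f f" for n
      proof (rule discriminant_bound)
        have m: "(\<lambda>x. G n x - f x) \<in> V" using that by (intro C.diff_mem)
        show "0 \<le> J (\<lambda>x. G n x - f x) (\<lambda>x. G n x - f x) + 2 * c * J (\<lambda>x. G n x - f x) f + c\<^sup>2 * J f f" for c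
          using C.norm_add_scaled[OF m that(3), of c]
            C.ip_nonneg[OF C.add_mem[OF m C.scale_mem[OF that(3), of c]]] by simp
        show "0 \<le> J f f" using that by (intro C.ip_nonneg)
      qed
      moreover have "(\<lambda>n. J (\<lambda>x. G n x - f x) (\<lambda>x. G n x - f x) * J f f) \<longlonglongrightarrow> 0"
        using tendsto_mult_right[OF that(4), of "J f f"] by simp
      ultimately show ?thesis by (rule null_sequence_if_square_le)
    qed
    have "J (G n) (G n) = J f f + 2 * J (\<lambda>x. G n x - f x) f + J (\<lambda>x. G n x - f x) (\<lambda>x. G n x - f x)" for n
      using C.norm_diff[OF that(2,3)] C.ip_add_scaled[OF that(2,3,3), of n "-1"] by simp
    moreover have "(\<lambda>n. J f f + 2 * J (\<lambda>x. G n x - f x) f + J (\<lambda>x. G n x - f x) (\<lambda>x. G n x - f x))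
        \<longlonglongrightarrow> J f f + 2 * 0 + 0"
      by (intro tendsto_intros cross that)
    ultimately show ?thesis by simp
  qed
  have "(\<lambda>n. ip (G n) (G n)) \<longlonglongrightarrow> ip f f"
    by (rule normlim[OF A.function_hilbert_space_axioms GA assms(3) lim])
  moreover have "(\<lambda>n. ip (G n) (G n)) \<longlonglongrightarrow> ip' f f"
    using normlim[OF B.function_hilbert_space_axioms GB] p pf
    by (simp add: kernel_span_ip_unique[OF assms(1,2) G G])
  ultimately show ?thesis using p(1) pf LIMSEQ_unique by blast
qed

lemma rkhs_unique:
  assumes "rkhs H ip K" "rkhs H' ip' K"
  shows "H = H'" and "f \<in> H \<Longrightarrow> g \<in> H \<Longrightarrow> ip f g = ip' f g"
proof -
  interpret A: rkhs H ip K by fact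
  interpret B: rkhs H' ip' K by fact
  show "H = H'"
    using rkhs_subset_isometric[OF assms] rkhs_subset_isometric[OF assms(2,1)] by blast
  assume fg: "f \<in> H" "g \<in> H"
  then have fg': "f \<in> H'" "g \<in> H'" using \<open>H = H'\<close> by auto
  show "ip f g = ip' f g"
    using A.norm_diff[OF fg] B.norm_diff[OF fg'] rkhs_subset_isometric[OF assms fg(1)]
      rkhs_subset_isometric[OF assms fg(2)] rkhs_subset_isometric[OF assms A.diff_mem[OF fg]] by simp
qed

section \<open>The space generated by an independent square-summable family\<close>

text \<open>Sequences are forced to vanish outside \<open>I\<close>, so that a coefficient sequence is determined by the function that
it represents.\<close>
definition l2 :: "'i set \<Rightarrow> ('i \<Rightarrow> real) set" where
  "l2 I = {c. (\<forall>i. i \<notin> I \<longrightarrow> c i = 0) \<and> (\<lambda>i. (c i)\<^sup>2) summable_on I}"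

lemma summable_on_mult_of_squares:
  fixes a b :: "'i \<Rightarrow> real"
  assumes "(\<lambda>i. (a i)\<^sup>2) summable_on I" "(\<lambda>i. (b i)\<^sup>2) summable_on I"
  shows "(\<lambda>i. a i * b i) summable_on I"
proof -
  have "(\<lambda>i. (a i)\<^sup>2 + (b i)\<^sup>2) summable_on I"
    using assms by (rule summable_on_add)
  moreover have "norm (a i * b i) \<le> (a i)\<^sup>2 + (b i)\<^sup>2" for i
  proof -
    have "\<bar>a i\<bar> * \<bar>b i\<bar> \<le> 2 * \<bar>a i\<bar> * \<bar>b i\<bar>" by simp
    also have "\<dots> \<le> (a i)\<^sup>2 + (b i)\<^sup>2"
      using sum_squares_bound[of "\<bar>a i\<bar>" "\<bar>b i\<bar>"] by simp
    finally show ?thesis by (simp add: abs_mult)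
  qed
  ultimately have "(\<lambda>i. norm (a i * b i)) summable_on I"
    by (rule summable_on_comparison_test) auto
  then show ?thesis by (rule abs_summable_summable)
qed

lemma l2_mult: "c \<in> l2 I \<Longrightarrow> d \<in> l2 I \<Longrightarrow> (\<lambda>i. c i * d i) summable_on I"
  by (auto simp: l2_def intro: summable_on_mult_of_squares)

lemma l2_zero: "(\<lambda>i. 0) \<in> l2 I" by (simp add: l2_def)

lemma l2_add: "c \<in> l2 I \<Longrightarrow> d \<in> l2 I \<Longrightarrow> (\<lambda>i. c i + d i) \<in> l2 I"
proof -
  assume cd: "c \<in> l2 I" "d \<in> l2 I"
  then have "(\<lambda>i. (c i)\<^sup>2 + 2 * (c i * d i) + (d i)\<^sup>2) summable_on I"
    by (intro summable_on_add summable_on_cmult_right l2_mult) (auto simp: l2_def)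
  then have "(\<lambda>i. (c i + d i)\<^sup>2) summable_on I"
    by (rule back_subst[of "\<lambda>f. f summable_on I"]) (auto simp: power2_eq_square algebra_simps)
  then show ?thesis using cd by (simp add: l2_def)
qed

lemma l2_scale: "c \<in> l2 I \<Longrightarrow> (\<lambda>i. r * c i) \<in> l2 I"
  by (auto simp: l2_def power_mult_distrib intro: summable_on_cmult_right)

lemma l2_diff: "c \<in> l2 I \<Longrightarrow> d \<in> l2 I \<Longrightarrow> (\<lambda>i. c i - d i) \<in> l2 I"
  using l2_add[OF _ l2_scale[of d I "- 1"], of c] by simp

lemma l2_finite_support: "finite J \<Longrightarrow> J \<subseteq> I \<Longrightarrow> (\<And>i. i \<notin> J \<Longrightarrow> c i = 0) \<Longrightarrow> c \<in> l2 I"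
  unfolding l2_def using summable_on_cong_neutral[of I J "\<lambda>i. (c i)\<^sup>2" "\<lambda>i. (c i)\<^sup>2"] by auto

text \<open>Coordinatewise limits exist, and the Cauchy bound passes to the limit on each finite set of
coordinates, hence to the infinite sum.\<close>
lemma l2_complete:
  assumes c: "\<And>n. c n \<in> l2 I"
    and cauchy: "\<And>\<epsilon>. \<epsilon> > 0 \<Longrightarrow> \<exists>N. \<forall>m\<ge>N. \<forall>n\<ge>N. (\<Sum>\<^sub>\<infinity>i\<in>I. (c m i - c n i)\<^sup>2) < \<epsilon>"
  obtains d where "d \<in> l2 I" "(\<lambda>n. \<Sum>\<^sub>\<infinity>i\<in>I. (c n i - d i)\<^sup>2) \<longlonglongrightarrow> 0"
proof -
  have fin: "(\<Sum>i\<in>J. (c m i - c n i)\<^sup>2) \<le> (\<Sum>\<^sub>\<infinity>i\<in>I. (c m i - c n i)\<^sup>2)"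
    if "finite J" "J \<subseteq> I" for J m n
    using that l2_diff[OF c c, of m n] by (intro finite_sum_le_infsum) (auto simp: l2_def)
  have "Cauchy (\<lambda>n. c n i)" for i
  proof (cases "i \<in> I")
    case True
    show ?thesis
    proof (rule metric_CauchyI)
      fix e :: real assume "e > 0"
      then have "e\<^sup>2 > 0" by simp
      from cauchy[OF this] obtain N
        where N: "\<And>m n. m \<ge> N \<Longrightarrow> n \<ge> N \<Longrightarrow> (\<Sum>\<^sub>\<infinity>i\<in>I. (c m i - c n i)\<^sup>2) < e\<^sup>2" by blast
      have "dist (c m i) (c n i) < e" if "m \<ge> N" "n \<ge> N" for m n
      proof -
        have "(c m i - c n i)\<^sup>2 < e\<^sup>2"
          using fin[of "{i}" m n] N[OF that] True by simp
        then show ?thesis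
          using \<open>e > 0\<close> power2_less_imp_less[of "\<bar>c m i - c n i\<bar>" e] by (simp add: dist_real_def)
      qed
      then show "\<exists>N. \<forall>m\<ge>N. \<forall>n\<ge>N. dist (c m i) (c n i) < e" by blast
    qed
  next
    case False
    then have "c n i = 0" for n using c[of n] by (simp add: l2_def)
    then show ?thesis by (simp add: Cauchy_def)
  qed
  then have "\<exists>d. (\<lambda>n. c n i) \<longlonglongrightarrow> d" for i
    by (simp add: Cauchy_convergent_iff convergent_def)
  then obtain d where d: "\<And>i. (\<lambda>n. c n i) \<longlonglongrightarrow> d i" by metis
  have lim: "(\<Sum>i\<in>J. (c m i - d i)\<^sup>2) \<le> \<epsilon>"
    if "finite J" "J \<subseteq> I" and N: "\<And>n. n \<ge> N \<Longrightarrow> (\<Sum>\<^sub>\<infinity>i\<in>I. (c m i - c n i)\<^sup>2) < \<epsilon>" for J m N \<epsilon>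
  proof (rule tendsto_upperbound)
    show "(\<lambda>n. \<Sum>i\<in>J. (c m i - c n i)\<^sup>2) \<longlonglongrightarrow> (\<Sum>i\<in>J. (c m i - d i)\<^sup>2)"
      by (intro tendsto_intros d)
    show "\<forall>\<^sub>F n in sequentially. (\<Sum>i\<in>J. (c m i - c n i)\<^sup>2) \<le> \<epsilon>"
      using fin[OF that(1,2), of m] N
      by (intro eventually_sequentiallyI[of N]) (meson less_imp_le order_trans)
  qed simp
  have off: "d i = 0" if "i \<notin> I" for i
  proof -
    have "c n i = 0" for n using c[of n] that by (simp add: l2_def)
    then have "(\<lambda>n. c n i) \<longlonglongrightarrow> 0" by simp
    from LIMSEQ_unique[OF d this] show ?thesis .
  qed
  have memd: "(\<lambda>i. c m i - d i) \<in> l2 I" and le: "(\<Sum>\<^sub>\<infinity>i\<in>I. (c m i - d i)\<^sup>2) \<le> \<epsilon>"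
    if "\<And>n. n \<ge> N \<Longrightarrow> (\<Sum>\<^sub>\<infinity>i\<in>I. (c m i - c n i)\<^sup>2) < \<epsilon>" for m N \<epsilon>
  proof -
    have "(\<lambda>i. (c m i - d i)\<^sup>2) summable_on I"
      by (rule nonneg_bdd_above_summable_on) (auto intro!: bdd_aboveI2[of _ _ \<epsilon>] lim[OF _ _ that])
    then show "(\<lambda>i. c m i - d i) \<in> l2 I" using off c[of m] by (simp add: l2_def)
    show "(\<Sum>\<^sub>\<infinity>i\<in>I. (c m i - d i)\<^sup>2) \<le> \<epsilon>"
      by (rule infsum_le_finite_sums[OF \<open>(\<lambda>i. (c m i - d i)\<^sup>2) summable_on I\<close>]) (rule lim[OF _ _ that])
  qed
  obtain N where "\<And>m n. m \<ge> N \<Longrightarrow> n \<ge> N \<Longrightarrow> (\<Sum>\<^sub>\<infinity>i\<in>I. (c m i - c n i)\<^sup>2) < 1"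
    using cauchy[of 1] by auto
  then have "(\<lambda>i. c N i - d i) \<in> l2 I" by (intro memd[of N N 1]) auto
  from l2_diff[OF c[of N] this] have dl: "d \<in> l2 I" by simp
  have "(\<lambda>n. \<Sum>\<^sub>\<infinity>i\<in>I. (c n i - d i)\<^sup>2) \<longlonglongrightarrow> 0"
  proof (rule LIMSEQ_I)
    fix r :: real assume "0 < r"
    then have "0 < r / 2" by simp
    from cauchy[OF this] obtain N
      where N: "\<And>m n. m \<ge> N \<Longrightarrow> n \<ge> N \<Longrightarrow> (\<Sum>\<^sub>\<infinity>i\<in>I. (c m i - c n i)\<^sup>2) < r / 2" by blast
    have "norm ((\<Sum>\<^sub>\<infinity>i\<in>I. (c m i - d i)\<^sup>2) - 0) < r" if "m \<ge> N" for m
    proof -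
      have "0 \<le> (\<Sum>\<^sub>\<infinity>i\<in>I. (c m i - d i)\<^sup>2)" by (rule infsum_nonneg) simp
      moreover have "(\<Sum>\<^sub>\<infinity>i\<in>I. (c m i - d i)\<^sup>2) \<le> r / 2" using N that by (intro le[of N]) auto
      ultimately show ?thesis using \<open>0 < r\<close> by simp
    qed
    then show "\<exists>N. \<forall>n\<ge>N. norm ((\<Sum>\<^sub>\<infinity>i\<in>I. (c n i - d i)\<^sup>2) - 0) < r" by blast
  qed
  with dl show ?thesis by (rule that)
qed

text \<open>Without independence the \<open>e i\<close> would in general only form a Parseval frame of the space.\<close>
locale l2_features =
  fixes I :: "'i set" and e :: "'i \<Rightarrow> 'a \<Rightarrow> real" and K :: "'a \<Rightarrow> 'a \<Rightarrow> real"
  assumes square_summable: "(\<lambda>i. (e i t)\<^sup>2) summable_on I"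
    and kernel_expansion: "K s t = (\<Sum>\<^sub>\<infinity>i\<in>I. e i s * e i t)"
    and independent: "c \<in> l2 I \<Longrightarrow> (\<And>t. (\<Sum>\<^sub>\<infinity>i\<in>I. c i * e i t) = 0) \<Longrightarrow> i \<in> I \<Longrightarrow> c i = 0"
begin

definition synth :: "('i \<Rightarrow> real) \<Rightarrow> 'a \<Rightarrow> real" where
  "synth c t = (\<Sum>\<^sub>\<infinity>i\<in>I. c i * e i t)"

definition coeffs :: "('a \<Rightarrow> real) \<Rightarrow> 'i \<Rightarrow> real" where
  "coeffs = inv_into (l2 I) synth"

definition ip0 :: "('a \<Rightarrow> real) \<Rightarrow> ('a \<Rightarrow> real) \<Rightarrow> real" where
  "ip0 f g = (\<Sum>\<^sub>\<infinity>i\<in>I. coeffs f i * coeffs g i)"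

lemma terms_summable: "c \<in> l2 I \<Longrightarrow> (\<lambda>i. c i * e i t) summable_on I"
  by (rule summable_on_mult_of_squares) (auto simp: l2_def square_summable)

lemma synth_add: "c \<in> l2 I \<Longrightarrow> d \<in> l2 I \<Longrightarrow> synth (\<lambda>i. c i + d i) = (\<lambda>t. synth c t + synth d t)"
  by (simp add: synth_def fun_eq_iff distrib_right infsum_add terms_summable)

lemma synth_scale: "synth (\<lambda>i. r * c i) = (\<lambda>t. r * synth c t)"
  by (simp add: synth_def fun_eq_iff mult.assoc infsum_cmult_right')

lemma synth_diff: "c \<in> l2 I \<Longrightarrow> d \<in> l2 I \<Longrightarrow> synth (\<lambda>i. c i - d i) = (\<lambda>t. synth c t - synth d t)"
  using synth_add[OF _ l2_scale[of d I "- 1"], of c] synth_scale[of "- 1" d] by simp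

lemma synth_zero: "synth (\<lambda>i. 0) = (\<lambda>t. 0)"
  by (simp add: synth_def fun_eq_iff)

lemma synth_inj: "inj_on synth (l2 I)"
proof (rule inj_onI)
  fix c d assume cd: "c \<in> l2 I" "d \<in> l2 I" and eq: "synth c = synth d"
  have "c i - d i = 0" if "i \<in> I" for i
  proof (rule independent[OF l2_diff[OF cd] _ that])
    show "(\<Sum>\<^sub>\<infinity>i\<in>I. (c i - d i) * e i t) = 0" for t
      using fun_cong[OF synth_diff[OF cd], of t] eq by (simp add: synth_def)
  qed
  with cd show "c = d" by (fastforce simp: l2_def)
qed

lemma coeffs_synth [simp]: "c \<in> l2 I \<Longrightarrow> coeffs (synth c) = c"
  unfolding coeffs_def by (rule inv_into_f_f[OF synth_inj])

lemma ip0_synth: "c \<in> l2 I \<Longrightarrow> d \<in> l2 I \<Longrightarrow> ip0 (synth c) (synth d) = (\<Sum>\<^sub>\<infinity>i\<in>I. c i * d i)"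
  by (simp add: ip0_def)

lemma norm0_synth: "c \<in> l2 I \<Longrightarrow> ip0 (synth c) (synth c) = (\<Sum>\<^sub>\<infinity>i\<in>I. (c i)\<^sup>2)"
  by (simp add: ip0_synth power2_eq_square)

lemma section_synth: "(\<lambda>s. K s t) = synth (\<lambda>i. if i \<in> I then e i t else 0)"
  by (rule ext) (auto simp: kernel_expansion synth_def mult.commute intro!: infsum_cong)

lemma section_l2: "(\<lambda>i. if i \<in> I then e i t else 0) \<in> l2 I"
  using square_summable[of t] by (auto simp: l2_def cong: summable_on_cong)

text \<open>The synthesis map is injective, so its range inherits the structure of the sequence space. The section at
\<open>t\<close> has the coefficients \<open>e i t\<close>, and the reproducing property is then the definition of the synthesis map.\<close>
lemma rkhs_synth: "rkhs (synth ` l2 I) ip0 K"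
proof
  show "(\<lambda>x. 0) \<in> synth ` l2 I"
    using imageI[OF l2_zero, of synth] by (simp add: synth_zero)
  show "(\<lambda>x. f x + g x) \<in> synth ` l2 I" if "f \<in> synth ` l2 I" "g \<in> synth ` l2 I" for f g
  proof -
    from that obtain a b where "f = synth a" "g = synth b" "a \<in> l2 I" "b \<in> l2 I" by blast
    then show ?thesis by (auto intro!: l2_add simp flip: synth_add)
  qed
  show "(\<lambda>x. r * f x) \<in> synth ` l2 I" if "f \<in> synth ` l2 I" for f r
    using that by (auto intro!: l2_scale simp flip: synth_scale)
  show "ip0 f g = ip0 g f" for f g by (simp add: ip0_def mult.commute)
  show "ip0 (\<lambda>x. f x + g x) h = ip0 f h + ip0 g h"
    if fgh: "f \<in> synth ` l2 I" "g \<in> synth ` l2 I" "h \<in> synth ` l2 I" for f g h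
  proof -
    from fgh obtain a b c where "f = synth a" "g = synth b" "h = synth c"
      and m: "a \<in> l2 I" "b \<in> l2 I" "c \<in> l2 I" by blast
    then show ?thesis
      by (simp add: ip0_synth l2_add distrib_right infsum_add l2_mult flip: synth_add)
  qed
  show "ip0 (\<lambda>x. r * f x) g = r * ip0 f g"
    if fg: "f \<in> synth ` l2 I" "g \<in> synth ` l2 I" for f g r
  proof -
    from fg obtain a b where "f = synth a" "g = synth b" and m: "a \<in> l2 I" "b \<in> l2 I" by blast
    then show ?thesis
      by (simp add: ip0_synth l2_scale mult.assoc infsum_cmult_right' flip: synth_scale)
  qed
  show "0 \<le> ip0 f f" for f by (simp add: ip0_def infsum_nonneg)
  show "f = (\<lambda>x. 0)" if f: "f \<in> synth ` l2 I" "ip0 f f = 0" for f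
  proof -
    from f obtain c where c: "f = synth c" "c \<in> l2 I" by blast
    then have 0: "(\<Sum>\<^sub>\<infinity>i\<in>I. (c i)\<^sup>2) = 0" using f(2) by (simp add: norm0_synth)
    have "c i = 0" if "i \<in> I" for i
      using nonneg_infsum_le_0D[of "\<lambda>i. (c i)\<^sup>2" I i] 0 c(2) that by (simp add: l2_def)
    then have "c = (\<lambda>i. 0)" using c(2) by (auto simp: l2_def)
    then show ?thesis using c(1) synth_zero by simp
  qed
  show "(\<lambda>s. K s t) \<in> synth ` l2 I" for t
    unfolding section_synth by (rule imageI[OF section_l2])
  show "ip0 f (\<lambda>s. K s t) = f t" if f: "f \<in> synth ` l2 I" for f t
  proof -
    from f obtain c where c: "f = synth c" "c \<in> l2 I" by blast
    then show ?thesis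
      by (simp only: section_synth ip0_synth section_l2)
        (auto simp: synth_def intro!: infsum_cong)
  qed
  fix F :: "nat \<Rightarrow> 'a \<Rightarrow> real"
  assume F: "\<And>n. F n \<in> synth ` l2 I"
    and cauchy: "\<And>\<epsilon>. \<epsilon> > 0 \<Longrightarrow> \<exists>N. \<forall>m\<ge>N. \<forall>n\<ge>N.
          sqrt (ip0 (\<lambda>x. F m x - F n x) (\<lambda>x. F m x - F n x)) < \<epsilon>"
  define c where "c n = coeffs (F n)" for n
  have c: "c n \<in> l2 I" "F n = synth (c n)" for n
    using F[of n] by (auto simp: c_def)
  have dist: "ip0 (\<lambda>x. F m x - synth d x) (\<lambda>x. F m x - synth d x) = (\<Sum>\<^sub>\<infinity>i\<in>I. (c m i - d i)\<^sup>2)"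
    if "d \<in> l2 I" for m d
    using that c by (simp add: norm0_synth l2_diff flip: synth_diff)
  have distF: "ip0 (\<lambda>x. F m x - F n x) (\<lambda>x. F m x - F n x) = (\<Sum>\<^sub>\<infinity>i\<in>I. (c m i - c n i)\<^sup>2)" for m n
    using dist[OF c(1)[of n], of m] by (simp only: c(2)[of n])
  have "\<exists>d. d \<in> l2 I \<and> (\<lambda>n. \<Sum>\<^sub>\<infinity>i\<in>I. (c n i - d i)\<^sup>2) \<longlonglongrightarrow> 0"
  proof (rule l2_complete[OF c(1)])
    fix \<epsilon> :: real assume "\<epsilon> > 0"
    then have "sqrt \<epsilon> > 0" by simp
    from cauchy[OF this] show "\<exists>N. \<forall>m\<ge>N. \<forall>n\<ge>N. (\<Sum>\<^sub>\<infinity>i\<in>I. (c m i - c n i)\<^sup>2) < \<epsilon>"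
      by (simp add: distF)
  qed blast
  then obtain d where d: "d \<in> l2 I" "(\<lambda>n. \<Sum>\<^sub>\<infinity>i\<in>I. (c n i - d i)\<^sup>2) \<longlonglongrightarrow> 0" by blast
  have "(\<lambda>n. sqrt (ip0 (\<lambda>x. F n x - synth d x) (\<lambda>x. F n x - synth d x))) \<longlonglongrightarrow> 0"
    using tendsto_real_sqrt[OF d(2)] by (simp add: dist[OF d(1)])
  with d(1) show "\<exists>f\<in>synth ` l2 I. (\<lambda>n. sqrt (ip0 (\<lambda>x. F n x - f x) (\<lambda>x. F n x - f x))) \<longlonglongrightarrow> 0"
    by blast
qed

lemma unit_l2: "i \<in> I \<Longrightarrow> (\<lambda>j. if j = i then 1 else 0) \<in> l2 I"
  by (rule l2_finite_support[of "{i}"]) auto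

lemma finite_synth:
  assumes "finite J" "J \<subseteq> I"
  shows "synth (\<lambda>i. if i \<in> J then c i else 0) = (\<lambda>x. \<Sum>j\<in>J. c j * e j x)"
proof
  fix x
  have "(\<Sum>\<^sub>\<infinity>i\<in>I. (if i \<in> J then c i else 0) * e i x) = (\<Sum>\<^sub>\<infinity>i\<in>J. c i * e i x)"
    using assms by (intro infsum_cong_neutral) auto
  then show "synth (\<lambda>i. if i \<in> J then c i else 0) x = (\<Sum>j\<in>J. c j * e j x)"
    using assms by (simp add: synth_def)
qed

lemma feature_synth: "i \<in> I \<Longrightarrow> e i = synth (\<lambda>j. if j = i then 1 else 0)"
  using finite_synth[of "{i}" "\<lambda>_. 1"] by simp

lemma orthonormal_basis_synth: "orthonormal_basis (synth ` l2 I) ip0 I e"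
  unfolding orthonormal_basis_def
proof (intro conjI ballI allI impI)
  show "e i \<in> synth ` l2 I" if "i \<in> I" for i
    using feature_synth[OF that] unit_l2[OF that] by simp
  show "ip0 (e i) (e j) = (if i = j then 1 else 0)" if "i \<in> I" "j \<in> I" for i j
  proof -
    have "ip0 (e i) (e j) = (\<Sum>\<^sub>\<infinity>k\<in>I. (if k = i then 1 else 0) * (if k = j then 1 else 0))"
      using that by (simp add: feature_synth ip0_synth unit_l2)
    also have "\<dots> = (\<Sum>\<^sub>\<infinity>k\<in>{i}. (if k = i then 1 else 0) * (if k = j then 1 else 0))"
      using that by (intro infsum_cong_neutral) auto
    finally show ?thesis by simp
  qed
  fix f and \<epsilon> :: real assume f: "f \<in> synth ` l2 I" and "0 < \<epsilon>"
  then obtain c where c: "c \<in> l2 I" "f = synth c" by blast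
  have "0 < \<epsilon>\<^sup>2 / 2" using \<open>0 < \<epsilon>\<close> by simp
  have sum: "(\<lambda>i. (c i)\<^sup>2) summable_on I" using c by (simp add: l2_def)
  obtain J where J: "finite J" "J \<subseteq> I"
    and close: "dist (\<Sum>i\<in>J. (c i)\<^sup>2) (\<Sum>\<^sub>\<infinity>i\<in>I. (c i)\<^sup>2) \<le> \<epsilon>\<^sup>2 / 2"
    using infsum_finite_approximation[OF sum \<open>0 < \<epsilon>\<^sup>2 / 2\<close>] by blast
  define d where "d = (\<lambda>i. if i \<in> J then c i else 0)"
  have d: "d \<in> l2 I" unfolding d_def by (rule l2_finite_support[OF J]) simp
  have sumd: "(\<lambda>i. (d i)\<^sup>2) summable_on I" using d by (simp add: l2_def)
  have "(\<lambda>x. f x - (\<Sum>j\<in>J. c j * e j x)) = synth (\<lambda>i. c i - d i)"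
    using synth_diff[OF c(1) d] finite_synth[OF J, of c] c(2) by (simp add: d_def)
  then have "ip0 (\<lambda>x. f x - (\<Sum>j\<in>J. c j * e j x)) (\<lambda>x. f x - (\<Sum>j\<in>J. c j * e j x))
      = (\<Sum>\<^sub>\<infinity>i\<in>I. (c i - d i)\<^sup>2)"
    using norm0_synth[OF l2_diff[OF c(1) d]] by simp
  also have "\<dots> = (\<Sum>\<^sub>\<infinity>i\<in>I. (c i)\<^sup>2 + - ((d i)\<^sup>2))"
    by (rule infsum_cong) (simp add: d_def)
  also have "\<dots> = (\<Sum>\<^sub>\<infinity>i\<in>I. (c i)\<^sup>2) - (\<Sum>\<^sub>\<infinity>i\<in>I. (d i)\<^sup>2)"
    using infsum_add[OF sum summable_on_uminus[THEN iffD2, OF sumd]] by (simp only: infsum_uminus)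
  also have "(\<Sum>\<^sub>\<infinity>i\<in>I. (d i)\<^sup>2) = (\<Sum>\<^sub>\<infinity>i\<in>J. (c i)\<^sup>2)"
    using J by (intro infsum_cong_neutral) (auto simp: d_def)
  finally have "ip0 (\<lambda>x. f x - (\<Sum>j\<in>J. c j * e j x)) (\<lambda>x. f x - (\<Sum>j\<in>J. c j * e j x)) \<le> \<epsilon>\<^sup>2 / 2"
    using J abs_le_D1[OF close[unfolded dist_real_def abs_minus_commute[of "sum _ _"]]] by simp
  also have "\<dots> < \<epsilon>\<^sup>2" using \<open>0 < \<epsilon>\<close> by simp
  finally have lt: "ip0 (\<lambda>x. f x - (\<Sum>j\<in>J. c j * e j x)) (\<lambda>x. f x - (\<Sum>j\<in>J. c j * e j x)) < \<epsilon>\<^sup>2" .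
  have "sqrt (ip0 (\<lambda>x. f x - (\<Sum>j\<in>J. c j * e j x)) (\<lambda>x. f x - (\<Sum>j\<in>J. c j * e j x))) < \<epsilon>"
    using real_sqrt_less_mono[OF lt] \<open>0 < \<epsilon>\<close> by simp
  with J show "\<exists>J c. finite J \<and> J \<subseteq> I \<and>
      sqrt (ip0 (\<lambda>x. f x - (\<Sum>j\<in>J. c j * e j x)) (\<lambda>x. f x - (\<Sum>j\<in>J. c j * e j x))) < \<epsilon>"
    by blast
qed

lemma orthonormal_basis_rkhs:
  assumes "rkhs H ip K"
  shows "orthonormal_basis H ip I e"
proof -
  interpret A: rkhs "synth ` l2 I" ip0 K by (rule rkhs_synth)
  note eqs = rkhs_unique[OF rkhs_synth assms]
  have e: "e i \<in> synth ` l2 I" if "i \<in> I" for i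
    using orthonormal_basis_synth that by (simp add: orthonormal_basis_def)
  have rem: "(\<lambda>x. f x - (\<Sum>j\<in>J. c j * e j x)) \<in> synth ` l2 I"
    if "f \<in> synth ` l2 I" "finite J" "J \<subseteq> I" for f J c
    using that e by (intro A.diff_mem A.sum_mem) auto
  show ?thesis
    unfolding orthonormal_basis_def eqs(1)[symmetric]
  proof (intro conjI ballI allI impI)
    fix f and \<epsilon> :: real assume f: "f \<in> synth ` l2 I" and "0 < \<epsilon>"
    then obtain J c where "finite J" "J \<subseteq> I"
      "sqrt (ip0 (\<lambda>x. f x - (\<Sum>j\<in>J. c j * e j x)) (\<lambda>x. f x - (\<Sum>j\<in>J. c j * e j x))) < \<epsilon>"
      using orthonormal_basis_synth unfolding orthonormal_basis_def by blast
    with eqs(2)[OF rem rem] f show "\<exists>J c. finite J \<and> J \<subseteq> I \<and>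
      sqrt (ip (\<lambda>x. f x - (\<Sum>j\<in>J. c j * e j x)) (\<lambda>x. f x - (\<Sum>j\<in>J. c j * e j x))) < \<epsilon>"
      by (intro exI[of _ J] exI[of _ c]) simp
  next
    fix i j assume ij: "i \<in> I" "j \<in> I"
    have "ip (e i) (e j) = ip0 (e i) (e j)" by (rule eqs(2)[OF e e, symmetric]) (use ij in auto)
    also have "\<dots> = (if i = j then 1 else 0)"
      using orthonormal_basis_synth ij unfolding orthonormal_basis_def by blast
    finally show "ip (e i) (e j) = (if i = j then 1 else 0)" .
  qed (rule e)
qed

end

section \<open>Matern kernels of half-integer order\<close>

text \<open>The entire part of the modified Bessel function: \<open>I\<^sub>a(x) = (x/2)\<^sup>a\<close> times this function at
\<open>x\<^sup>2/4\<close>.\<close>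
definition bessel_series :: "real \<Rightarrow> real \<Rightarrow> real" where
  "bessel_series a z = (\<Sum>k. (rGamma (real k + a + 1) / fact k) * z ^ k)"

lemma summable_bessel_series: "summable (\<lambda>k. (rGamma (real k + a + 1) / fact k) * z ^ k)"
proof (rule summable_ratio_test)
  let ?N = "nat \<lceil>\<bar>a\<bar> + 2 * \<bar>z\<bar>\<rceil>"
  show "(1 / 2 :: real) < 1" by simp
  fix n assume "n \<ge> ?N"
  then have n: "real n \<ge> \<bar>a\<bar> + 2 * \<bar>z\<bar>" by linarith
  have rec: "rGamma (real n + a + 1) = (real n + a + 1) * rGamma (real (Suc n) + a + 1)"
    using rGamma_plus1[of "real n + a + 1"] by (simp add: algebra_simps)
  have "\<bar>z\<bar> \<le> \<bar>real n + a + 1\<bar> * real (Suc n) / 2"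
  proof -
    have "1 \<le> \<bar>real n + a + 1\<bar>" using n by linarith
    then have "1 * real (Suc n) \<le> \<bar>real n + a + 1\<bar> * real (Suc n)" by (intro mult_right_mono) auto
    then have "real (Suc n) \<le> \<bar>real n + a + 1\<bar> * real (Suc n)" by (simp only: mult_1)
    moreover have "2 * \<bar>z\<bar> \<le> real (Suc n)" using n by simp
    ultimately have "2 * \<bar>z\<bar> \<le> \<bar>real n + a + 1\<bar> * real (Suc n)" by (rule order_trans[rotated])
    then show ?thesis by simp
  qed
  then have "\<bar>rGamma (real (Suc n) + a + 1)\<bar> * \<bar>z\<bar> ^ n * \<bar>z\<bar>
     \<le> \<bar>rGamma (real (Suc n) + a + 1)\<bar> * \<bar>z\<bar> ^ n * (\<bar>real n + a + 1\<bar> * real (Suc n) / 2)"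
    by (intro mult_left_mono) auto
  then have "\<bar>rGamma (real (Suc n) + a + 1)\<bar> * \<bar>z\<bar> ^ n * \<bar>z\<bar> / fact (Suc n)
     \<le> \<bar>rGamma (real (Suc n) + a + 1)\<bar> * \<bar>z\<bar> ^ n * (\<bar>real n + a + 1\<bar> * real (Suc n) / 2) / fact (Suc n)"
    by (intro divide_right_mono) auto
  also have "\<dots> = 1 / 2 * norm ((rGamma (real n + a + 1) / fact n) * z ^ n)"
  proof -
    have "fact (Suc n) = real (Suc n) * fact n" by simp
    then show ?thesis unfolding rec real_norm_def abs_mult abs_divide power_abs by simp
  qed
  finally show "norm ((rGamma (real (Suc n) + a + 1) / fact (Suc n)) * z ^ Suc n)
      \<le> 1 / 2 * norm ((rGamma (real n + a + 1) / fact n) * z ^ n)"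
    unfolding real_norm_def abs_mult abs_divide power_abs power_Suc by (simp add: mult_ac del: fact_Suc of_nat_Suc)
qed

lemma bessel_series_deriv:
  "(bessel_series a has_real_derivative bessel_series (a + 1) z) (at z)"
proof -
  let ?c = "\<lambda>k. rGamma (real k + a + 1) / fact k"
  have "diffs ?c = (\<lambda>k. rGamma (real k + (a + 1) + 1) / fact k)"
    by (simp add: diffs_def fun_eq_iff add_ac)
  with termdiffs_strong_converges_everywhere[OF summable_bessel_series[of a]]
  show ?thesis by (simp add: bessel_series_def[abs_def])
qed

lemma bessel_series_deriv_chain [derivative_intros]:
  "(f has_real_derivative f') (at x within s) \<Longrightarrow>
   ((\<lambda>x. bessel_series a (f x)) has_real_derivative bessel_series (a + 1) (f x) * f') (at x within s)"
  by (rule DERIV_chain2[OF bessel_series_deriv])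

text \<open>The three-term recurrence of the Bessel functions, from \<open>\<Gamma>(z+1) = z \<Gamma>(z)\<close> in each coefficient.\<close>
lemma bessel_series_rec:
  "bessel_series (a - 1) z = z * bessel_series (a + 1) z + a * bessel_series a z"
proof -
  let ?c = "\<lambda>k. rGamma (real k + a + 1) / fact k"
  have "diffs ?c = (\<lambda>k. rGamma (real k + (a + 1) + 1) / fact k)"
    by (simp add: diffs_def fun_eq_iff add_ac)
  then have "(\<lambda>k. real k * ?c k * z ^ (k - Suc 0)) sums bessel_series (a + 1) z"
    using diffs_equiv[of ?c z] summable_bessel_series[of "a + 1" z] by (simp add: bessel_series_def)
  from sums_add[OF sums_mult[OF this, of z]
      sums_mult[OF summable_sums[OF summable_bessel_series], of a a z]]
  have "(\<lambda>k. z * (real k * ?c k * z ^ (k - Suc 0)) + a * (?c k * z ^ k)) sums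
      (z * bessel_series (a + 1) z + a * bessel_series a z)" by (simp add: bessel_series_def)
  moreover have "z * (real k * ?c k * z ^ (k - Suc 0)) + a * (?c k * z ^ k)
      = rGamma (real k + (a - 1) + 1) / fact k * z ^ k" for k
  proof -
    have "z * (real k * z ^ (k - Suc 0)) = real k * z ^ k" by (cases k) simp_all
    moreover have "z * (real k * ?c k * z ^ (k - Suc 0)) = ?c k * (z * (real k * z ^ (k - Suc 0)))"
      by (simp only: mult_ac)
    ultimately have "z * (real k * ?c k * z ^ (k - Suc 0)) + a * (?c k * z ^ k) = ?c k * z ^ k * (real k + a)"
      by (simp only: distrib_left distrib_right mult_ac)
    also have "\<dots> = (real k + a) * rGamma (real k + a + 1) / fact k * z ^ k" by simp
    finally show ?thesis by (simp only: rGamma_plus1) simp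
  qed
  ultimately show ?thesis by (simp add: bessel_series_def sums_iff)
qed

text \<open>The Matern profile of order \<open>n + 1/2\<close>. For half-integer order the powers \<open>(x/2)\<^sup>2\<^sup>a\<close> have an odd integer
exponent, so the profile extends to an entire function; this makes its initial values at \<open>0\<close> available.\<close>
definition matern_entire :: "nat \<Rightarrow> real \<Rightarrow> real" where
  "matern_entire n x = Gamma (1 / 2 - real n) *
     (bessel_series (- (real n + 1 / 2)) (x\<^sup>2 / 4)
      - (x / 2) ^ (2 * n + 1) * bessel_series (real n + 1 / 2) (x\<^sup>2 / 4))"

lemma half_minus_nat_not_Ints: "1 / 2 - real n \<notin> \<int>"
proof
  assume "1 / 2 - real n \<in> \<int>"
  then have "1 / 2 - real n + real n \<in> \<int>" by (intro Ints_add) auto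
  then have "(1 / 2 :: real) \<in> \<int>" by simp
  then obtain k :: int where "(1 / 2 :: real) = of_int k" by (elim Ints_cases)
  then have "1 = 2 * k" by linarith
  then show False by presburger
qed

lemma Gamma_half_minus_nat_nonzero: "Gamma (1 / 2 - real n) \<noteq> 0"
  using half_minus_nat_not_Ints[of n] nonpos_Ints_subset_Ints by (auto simp: Gamma_eq_zero_iff)

lemma bessel_series_at_0: "bessel_series a 0 = rGamma (a + 1)"
  by (simp add: bessel_series_def powser_zero[of "\<lambda>k. rGamma (real k + a + 1) / fact k", simplified])

lemma matern_entire_at_0: "matern_entire n 0 = 1"
  using Gamma_half_minus_nat_nonzero[of n]
  by (simp add: matern_entire_def bessel_series_at_0 rGamma_inverse_Gamma)

lemma matern_entire_Suc_deriv:
  "(matern_entire (Suc n) has_real_derivative - (x / (2 * real n + 1)) * matern_entire n x) (at x)"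
proof -
  define W where "W b = bessel_series b (x\<^sup>2 / 4)" for b
  define h where "h = x / 2"
  have z: "x\<^sup>2 / 4 = h * h" "x = 2 * h" by (simp_all add: h_def power2_eq_square)
  have rec: "W (real n + 1 / 2) = h * h * W (real n + 5 / 2) + (real n + 3 / 2) * W (real n + 3 / 2)"
    using bessel_series_rec[of "real n + 3 / 2" "x\<^sup>2 / 4"]
    by (simp add: W_def z(1) add.commute)
  define G where "G = Gamma (1 / 2 - real (Suc n))"
  have "Gamma (1 / 2 - real (Suc n) + 1) = (1 / 2 - real (Suc n)) * G"
    unfolding G_def using half_minus_nat_not_Ints[of "Suc n"] nonpos_Ints_subset_Ints
    by (intro Gamma_plus1) auto
  then have GG: "Gamma (1 / 2 - real n) = - (real n + 1 / 2) * G" by (simp add: algebra_simps)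
  have "(matern_entire (Suc n) has_real_derivative
      G * (W (- (real (Suc n) + 1 / 2) + 1) * (2 * x / 4)
        - (real (2 * Suc n + 1) * h ^ (2 * Suc n + 1 - 1) * (1 / 2) * W (real (Suc n) + 1 / 2)
           + h ^ (2 * Suc n + 1) * (W (real (Suc n) + 1 / 2 + 1) * (2 * x / 4))))) (at x)"
    unfolding matern_entire_def[abs_def] W_def h_def G_def
    by (rule derivative_eq_intros refl | simp)+
  moreover have "G * (W (- (real (Suc n) + 1 / 2) + 1) * (2 * x / 4)
        - (real (2 * Suc n + 1) * h ^ (2 * Suc n + 1 - 1) * (1 / 2) * W (real (Suc n) + 1 / 2)
           + h ^ (2 * Suc n + 1) * (W (real (Suc n) + 1 / 2 + 1) * (2 * x / 4))))
     = - (x / (2 * real n + 1)) * matern_entire n x"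
  proof -
    have e: "- (real (Suc n) + 1 / 2) + 1 = - (real n + 1 / 2)"
      "real (Suc n) + 1 / 2 = real n + 3 / 2" "real (Suc n) + 1 / 2 + 1 = real n + 5 / 2"
      by simp_all
    have p: "h ^ (2 * Suc n + 1 - 1) = h * h ^ (2 * n + 1)"
      "h ^ (2 * Suc n + 1) = h * h * h ^ (2 * n + 1)" by simp_all
    have "- (x / (2 * real n + 1)) * matern_entire n x
      = G * h * (W (- (real n + 1 / 2)) - h ^ (2 * n + 1) * W (real n + 1 / 2))"
    proof -
      have "- (2 * h / (2 * real n + 1)) * (- (real n + 1 / 2) * G * d) = G * h * d" for d
        by (simp add: field_simps)
      then show ?thesis
        unfolding matern_entire_def GG z(2)[symmetric] h_def[symmetric] W_def[symmetric]
        by (metis (no_types, lifting) z(2))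
    qed
    then show ?thesis
      unfolding e p rec by (simp add: z(2) algebra_simps)
  qed
  ultimately show ?thesis by simp
qed

lemma matern_entire_0: "matern_entire 0 x = exp (- x)"
proof -
  have d: "(matern_entire 0 has_real_derivative - matern_entire 0 x) (at x)" for x
  proof -
    have rec: "bessel_series (- (1 / 2)) (x\<^sup>2 / 4)
        = x\<^sup>2 / 4 * bessel_series (3 / 2) (x\<^sup>2 / 4) + 1 / 2 * bessel_series (1 / 2) (x\<^sup>2 / 4)"
      using bessel_series_rec[of "1 / 2" "x\<^sup>2 / 4"] by simp
    have "(matern_entire 0 has_real_derivative
      Gamma (1 / 2) * (bessel_series (- (1 / 2) + 1) (x\<^sup>2 / 4) * (2 * x / 4)
        - (1 / 2 * bessel_series (1 / 2) (x\<^sup>2 / 4)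
           + (x / 2) * (bessel_series (1 / 2 + 1) (x\<^sup>2 / 4) * (2 * x / 4))))) (at x)"
      unfolding matern_entire_def[abs_def]
      by (rule derivative_eq_intros refl | simp)+
    then show ?thesis
      by (rule back_subst[of "\<lambda>d. (matern_entire 0 has_real_derivative d) (at x)"])
        (simp add: matern_entire_def rec, simp add: power2_eq_square algebra_simps)
  qed
  have "\<forall>x. ((\<lambda>x. matern_entire 0 x * exp x) has_real_derivative 0) (at x)"
    by (auto intro!: derivative_eq_intros d)
  from DERIV_isconst_all[OF this, of x 0] show ?thesis
    by (simp add: matern_entire_at_0 exp_minus field_simps)
qed

definition matern_deriv :: "nat \<Rightarrow> real \<Rightarrow> real" where
  "matern_deriv n x = (case n of 0 \<Rightarrow> - exp (- x) | Suc k \<Rightarrow> - (x / (2 * real k + 1)) * matern_entire k x)"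

lemma matern_entire_deriv: "(matern_entire n has_real_derivative matern_deriv n x) (at x)"
proof (cases n)
  case 0
  have "matern_entire 0 = (\<lambda>x. exp (- x))" by (rule ext) (rule matern_entire_0)
  moreover have "((\<lambda>x. exp (- x)) has_real_derivative - exp (- x)) (at x)"
    by (auto intro!: derivative_eq_intros)
  ultimately show ?thesis using 0 by (simp only: matern_deriv_def nat.case)
next
  case (Suc k)
  show ?thesis
    unfolding Suc matern_deriv_def nat.case by (rule matern_entire_Suc_deriv)
qed

text \<open>This is Bessel's equation for the profile of order \<open>n + 1/2\<close>, rewritten by means of the formula for the first
derivative. Both sides agree at \<open>0\<close>, and the induction hypothesis makes their derivatives agree.\<close>
lemma matern_entire_Suc:
  "matern_entire (Suc n) x = matern_entire n x - x / (2 * real n + 1) * matern_deriv n x"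
proof (induction n arbitrary: x)
  case 0
  define g where "g x = matern_entire 1 x - (1 + x) * exp (- x)" for x
  have "\<forall>x. (g has_real_derivative 0) (at x)"
  proof
    fix x
    have "((\<lambda>x. (1 + x) * exp (- x)) has_real_derivative - x * exp (- x)) (at x)"
      by (auto intro!: derivative_eq_intros simp: algebra_simps)
    from DERIV_diff[OF matern_entire_deriv[of 1 x] this]
    show "(g has_real_derivative 0) (at x)"
      unfolding g_def by (simp add: matern_deriv_def matern_entire_0)
  qed
  from DERIV_isconst_all[OF this, of x 0] show ?case
    by (simp add: g_def matern_entire_at_0 matern_entire_0 matern_deriv_def algebra_simps)
next
  case (Suc n)
  define c where "c = 2 * real n + 1"
  have c: "c > 0" "2 * real (Suc n) + 1 = c + 2" by (simp_all add: c_def)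
  define g where "g x = matern_entire (Suc (Suc n)) x
    - (matern_entire (Suc n) x + x\<^sup>2 / (c * (c + 2)) * matern_entire n x)" for x
  have "\<forall>x. (g has_real_derivative 0) (at x)"
  proof
    fix x
    have "(g has_real_derivative matern_deriv (Suc (Suc n)) x
      - (matern_deriv (Suc n) x + (x\<^sup>2 / (c * (c + 2)) * matern_deriv n x
         + 2 * x / (c * (c + 2)) * matern_entire n x))) (at x)"
      unfolding g_def
      by (intro DERIV_diff DERIV_add DERIV_mult' matern_entire_deriv) (use c(1) in \<open>auto intro!: derivative_eq_intros\<close>)
    moreover have "matern_deriv (Suc (Suc n)) x
      = - (x / (c + 2)) * (matern_entire n x - x / c * matern_deriv n x)"
      "matern_deriv (Suc n) x = - (x / c) * matern_entire n x"
      unfolding matern_deriv_def nat.case Suc.IH c(2) c_def by simp_all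
    moreover have "- (x / (c + 2)) * (y - x / c * d)
      - (- (x / c) * y + (x\<^sup>2 / (c * (c + 2)) * d + 2 * x / (c * (c + 2)) * y)) = 0" for y d
    proof -
      have "c + 2 \<noteq> 0" "c \<noteq> 0" using c(1) by auto
      then have "- (x / (c + 2)) * (y - x / c * d)
        - (- (x / c) * y + (x\<^sup>2 / (c * (c + 2)) * d + 2 * x / (c * (c + 2)) * y))
        = (- x * (c * y - x * d) + x * (c + 2) * y - 2 * x * y - x\<^sup>2 * d) / (c * (c + 2))"
        by (simp add: divide_simps)
      then show ?thesis by (simp add: algebra_simps power2_eq_square)
    qed
    ultimately show "(g has_real_derivative 0) (at x)" by (simp only:)
  qed
  from DERIV_isconst_all[OF this, of x 0]
  have "matern_entire (Suc (Suc n)) x = matern_entire (Suc n) x + x\<^sup>2 / (c * (c + 2)) * matern_entire n x"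
    by (simp add: g_def matern_entire_at_0)
  moreover have "x / (2 * real (Suc n) + 1) * matern_deriv (Suc n) x
      = - (x\<^sup>2 / (c * (c + 2)) * matern_entire n x)"
    unfolding c(2) by (simp add: matern_deriv_def c_def power2_eq_square mult.commute)
  ultimately show ?case by simp
qed

lemma matern_deriv_deriv:
  "(matern_deriv (Suc n) has_real_derivative
     matern_entire (Suc n) x - (2 * real n + 2) / (2 * real n + 1) * matern_entire n x) (at x)"
proof -
  define c where "c = 2 * real n + 1"
  have c: "c > 0" "2 * real n + 2 = c + 1" by (simp_all add: c_def)
  have "matern_deriv (Suc n) = (\<lambda>x. - (x / c) * matern_entire n x)"
    by (simp add: matern_deriv_def fun_eq_iff c_def)
  moreover have "((\<lambda>x. - (x / c) * matern_entire n x) has_real_derivative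
      - (x / c) * matern_deriv n x + - (1 / c) * matern_entire n x) (at x)"
    by (intro DERIV_mult' matern_entire_deriv) (use c(1) in \<open>auto intro!: derivative_eq_intros\<close>)
  ultimately have "(matern_deriv (Suc n) has_real_derivative
      - (x / c) * matern_deriv n x + - (1 / c) * matern_entire n x) (at x)" by (simp only:)
  then show ?thesis
  proof (rule back_subst[of "\<lambda>d. (matern_deriv (Suc n) has_real_derivative d) (at x)"])
    show "- (x / c) * matern_deriv n x + - (1 / c) * matern_entire n x
      = matern_entire (Suc n) x - (2 * real n + 2) / (2 * real n + 1) * matern_entire n x"
      unfolding matern_entire_Suc c_def[symmetric] c(2) using c(1) by (simp add: field_simps)
  qed
qed

lemma Gamma_reflection_real: "Gamma (a :: real) * Gamma (1 - a) = pi / sin (pi * a)"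
proof -
  have "complex_of_real (Gamma a * Gamma (1 - a)) = complex_of_real (pi / sin (pi * a))"
    using Gamma_reflection_complex[of "complex_of_real a"]
    by (simp flip: sin_of_real Gamma_complex_of_real)
  then show ?thesis by (simp only: of_real_eq_iff)
qed

lemma bessel_I_series:
  assumes "x > 0"
  shows "bessel_I b x = (x / 2) powr b * bessel_series b (x\<^sup>2 / 4)"
proof -
  have "(x / 2) powr (2 * real k + b) * rGamma (real k + b + 1) / fact k
      = (x / 2) powr b * ((rGamma (real k + b + 1) / fact k) * (x\<^sup>2 / 4) ^ k)" for k
  proof -
    have "(x / 2) powr (2 * real k) = (x / 2) ^ (2 * k)"
      using assms powr_realpow[of "x / 2" "2 * k"] by simp
    also have "\<dots> = (x\<^sup>2 / 4) ^ k" by (simp add: power_mult power_divide)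
    finally show ?thesis by (simp add: powr_add)
  qed
  then show ?thesis
    unfolding bessel_I_def bessel_series_def
    by (simp only: suminf_mult[OF summable_bessel_series])
qed

lemma matern_profile_eq:
  assumes "x > 0"
  shows "matern_profile (real n + 1 / 2) x = matern_entire n x"
proof -
  define a where "a = real n + 1 / 2"
  define S where "S = sin (a * pi)"
  have "a \<notin> \<int>"
  proof
    assume "a \<in> \<int>"
    then have "1 - a \<in> \<int>" by (intro Ints_diff) auto
    then show False using half_minus_nat_not_Ints[of n] by (simp add: a_def)
  qed
  have "a > 0" by (simp add: a_def)
  have refl: "Gamma a * Gamma (1 - a) = pi / S"
    by (simp add: S_def mult.commute Gamma_reflection_real)
  have "Gamma a > 0" using \<open>a > 0\<close> by (rule Gamma_real_pos)
  have G1: "Gamma (1 - a) = pi / S / Gamma a"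
    unfolding refl[symmetric] using \<open>Gamma a > 0\<close> by simp
  have p2: "x powr a * 2 powr (1 - a) = 2 * (x / 2) powr a"
    using assms by (simp add: powr_diff powr_divide)
  have inv: "(x / 2) powr a * (x / 2) powr (- a) = 1"
    using assms by (simp flip: powr_add)
  have dbl: "(x / 2) powr a * (x / 2) powr a = (x / 2) ^ (2 * n + 1)"
  proof -
    have "(x / 2) powr a * (x / 2) powr a = (x / 2) powr (real (2 * n + 1))"
      by (simp add: a_def add.commute flip: powr_add)
    then show ?thesis using assms powr_realpow[of "x / 2" "2 * n + 1"] by simp
  qed
  have "matern_profile a x = (x powr a * 2 powr (1 - a)) * (pi / S / Gamma a) / 2 * (bessel_I (- a) x - bessel_I a x)"
    using \<open>a \<notin> \<int>\<close> by (simp add: matern_profile_def bessel_K_def S_def mult_ac)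
  also have "\<dots> = Gamma (1 - a) * ((x / 2) powr a * (bessel_I (- a) x - bessel_I a x))"
    unfolding p2 G1 by simp
  also have "(x / 2) powr a * (bessel_I (- a) x - bessel_I a x)
     = ((x / 2) powr a * (x / 2) powr (- a)) * bessel_series (- a) (x\<^sup>2 / 4)
       - ((x / 2) powr a * (x / 2) powr a) * bessel_series a (x\<^sup>2 / 4)"
    by (simp only: bessel_I_series[OF assms] right_diff_distrib mult.assoc)
  finally show ?thesis
    unfolding inv dbl by (simp add: matern_entire_def a_def)
qed

lemma matern_eq: "matern (real n + 1 / 2) t u = matern_entire n \<bar>t - u\<bar>"
proof (cases "t = u")
  case True
  have "(matern_entire n \<longlongrightarrow> matern_entire n 0) (at_right 0)"
    using DERIV_isCont[OF matern_entire_deriv[of n 0]] by (simp add: isCont_def filterlim_at_split)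
  moreover have "\<forall>\<^sub>F x in at_right 0. matern_entire n x = matern_profile (real n + 1 / 2) x"
    using eventually_at_right_less[of "0 :: real"]
    by eventually_elim (simp only: matern_profile_eq)
  ultimately have "(matern_profile (real n + 1 / 2) \<longlongrightarrow> matern_entire n 0) (at_right 0)"
    by (rule Lim_transform_eventually)
  then show ?thesis using True by (simp add: matern_def tendsto_Lim)
qed (simp add: matern_def matern_profile_eq)

section \<open>Iterated differences of Laguerre functions\<close>

text \<open>In each coefficient this is the absorption identity for binomials.\<close>
lemma laguerre_contiguous:
  "real (j + p + 1) * laguerre p j x - real (j + 1) * laguerre p (Suc j) x = x * laguerre (Suc p) j x"
proof -
  define a where "a k = (-1) ^ k / fact k * x ^ k" for k :: nat
  define b where "b k = real ((Suc j + p) choose (Suc j - k))" for k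
  have "real (j + p + 1) * laguerre p j x = (\<Sum>k\<le>j. real (Suc j - k) * b k * a k)"
    unfolding laguerre_def sum_distrib_left
  proof (rule sum.cong)
    fix k assume "k \<in> {..j}"
    then have "Suc (j - k) = Suc j - k" by simp
    then have "(j + p + 1) * ((j + p) choose (j - k)) = (Suc j - k) * ((Suc j + p) choose (Suc j - k))"
      using Suc_times_binomial_eq[of "j + p" "j - k"] by (simp add: mult.commute)
    then have "real (j + p + 1) * real ((j + p) choose (j - k)) = real (Suc j - k) * b k"
      unfolding b_def by (metis of_nat_mult)
    then show "real (j + p + 1) * (real ((j + p) choose (j - k)) * ((-1) ^ k / fact k) * x ^ k)
        = real (Suc j - k) * b k * a k"
      by (simp only: a_def mult.assoc[symmetric])
  qed simp
  also have "\<dots> = (\<Sum>k\<le>Suc j. real (Suc j - k) * b k * a k)" by simp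
  finally have "real (j + p + 1) * laguerre p j x - real (j + 1) * laguerre p (Suc j) x
      = (\<Sum>k\<le>Suc j. real (Suc j - k) * b k * a k - real (j + 1) * (b k * a k))"
    unfolding laguerre_def sum_distrib_left sum_subtractf by (simp only: a_def b_def mult.assoc)
  also have "\<dots> = (\<Sum>k\<le>Suc j. - (real k * b k * a k))"
    by (rule sum.cong) (simp_all add: of_nat_diff algebra_simps)
  also have "\<dots> = (\<Sum>k\<le>j. - (real (Suc k) * b (Suc k) * a (Suc k)))"
    by (subst sum.atMost_Suc_shift) simp
  also have "\<dots> = x * laguerre (Suc p) j x"
    unfolding laguerre_def sum_distrib_left
  proof (rule sum.cong)
    fix k assume "k \<in> {..j}"
    have "- (real (Suc k) * a (Suc k)) = x * ((-1) ^ k / fact k * x ^ k)"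
      by (simp add: a_def)
    then have "- (real (Suc k) * b (Suc k) * a (Suc k)) = b (Suc k) * (x * ((-1) ^ k / fact k * x ^ k))"
      by (simp only: mult_minus_right[symmetric] mult.commute[of _ "b (Suc k)"] mult.assoc)
    then show "- (real (Suc k) * b (Suc k) * a (Suc k))
        = x * (real ((j + Suc p) choose (j - k)) * ((-1) ^ k / fact k) * x ^ k)"
      by (simp add: b_def mult_ac)
  qed simp
  finally show ?thesis .
qed

lemma laguerre_primitive:
  "((\<lambda>x. x * laguerre 1 j x) has_real_derivative real (Suc j) * laguerre 0 j x) (at x)"
proof -
  have eq: "(\<lambda>x. x * laguerre 1 j x)
      = (\<lambda>x. \<Sum>k\<le>j. real ((Suc j) choose (j - k)) * ((-1) ^ k / fact k) * x ^ Suc k)"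
    by (simp add: laguerre_def sum_distrib_left mult_ac)
  have "((\<lambda>x. \<Sum>k\<le>j. real ((Suc j) choose (j - k)) * ((-1) ^ k / fact k) * x ^ Suc k)
      has_real_derivative
      (\<Sum>k\<le>j. real ((Suc j) choose (j - k)) * ((-1) ^ k / fact k) * (real (Suc k) * x ^ k))) (at x)"
    by (intro DERIV_sum DERIV_cmult) (use DERIV_pow[of "Suc _" x] in simp)
  moreover have "(\<Sum>k\<le>j. real ((Suc j) choose (j - k)) * ((-1) ^ k / fact k) * (real (Suc k) * x ^ k))
      = real (Suc j) * laguerre 0 j x"
    unfolding laguerre_def sum_distrib_left
  proof (rule sum.cong)
    fix k assume k: "k \<in> {..j}"
    have "(Suc j choose (j - k)) = (Suc j choose Suc k)"
      using k binomial_symmetric[of "Suc k" "Suc j"] by simp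
    moreover have "(j choose (j - k)) = (j choose k)" using k binomial_symmetric[of k j] by simp
    ultimately have "(Suc j choose (j - k)) * Suc k = Suc j * ((j + 0) choose (j - k))"
      using Suc_times_binomial_eq[of j k] by simp
    then have "real (Suc j choose (j - k)) * real (Suc k) = real (Suc j) * real ((j + 0) choose (j - k))"
      by (metis of_nat_mult)
    note h = this
    have "real ((Suc j) choose (j - k)) * ((-1) ^ k / fact k) * (real (Suc k) * x ^ k)
        = (real (Suc j choose (j - k)) * real (Suc k)) * ((-1) ^ k / fact k * x ^ k)"
      by (simp only: mult_ac)
    then show "real ((Suc j) choose (j - k)) * ((-1) ^ k / fact k) * (real (Suc k) * x ^ k)
        = real (Suc j) * (real ((j + 0) choose (j - k)) * ((-1) ^ k / fact k) * x ^ k)"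
      unfolding h by (simp only: mult.assoc)
  qed simp
  ultimately show ?thesis unfolding eq by simp
qed

lemma laguerre_at_0: "laguerre 0 n 0 = 1"
  by (simp add: laguerre_def power_0_left if_distrib cong: if_cong)

text \<open>The recursion is a backward difference in the index. The value \<open>0\<close> at negative indices makes the telescoping sums
below start without a boundary term.\<close>
fun lag_diff :: "nat \<Rightarrow> int \<Rightarrow> real \<Rightarrow> real" where
  "lag_diff 0 n t = (if n < 0 then 0 else laguerre 0 (nat n) (2 * t) * exp (- t))"
| "lag_diff (Suc p) n t = lag_diff p (n - 1) t - lag_diff p n t"

lemma lag_diff_neg: "n < 0 \<Longrightarrow> lag_diff p n t = 0"
  by (induction p arbitrary: n) auto

lemma lag_diff_0_0: "lag_diff 0 0 t = exp (- t)"
  by (simp add: laguerre_def)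

lemma lag_diff_eq_laguerre:
  "lag_diff p (int (j + p)) t
    = (2 * t) ^ p * (fact j / fact (j + p)) * laguerre p j (2 * t) * exp (- t)"
proof (induction p arbitrary: j)
  case (Suc p)
  have f: "fact j / fact (j + p) = real (j + p + 1) * (fact j / fact (j + p + 1))"
    "fact (Suc j) / fact (Suc j + p) = real (j + 1) * (fact j / fact (j + p + 1))"
    by (simp_all add: divide_simps)
  have "lag_diff (Suc p) (int (j + Suc p)) t = lag_diff p (int (j + p)) t - lag_diff p (int (Suc j + p)) t"
    by simp
  also have "\<dots> = (2 * t) ^ p * (fact j / fact (j + p + 1))
      * (real (j + p + 1) * laguerre p j (2 * t) - real (j + 1) * laguerre p (Suc j) (2 * t)) * exp (- t)"
    unfolding Suc.IH f by (simp add: algebra_simps)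
  finally show ?case
    unfolding laguerre_contiguous by (simp add: mult_ac)
qed simp

text \<open>Differentiation turns the difference of neighbours into their sum. In terms of Fourier transforms, the
transform of \<open>\<lambda>\<^sub>n\<close> is \<open>(i\<omega>-1)\<^sup>n/(i\<omega>+1)\<^sup>n\<^sup>+\<^sup>1\<close>, and for \<open>p = 0\<close> this identity is \<open>(D + 1) \<lambda>\<^sub>n = (D - 1) \<lambda>\<^sub>n\<^sub>-\<^sub>1\<close>.\<close>
lemma lag_diff_deriv: "(lag_diff (Suc p) n has_real_derivative lag_diff p (n - 1) t + lag_diff p n t) (at t)"
proof (induction p arbitrary: n)
  case 0
  consider "n < 0" | "n = 0" | j where "n = int (Suc j)"
    by (metis int_cases not_less of_nat_0_less_iff zero_less_Suc linorder_neqE_linordered_idom nat_0_iff old.nat.exhaust of_nat_0 zero_le_imp_eq_int)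
  then show ?case
  proof cases
    case 1
    then have "lag_diff (Suc 0) n = (\<lambda>t. 0)" by (simp add: fun_eq_iff)
    with 1 show ?thesis by simp
  next
    case 2
    then have "lag_diff (Suc 0) n = (\<lambda>t. - exp (- t))" by (simp add: fun_eq_iff laguerre_def)
    moreover have "((\<lambda>t. - exp (- t)) has_real_derivative exp (- t)) (at t)"
      by (auto intro!: derivative_eq_intros)
    ultimately show ?thesis using 2 by (simp add: laguerre_def)
  next
    case 3
    define L where "L x = (x * laguerre 1 j x) / real (Suc j)" for x
    have L: "L x = laguerre 0 j x - laguerre 0 (Suc j) x" for x
      using laguerre_contiguous[of j 0 x] by (simp add: L_def field_simps)
    have "(L has_real_derivative laguerre 0 j x) (at x)" for x
      using DERIV_cdivide[OF laguerre_primitive[of j x], of "real (Suc j)"]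
      unfolding L_def[abs_def] by simp
    from DERIV_chain2[OF this, of "\<lambda>t. 2 * t" 2 t]
    have "((\<lambda>t. L (2 * t)) has_real_derivative laguerre 0 j (2 * t) * 2) (at t)"
      by (auto intro!: derivative_eq_intros)
    then have "((\<lambda>t. L (2 * t) * exp (- t)) has_real_derivative
        laguerre 0 j (2 * t) * 2 * exp (- t) - L (2 * t) * exp (- t)) (at t)"
      by (auto intro!: derivative_eq_intros)
    moreover have "lag_diff (Suc 0) n = (\<lambda>t. L (2 * t) * exp (- t))"
      using 3 by (simp add: fun_eq_iff L left_diff_distrib nat_add_distrib)
    moreover have "lag_diff 0 (n - 1) t + lag_diff 0 n t
        = laguerre 0 j (2 * t) * 2 * exp (- t) - L (2 * t) * exp (- t)"
      using 3 by (simp add: L nat_add_distrib algebra_simps)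
    ultimately show ?thesis by (simp only:)
  qed
next
  case (Suc p)
  have "lag_diff (Suc (Suc p)) n = (\<lambda>t. lag_diff (Suc p) (n - 1) t - lag_diff (Suc p) n t)" by (simp add: fun_eq_iff)
  with DERIV_diff[OF Suc.IH[of "n - 1"] Suc.IH[of n]] show ?case
    by (simp add: algebra_simps)
qed

lemma lag_diff_deriv_chain [derivative_intros]:
  "(f has_real_derivative f') (at x within s) \<Longrightarrow>
   ((\<lambda>x. lag_diff (Suc p) n (f x)) has_real_derivative (lag_diff p (n - 1) (f x) + lag_diff p n (f x)) * f') (at x within s)"
  by (rule DERIV_chain2[OF lag_diff_deriv])

lemma continuous_on_lag_diff [continuous_intros]:
  "continuous_on s f \<Longrightarrow> continuous_on s (\<lambda>x. lag_diff p n (f x))"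
proof (induction p arbitrary: n)
  case 0
  then show ?case by (cases "n < 0") (auto simp: laguerre_def intro!: continuous_intros)
qed (auto intro!: continuous_intros)

lemma lag_diff_at_0: "lag_diff (Suc p) (int m) 0 = (-1) ^ (Suc p + m) * real (p choose m)"
proof (induction p arbitrary: m)
  case 0
  then show ?case by (cases m) (simp_all add: laguerre_at_0)
next
  case (Suc p)
  have "lag_diff (Suc (Suc p)) (int m) 0 = lag_diff (Suc p) (int m - 1) 0 - lag_diff (Suc p) (int m) 0" by simp
  also have "\<dots> = (-1) ^ (Suc (Suc p) + m) * real (Suc p choose m)"
  proof (cases m)
    case 0
    then show ?thesis using Suc.IH[of 0] lag_diff_neg[of "-1" "Suc p" 0] by simp
  next
    case (Suc k)
    then have "int m - 1 = int k" by simp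
    then show ?thesis using Suc Suc.IH[of k] Suc.IH[of m] by (simp add: algebra_simps)
  qed
  finally show ?case .
qed

lemma lag_diff_sum: "lag_diff p n t = (\<Sum>k\<le>p. real (p choose k) * (-1) ^ k * lag_diff 0 (n + int k - int p) t)"
proof (induction p arbitrary: n)
  case (Suc p)
  let ?f = "\<lambda>k. (-1) ^ k * lag_diff 0 (n + int k - int (Suc p)) t"
  have a: "lag_diff p (n - 1) t = (\<Sum>k\<le>p. real (p choose k) * ?f k)"
    unfolding Suc.IH[of "n - 1"] by (rule sum.cong) (simp_all add: algebra_simps del: lag_diff.simps)
  have b: "lag_diff p n t = (\<Sum>k\<le>p. - (real (p choose k) * ?f (Suc k)))"
    unfolding Suc.IH[of n] by (rule sum.cong) (simp_all add: algebra_simps del: lag_diff.simps)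
  have "(\<Sum>k\<le>Suc p. real (Suc p choose k) * ?f k)
      = ?f 0 + (\<Sum>k\<le>p. real (Suc p choose Suc k) * ?f (Suc k))"
    by (subst sum.atMost_Suc_shift) (simp del: lag_diff.simps)
  also have "\<dots> = ?f 0 + (\<Sum>k\<le>p. real (p choose Suc k) * ?f (Suc k)) + (\<Sum>k\<le>p. real (p choose k) * ?f (Suc k))"
    by (simp only: binomial_Suc_Suc of_nat_add distrib_right sum.distrib add_ac)
  also have "?f 0 + (\<Sum>k\<le>p. real (p choose Suc k) * ?f (Suc k)) = (\<Sum>k\<le>Suc p. real (p choose k) * ?f k)"
    by (subst sum.atMost_Suc_shift) (simp del: lag_diff.simps)
  also have "\<dots> = (\<Sum>k\<le>p. real (p choose k) * ?f k)" by simp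
  finally show ?case
    unfolding lag_diff.simps(2)[of p n t] a b by (simp add: sum_negf mult.assoc del: lag_diff.simps)
qed simp

section \<open>Orthogonality on the half-line\<close>

text \<open>Half of the decay rate is given away to absorb polynomial factors; a product of two such functions is still
dominated by a multiple of \<open>exp (- t)\<close>.\<close>
definition exp_bounded :: "(real \<Rightarrow> real) \<Rightarrow> bool" where
  "exp_bounded f \<longleftrightarrow> (\<exists>C. \<forall>t\<ge>0. \<bar>f t\<bar> \<le> C * exp (- t / 2))"

lemma exp_bounded_add: "exp_bounded f \<Longrightarrow> exp_bounded g \<Longrightarrow> exp_bounded (\<lambda>t. f t + g t)"
proof -
  assume "exp_bounded f" "exp_bounded g"
  then obtain C D where "\<And>t. t \<ge> 0 \<Longrightarrow> \<bar>f t\<bar> \<le> C * exp (- t / 2)" "\<And>t. t \<ge> 0 \<Longrightarrow> \<bar>g t\<bar> \<le> D * exp (- t / 2)"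
    unfolding exp_bounded_def by blast
  then have "\<bar>f t + g t\<bar> \<le> (C + D) * exp (- t / 2)" if "t \<ge> 0" for t
    using that abs_triangle_ineq[of "f t" "g t"] by (smt (verit) distrib_right)
  then show ?thesis unfolding exp_bounded_def by blast
qed

lemma exp_bounded_scale: "exp_bounded f \<Longrightarrow> exp_bounded (\<lambda>t. c * f t)"
proof -
  assume "exp_bounded f"
  then obtain C where "\<And>t. t \<ge> 0 \<Longrightarrow> \<bar>f t\<bar> \<le> C * exp (- t / 2)"
    unfolding exp_bounded_def by blast
  then have "\<bar>c * f t\<bar> \<le> (\<bar>c\<bar> * C) * exp (- t / 2)" if "t \<ge> 0" for t
    using that by (simp add: abs_mult mult.assoc mult_left_mono)
  then show ?thesis unfolding exp_bounded_def by blast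
qed

lemma exp_bounded_diff: "exp_bounded f \<Longrightarrow> exp_bounded g \<Longrightarrow> exp_bounded (\<lambda>t. f t - g t)"
  using exp_bounded_add[of f "\<lambda>t. - 1 * g t"] exp_bounded_scale[of g "- 1"] by simp

lemma exp_bounded_sum: "(\<And>i. i \<in> I \<Longrightarrow> exp_bounded (f i)) \<Longrightarrow> exp_bounded (\<lambda>t. \<Sum>i\<in>I. f i t)"
proof (induction I rule: infinite_finite_induct)
  case (insert x F)
  then show ?case by (simp add: exp_bounded_add)
qed (auto simp: exp_bounded_def intro!: exI[of _ 0])

text \<open>From \<open>t/c \<le> exp (t/c)\<close> with \<open>c = 2k\<close>, raised to the power \<open>k\<close>.\<close>
lemma exp_bounded_power: "exp_bounded (\<lambda>t. t ^ k * exp (- t))"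
proof (cases "k = 0")
  case True
  then show ?thesis by (auto simp: exp_bounded_def intro!: exI[of _ 1])
next
  case False
  define c where "c = 2 * real k"
  have c: "c > 0" "real k / c = 1 / 2" using False by (simp_all add: c_def)
  have "\<bar>t ^ k * exp (- t)\<bar> \<le> c ^ k * exp (- t / 2)" if t: "t \<ge> 0" for t
  proof -
    have "t / c \<le> exp (t / c)" using exp_ge_add_one_self[of "t / c"] by linarith
    then have "(t / c) ^ k \<le> exp (t / c) ^ k" using t c by (intro power_mono) auto
    also have "exp (t / c) ^ k = exp (t / 2)"
      using c False by (simp add: c_def flip: exp_of_nat_mult)
    finally have "t ^ k \<le> c ^ k * exp (t / 2)" using c by (simp add: power_divide field_simps)
    then have "t ^ k * exp (- t) \<le> c ^ k * exp (t / 2) * exp (- t)" by (intro mult_right_mono) auto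
    also have "\<dots> = c ^ k * exp (- t / 2)" by (simp add: mult.assoc flip: exp_add)
    finally show ?thesis using t by simp
  qed
  then show ?thesis unfolding exp_bounded_def by blast
qed

lemma exp_bounded_lag_diff: "exp_bounded (lag_diff p n)"
proof (induction p arbitrary: n)
  case 0
  show ?case
  proof (cases "n < 0")
    case True
    then show ?thesis by (auto simp: exp_bounded_def intro!: exI[of _ 0])
  next
    case False
    then have "lag_diff 0 n = (\<lambda>t. \<Sum>k\<le>nat n. (real (nat n choose (nat n - k)) * ((-1) ^ k / fact k) * 2 ^ k)
        * (t ^ k * exp (- t)))"
      unfolding lag_diff.simps laguerre_def sum_distrib_right power_mult_distrib
      by (simp only: if_False mult_ac add_0_right)
    then show ?thesis by (simp only:) (intro exp_bounded_sum exp_bounded_scale exp_bounded_power)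
  qed
next
  case (Suc p)
  have "lag_diff (Suc p) n = (\<lambda>t. lag_diff p (n - 1) t - lag_diff p n t)" by (simp add: fun_eq_iff)
  then show ?case by (simp only:) (intro exp_bounded_diff Suc.IH)
qed

lemma exp_bounded_mult_obtains:
  assumes "exp_bounded f" "exp_bounded g"
  obtains C where "\<And>t. t \<ge> 0 \<Longrightarrow> \<bar>f t * g t\<bar> \<le> C * exp (- t)"
proof -
  obtain C D where C: "\<And>t. t \<ge> 0 \<Longrightarrow> \<bar>f t\<bar> \<le> C * exp (- t / 2)"
    and D: "\<And>t. t \<ge> 0 \<Longrightarrow> \<bar>g t\<bar> \<le> D * exp (- t / 2)"
    using assms unfolding exp_bounded_def by blast
  have "\<bar>f t * g t\<bar> \<le> (C * D) * exp (- t)" if "t \<ge> 0" for t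
  proof -
    have "0 \<le> C * exp (- t / 2)" using C[OF that] abs_ge_zero[of "f t"] by linarith
    then have "\<bar>f t\<bar> * \<bar>g t\<bar> \<le> (C * exp (- t / 2)) * (D * exp (- t / 2))"
      using C[OF that] D[OF that] by (intro mult_mono) auto
    also have "\<dots> = (C * D) * exp (- t)"
      by (simp add: mult_ac flip: exp_add)
    finally show ?thesis by (simp add: abs_mult)
  qed
  then show ?thesis by (rule that)
qed

lemma exp_minus_integrable: "(\<lambda>t::real. C * exp (- t)) integrable_on {0..}"
  using integrable_on_cmult_left[OF integrable_on_exp_minus_to_infinity[of 1 0], of C] by simp

lemma has_integral_half_line:
  fixes F f :: "real \<Rightarrow> real"
  assumes deriv: "\<And>t. (F has_real_derivative f t) (at t)"
    and bound: "\<And>t. t \<ge> 0 \<Longrightarrow> \<bar>f t\<bar> \<le> C * exp (- t)"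
    and bound': "\<And>t. t \<ge> 0 \<Longrightarrow> \<bar>F t\<bar> \<le> D * exp (- t)"
  shows "(f has_integral - F 0) {0..}"
proof (rule has_integral_dominated_convergence)
  define g where "g k t = (if t \<in> {0..real k} then f t else 0)" for k t
  show "(g k has_integral F (real k) - F 0) {0..}" for k
  proof -
    have "(f has_integral F (real k) - F 0) {0..real k}"
      using deriv by (intro fundamental_theorem_of_calculus)
        (auto simp: has_real_derivative_iff_has_vector_derivative[symmetric] intro: has_field_derivative_at_within)
    then show ?thesis unfolding g_def by (subst has_integral_restrict) auto
  qed
  show "(\<lambda>t. C * exp (- t)) integrable_on {0..}" by (rule exp_minus_integrable)
  have C: "C \<ge> 0" using bound[of 0] abs_ge_zero[of "f 0"] by simp
  show "\<forall>t\<in>{0..}. norm (g k t) \<le> C * exp (- t)" for k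
    using bound C by (auto simp: g_def)
  show "\<forall>t\<in>{0..}. (\<lambda>k. g k t) \<longlonglongrightarrow> f t"
  proof
    fix t :: real assume "t \<in> {0..}"
    then have "eventually (\<lambda>k. f t = g k t) sequentially"
      by (intro eventually_mono[OF eventually_ge_at_top[of "nat \<lceil>t\<rceil>"]])
        (auto simp: g_def nat_ceiling_le_eq)
    then show "(\<lambda>k. g k t) \<longlonglongrightarrow> f t"
      by (rule Lim_transform_eventually[OF tendsto_const])
  qed
  have "(\<lambda>k. F (real k)) \<longlonglongrightarrow> 0"
  proof (rule Lim_null_comparison)
    show "\<forall>\<^sub>F k in sequentially. norm (F (real k)) \<le> D * exp (- real k)" using bound' by simp
    show "(\<lambda>k. D * exp (- real k)) \<longlonglongrightarrow> 0"
      by (intro tendsto_mult_right_zero filterlim_compose[OF exp_at_bot]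
        filterlim_compose[OF filterlim_uminus_at_bot_at_top] filterlim_real_sequentially)
  qed
  then show "(\<lambda>k. F (real k) - F 0) \<longlonglongrightarrow> - F 0"
    using tendsto_diff[OF _ tendsto_const[of "F 0"], of "\<lambda>k. F (real k)" 0] by simp
qed

lemma lag_diff_integrable: "(\<lambda>t. lag_diff p m t * lag_diff q n t) integrable_on {0..}"
proof -
  obtain C where C: "\<And>t. t \<ge> 0 \<Longrightarrow> \<bar>lag_diff p m t * lag_diff q n t\<bar> \<le> C * exp (- t)"
    using exp_bounded_mult_obtains[OF exp_bounded_lag_diff exp_bounded_lag_diff] by blast
  have "C \<ge> 0" using C[of 0] abs_ge_zero[of "lag_diff p m 0 * lag_diff q n 0"] by simp
  define g where "g k t = (if t \<in> {0..real k} then lag_diff p m t * lag_diff q n t else 0)" for k t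
  show ?thesis
  proof (rule dominated_convergence)
    show "g k integrable_on {0..}" for k
    proof -
      have "(\<lambda>t. lag_diff p m t * lag_diff q n t) integrable_on {0..real k}"
        by (intro integrable_continuous_interval continuous_intros)
      then show ?thesis
        unfolding g_def integrable_on_def by (subst has_integral_restrict) auto
    qed
    show "(\<lambda>t. C * exp (- t)) integrable_on {0..}" by (rule exp_minus_integrable)
    show "norm (g k t) \<le> C * exp (- t)" if "t \<in> {0..}" for k t
      using C[of t] that \<open>C \<ge> 0\<close> by (auto simp: g_def)
    fix t :: real assume "t \<in> {0..}"
    then have "eventually (\<lambda>k. lag_diff p m t * lag_diff q n t = g k t) sequentially"
      by (intro eventually_mono[OF eventually_ge_at_top[of "nat \<lceil>t\<rceil>"]])
        (auto simp: g_def nat_ceiling_le_eq)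
    then show "(\<lambda>k. g k t) \<longlonglongrightarrow> lag_diff p m t * lag_diff q n t"
      by (rule Lim_transform_eventually[OF tendsto_const])
  qed
qed

lemma has_integral_lag_diff_product:
  assumes "\<And>t. ((\<lambda>t. lag_diff p m t * lag_diff q n t) has_real_derivative f t) (at t)"
    and "f = (\<lambda>t. 2 * (lag_diff p' m' t * lag_diff q' n' t) - 2 * (lag_diff p'' m'' t * lag_diff q'' n'' t))"
  shows "(f has_integral - (lag_diff p m 0 * lag_diff q n 0)) {0..}"
proof -
  obtain C1 where C1: "\<And>t. t \<ge> 0 \<Longrightarrow> \<bar>lag_diff p' m' t * lag_diff q' n' t\<bar> \<le> C1 * exp (- t)"
    using exp_bounded_mult_obtains[OF exp_bounded_lag_diff exp_bounded_lag_diff] by blast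
  obtain C2 where C2: "\<And>t. t \<ge> 0 \<Longrightarrow> \<bar>lag_diff p'' m'' t * lag_diff q'' n'' t\<bar> \<le> C2 * exp (- t)"
    using exp_bounded_mult_obtains[OF exp_bounded_lag_diff exp_bounded_lag_diff] by blast
  obtain D where D: "\<And>t. t \<ge> 0 \<Longrightarrow> \<bar>lag_diff p m t * lag_diff q n t\<bar> \<le> D * exp (- t)"
    using exp_bounded_mult_obtains[OF exp_bounded_lag_diff exp_bounded_lag_diff] by blast
  show ?thesis
  proof (rule has_integral_half_line[OF assms(1)])
    show "\<bar>f t\<bar> \<le> (2 * C1 + 2 * C2) * exp (- t)" if "t \<ge> 0" for t
      unfolding assms(2) distrib_right mult.assoc using C1[OF that] C2[OF that] by linarith
  qed (rule D)
qed

text \<open>The product of two first differences has derivative \<open>2 \<lambda>\<^sub>m \<lambda>\<^sub>n - 2 \<lambda>\<^sub>m\<^sub>+\<^sub>1 \<lambda>\<^sub>n\<^sub>+\<^sub>1\<close> and vanishes at both ends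
of the half-line when both indices are positive. So the inner products are constant along diagonals of the index pair.\<close>
lemma lag_diff_orthogonal:
  "((\<lambda>t. lag_diff 0 (int m) t * lag_diff 0 (int n) t) has_integral (if m = n then 1 / 2 else 0)) {0..}"
proof -
  have I: "((\<lambda>t. lag_diff 0 (int m) t * lag_diff 0 (int n) t) has_integral
      integral {0..} (\<lambda>t. lag_diff 0 (int m) t * lag_diff 0 (int n) t)) {0..}" for m n
    by (rule integrable_integral[OF lag_diff_integrable])
  have b: "lag_diff (Suc 0) (int (Suc m)) 0 = 0" for m
    using lag_diff_at_0[of 0 "Suc m"] by simp
  have step: "integral {0..} (\<lambda>t. lag_diff 0 (int (Suc m)) t * lag_diff 0 (int (Suc n)) t)
     = integral {0..} (\<lambda>t. lag_diff 0 (int m) t * lag_diff 0 (int n) t)" for m n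
  proof -
    have "((\<lambda>t. 2 * (lag_diff 0 (int m) t * lag_diff 0 (int n) t) - 2 * (lag_diff 0 (int (Suc m)) t * lag_diff 0 (int (Suc n)) t))
       has_integral - (lag_diff (Suc 0) (int (Suc m)) 0 * lag_diff (Suc 0) (int (Suc n)) 0)) {0..}"
    proof (rule has_integral_lag_diff_product[OF _ refl])
      show "((\<lambda>t. lag_diff (Suc 0) (int (Suc m)) t * lag_diff (Suc 0) (int (Suc n)) t) has_real_derivative
         2 * (lag_diff 0 (int m) t * lag_diff 0 (int n) t) - 2 * (lag_diff 0 (int (Suc m)) t * lag_diff 0 (int (Suc n)) t)) (at t)" for t
        by (rule DERIV_cong[OF DERIV_mult[OF lag_diff_deriv lag_diff_deriv]])
          (simp del: lag_diff.simps(1) add: algebra_simps)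
    qed
    moreover have "((\<lambda>t. 2 * (lag_diff 0 (int m) t * lag_diff 0 (int n) t) - 2 * (lag_diff 0 (int (Suc m)) t * lag_diff 0 (int (Suc n)) t))
       has_integral (2 * integral {0..} (\<lambda>t. lag_diff 0 (int m) t * lag_diff 0 (int n) t)
         - 2 * integral {0..} (\<lambda>t. lag_diff 0 (int (Suc m)) t * lag_diff 0 (int (Suc n)) t))) {0..}"
      by (intro has_integral_diff has_integral_mult_right I)
    ultimately have "2 * integral {0..} (\<lambda>t. lag_diff 0 (int m) t * lag_diff 0 (int n) t)
         - 2 * integral {0..} (\<lambda>t. lag_diff 0 (int (Suc m)) t * lag_diff 0 (int (Suc n)) t)
         = - (lag_diff (Suc 0) (int (Suc m)) 0 * lag_diff (Suc 0) (int (Suc n)) 0)"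
      by (rule has_integral_unique[rotated])
    then show ?thesis unfolding b by simp
  qed
  have zero: "integral {0..} (\<lambda>t. lag_diff 0 (int 0) t * lag_diff 0 (int (Suc n)) t) = 0" for n
  proof -
    have "((\<lambda>t. 2 * (lag_diff 0 (-1) t * lag_diff 0 0 t) - 2 * (lag_diff 0 (int 0) t * lag_diff 0 (int (Suc n)) t))
        has_integral - (lag_diff (Suc 0) (int 0) 0 * lag_diff (Suc 0) (int (Suc n)) 0)) {0..}"
    proof (rule has_integral_lag_diff_product[OF _ refl])
      have e: "lag_diff (Suc 0) (int 0) = (\<lambda>t. - exp (- t))" by (simp add: fun_eq_iff laguerre_def)
      have "((\<lambda>t. - exp (- t)) has_real_derivative exp (- t)) (at t)" for t
        by (auto intro!: derivative_eq_intros)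
      from DERIV_mult[OF this lag_diff_deriv[of 0 "int (Suc n)"]]
      show "((\<lambda>t. lag_diff (Suc 0) (int 0) t * lag_diff (Suc 0) (int (Suc n)) t) has_real_derivative
         2 * (lag_diff 0 (-1) t * lag_diff 0 0 t) - 2 * (lag_diff 0 (int 0) t * lag_diff 0 (int (Suc n)) t)) (at t)" for t
        unfolding e by (rule DERIV_cong) (simp add: lag_diff_0_0 lag_diff_neg algebra_simps del: lag_diff.simps(1))
    qed
    then have "((\<lambda>t. 2 * (lag_diff 0 (int 0) t * lag_diff 0 (int (Suc n)) t)) has_integral 0) {0..}"
      unfolding b using has_integral_neg by (force simp add: lag_diff_neg simp del: lag_diff.simps)
    moreover have "((\<lambda>t. 2 * (lag_diff 0 (int 0) t * lag_diff 0 (int (Suc n)) t)) has_integral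
        2 * integral {0..} (\<lambda>t. lag_diff 0 (int 0) t * lag_diff 0 (int (Suc n)) t)) {0..}"
      by (intro has_integral_mult_right I)
    ultimately have "2 * integral {0..} (\<lambda>t. lag_diff 0 (int 0) t * lag_diff 0 (int (Suc n)) t) = 0"
      by (rule has_integral_unique[rotated])
    then show ?thesis by simp
  qed
  have base: "integral {0..} (\<lambda>t. lag_diff 0 (int 0) t * lag_diff 0 (int 0) t) = 1 / 2"
  proof -
    have "(\<lambda>t. lag_diff 0 (int 0) t * lag_diff 0 (int 0) t) = (\<lambda>t. exp (- 2 * t))"
      by (simp add: fun_eq_iff lag_diff_0_0 flip: exp_add del: lag_diff.simps)
    then show ?thesis
      using integral_unique[OF has_integral_exp_minus_to_infinity[of 2 0]] by (simp del: lag_diff.simps)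
  qed
  have "integral {0..} (\<lambda>t. lag_diff 0 (int m) t * lag_diff 0 (int n) t) = (if m = n then 1 / 2 else 0)"
  proof (induction m n rule: diff_induct)
    case (1 m)
    show ?case
    proof (cases m)
      case 0
      then show ?thesis using base by simp
    next
      case (Suc k)
      then show ?thesis using zero[of k] by (simp add: mult.commute del: lag_diff.simps)
    qed
  next
    case (2 n)
    then show ?case using zero[of n] by (simp del: lag_diff.simps)
  next
    case (3 m n)
    then show ?case using step[of m n] by (simp del: lag_diff.simps)
  qed
  with I[of m n] show ?thesis by (simp only:)
qed

section \<open>Summing the products of differences\<close>

text \<open>With \<open>p = \<nu>\<close> and up to the factor \<open>\<kappa>\<^sup>2\<close>, the partial sums of the kernel expansion for \<open>t, u \<ge> 0\<close>.\<close>
definition partial_kernel :: "nat \<Rightarrow> nat \<Rightarrow> real \<Rightarrow> real \<Rightarrow> real" where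
  "partial_kernel p N t u = (\<Sum>m<N. lag_diff (Suc p) (int m) t * lag_diff (Suc p) (int m) u)"

text \<open>With \<open>a' = a\<^sub>m\<^sub>-\<^sub>1 + a\<^sub>m\<close> and \<open>a = a\<^sub>m\<^sub>-\<^sub>1 - a\<^sub>m\<close>, the derivative of a product is
\<open>2 a\<^sub>m\<^sub>-\<^sub>1 a\<^sub>m\<^sub>-\<^sub>1 - 2 a\<^sub>m a\<^sub>m\<close>, where in each term the first factor is taken at \<open>f s\<close> and the second one at \<open>g s\<close>.\<close>
lemma partial_kernel_deriv:
  assumes "(f has_real_derivative 1) (at s)" "(g has_real_derivative 1) (at s)"
  shows "((\<lambda>s. partial_kernel p N (f s) (g s)) has_real_derivative
    - 2 * (lag_diff p (int N - 1) (f s) * lag_diff p (int N - 1) (g s))) (at s)"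
proof -
  define h where "h m = 2 * (lag_diff p (int m - 1) (f s) * lag_diff p (int m - 1) (g s))" for m
  have "((\<lambda>s. lag_diff (Suc p) (int m) (f s) * lag_diff (Suc p) (int m) (g s)) has_real_derivative
      h m - h (Suc m)) (at s)" for m
    by (rule DERIV_cong[OF DERIV_mult[OF lag_diff_deriv_chain[OF assms(1)] lag_diff_deriv_chain[OF assms(2)]]])
      (simp add: h_def algebra_simps)
  then have "((\<lambda>s. partial_kernel p N (f s) (g s)) has_real_derivative (\<Sum>m<N. h m - h (Suc m))) (at s)"
    unfolding partial_kernel_def by (intro DERIV_sum)
  also have "(\<Sum>m<N. h m - h (Suc m)) = h 0 - h N" by (rule sum_lessThan_telescope')
  also have "\<dots> = - 2 * (lag_diff p (int N - 1) (f s) * lag_diff p (int N - 1) (g s))"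
    by (simp add: h_def lag_diff_neg)
  finally show ?thesis .
qed

lemma partial_kernel_eventually:
  assumes "N > p"
  shows "partial_kernel p N t 0 = partial_kernel p (Suc p) t 0"
  unfolding partial_kernel_def using assms
  by (intro sum.mono_neutral_right) (auto simp: lag_diff_at_0 binomial_eq_0 simp del: lag_diff.simps)

lemma partial_kernel_0_0: "partial_kernel p (Suc p) 0 0 = real ((2 * p) choose p)"
proof -
  have "partial_kernel p (Suc p) 0 0 = (\<Sum>m\<le>p. (real (p choose m))\<^sup>2)"
    unfolding partial_kernel_def lessThan_Suc_atMost
    by (rule sum.cong) (simp_all add: lag_diff_at_0 power2_eq_square del: lag_diff.simps)
  also have "\<dots> = real (\<Sum>m\<le>p. (p choose m)\<^sup>2)" by simp
  finally show ?thesis by (simp only: choose_square_sum)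
qed

lemma partial_kernel_diag_antimono:
  assumes "s \<le> t" shows "partial_kernel p N t t \<le> partial_kernel p N s s"
proof (rule DERIV_nonpos_imp_nonincreasing[OF assms])
  fix x
  show "\<exists>y. ((\<lambda>t. partial_kernel p N t t) has_real_derivative y) (at x) \<and> y \<le> 0"
    using partial_kernel_deriv[OF DERIV_ident DERIV_ident, of p N x]
    by (intro exI conjI, assumption) (simp add: mult_le_0_iff)
qed

lemma partial_kernel_diag_mono: "M \<le> N \<Longrightarrow> partial_kernel p M t t \<le> partial_kernel p N t t"
  unfolding partial_kernel_def by (intro sum_mono2) auto

text \<open>The partial sums increase with \<open>N\<close> and decrease along the diagonal, so they never exceed the sum at the
origin.\<close>
lemma partial_kernel_diag_le:
  assumes "t \<ge> 0" shows "partial_kernel p N t t \<le> real ((2 * p) choose p)"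
proof -
  have "partial_kernel p N t t \<le> partial_kernel p (Suc (N + p)) t t" by (rule partial_kernel_diag_mono) simp
  also have "\<dots> \<le> partial_kernel p (Suc (N + p)) 0 0" by (rule partial_kernel_diag_antimono[OF assms])
  also have "\<dots> = real ((2 * p) choose p)" 
    by (subst partial_kernel_eventually) (simp, rule partial_kernel_0_0)
  finally show ?thesis .
qed

definition l2_vanishing :: "real \<Rightarrow> (nat \<Rightarrow> real \<Rightarrow> real) \<Rightarrow> bool" where
  "l2_vanishing T F \<longleftrightarrow> (\<forall>N. continuous_on {0..T} (F N)) \<and> (\<lambda>N. integral {0..T} (\<lambda>t. (F N t)\<^sup>2)) \<longlonglongrightarrow> 0"

lemma square_integrable: "continuous_on {0..T::real} f \<Longrightarrow> (\<lambda>t. (f t)\<^sup>2 :: real) integrable_on {0..T}"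
  by (intro integrable_continuous_interval continuous_intros)

lemma l2_vanishing_add:
  assumes "l2_vanishing T F" "l2_vanishing T G"
  shows "l2_vanishing T (\<lambda>N t. F N t + G N t)"
  unfolding l2_vanishing_def
proof (intro conjI allI)
  have c: "continuous_on {0..T} (F N)" "continuous_on {0..T} (G N)" for N
    using assms by (auto simp: l2_vanishing_def)
  then show cs: "continuous_on {0..T} (\<lambda>t. F N t + G N t)" for N by (intro continuous_intros)
  show "(\<lambda>N. integral {0..T} (\<lambda>t. (F N t + G N t)\<^sup>2)) \<longlonglongrightarrow> 0"
  proof (rule tendsto_sandwich[OF _ _ tendsto_const])
    show "\<forall>\<^sub>F N in sequentially. 0 \<le> integral {0..T} (\<lambda>t. (F N t + G N t)\<^sup>2)"
      by (intro always_eventually allI integral_nonneg square_integrable cs) auto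
    have "integral {0..T} (\<lambda>t. (F N t + G N t)\<^sup>2)
        \<le> integral {0..T} (\<lambda>t. 2 * (F N t)\<^sup>2 + 2 * (G N t)\<^sup>2)" for N
    proof (rule integral_le)
      show "(\<lambda>t. (F N t + G N t)\<^sup>2) integrable_on {0..T}" by (intro square_integrable cs)
      show "(\<lambda>t. 2 * (F N t)\<^sup>2 + 2 * (G N t)\<^sup>2) integrable_on {0..T}"
        by (intro integrable_continuous_interval continuous_intros c)
      show "(F N t + G N t)\<^sup>2 \<le> 2 * (F N t)\<^sup>2 + 2 * (G N t)\<^sup>2" for t
        using zero_le_power2[of "F N t - G N t"] by (simp add: power2_eq_square algebra_simps)
    qed
    also have "integral {0..T} (\<lambda>t. 2 * (F N t)\<^sup>2 + 2 * (G N t)\<^sup>2)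
        = 2 * integral {0..T} (\<lambda>t. (F N t)\<^sup>2) + 2 * integral {0..T} (\<lambda>t. (G N t)\<^sup>2)" for N
      by (subst integral_add) (auto intro!: integrable_continuous_interval continuous_intros c)
    finally show "\<forall>\<^sub>F N in sequentially. integral {0..T} (\<lambda>t. (F N t + G N t)\<^sup>2)
        \<le> 2 * integral {0..T} (\<lambda>t. (F N t)\<^sup>2) + 2 * integral {0..T} (\<lambda>t. (G N t)\<^sup>2)"
      by (intro always_eventually allI)
    have "(\<lambda>N. 2 * integral {0..T} (\<lambda>t. (F N t)\<^sup>2) + 2 * integral {0..T} (\<lambda>t. (G N t)\<^sup>2))
        \<longlonglongrightarrow> 2 * 0 + 2 * 0"
      using assms by (intro tendsto_intros) (auto simp: l2_vanishing_def)
    then show "(\<lambda>N. 2 * integral {0..T} (\<lambda>t. (F N t)\<^sup>2) + 2 * integral {0..T} (\<lambda>t. (G N t)\<^sup>2))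
        \<longlonglongrightarrow> 0" by simp
  qed
qed

lemma l2_vanishing_diff:
  assumes "l2_vanishing T F" "l2_vanishing T G"
  shows "l2_vanishing T (\<lambda>N t. F N t - G N t)"
proof -
  have "l2_vanishing T (\<lambda>N t. - G N t)" using assms(2) by (auto simp: l2_vanishing_def intro: continuous_intros)
  from l2_vanishing_add[OF assms(1) this] show ?thesis by simp
qed

lemma l2_vanishing_shift: "l2_vanishing T F \<Longrightarrow> l2_vanishing T (\<lambda>N. F (N + k))"
  unfolding l2_vanishing_def using LIMSEQ_ignore_initial_segment[of _ 0 k] by blast

lemma l2_vanishing_zero: "l2_vanishing T (\<lambda>N t. 0)"
  by (simp add: l2_vanishing_def)

lemma l2_vanishing_sum: "(\<And>j. j < J \<Longrightarrow> l2_vanishing T (F j)) \<Longrightarrow> l2_vanishing T (\<lambda>N t. \<Sum>j<(J::nat). F j N t)"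
  by (induction J) (simp_all add: l2_vanishing_zero l2_vanishing_add)

text \<open>The squares sum to at most \<open>1\<close> pointwise, hence their integrals over \<open>{0..T}\<close> form a convergent series.\<close>
lemma l2_vanishing_lag_diff_1: "T \<ge> 0 \<Longrightarrow> l2_vanishing T (\<lambda>N. lag_diff (Suc 0) (int N))"
proof -
  assume "T \<ge> 0"
  have c: "continuous_on {0..T} (lag_diff (Suc 0) (int N))" for N
    using continuous_on_lag_diff[OF continuous_on_id] by blast
  have "(\<Sum>m<N. integral {0..T} (\<lambda>t. (lag_diff (Suc 0) (int m) t)\<^sup>2)) \<le> T" for N
  proof -
    have "(\<Sum>m<N. integral {0..T} (\<lambda>t. (lag_diff (Suc 0) (int m) t)\<^sup>2))
        = integral {0..T} (\<lambda>t. \<Sum>m<N. (lag_diff (Suc 0) (int m) t)\<^sup>2)"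
      by (intro integral_sum[symmetric] square_integrable c) simp
    also have "\<dots> \<le> integral {0..T} (\<lambda>t. 1)"
    proof (rule integral_le)
      show "(\<lambda>t. \<Sum>m<N. (lag_diff (Suc 0) (int m) t)\<^sup>2) integrable_on {0..T}"
        by (intro integrable_sum square_integrable c) simp
      show "(\<Sum>m<N. (lag_diff (Suc 0) (int m) t)\<^sup>2) \<le> 1" if "t \<in> {0..T}" for t
        using partial_kernel_diag_le[of t 0 N] that by (simp add: partial_kernel_def power2_eq_square)
    qed (rule integrable_continuous_interval, simp)
    also have "\<dots> = T" using \<open>T \<ge> 0\<close> by simp
    finally show ?thesis .
  qed
  then have "summable (\<lambda>m. integral {0..T} (\<lambda>t. (lag_diff (Suc 0) (int m) t)\<^sup>2))"
    by (intro summableI_nonneg_bounded[of _ T] integral_nonneg square_integrable c) auto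
  then show ?thesis
    using summable_LIMSEQ_zero c unfolding l2_vanishing_def by blast
qed

lemma norm_lag_diff_sum:
  "((\<lambda>t. (\<Sum>j<J. lag_diff 0 (int (N + j)) t)\<^sup>2) has_integral real J / 2) {0..}"
proof -
  have "((\<lambda>t. \<Sum>i<J. \<Sum>j<J. lag_diff 0 (int (N + i)) t * lag_diff 0 (int (N + j)) t) has_integral
      (\<Sum>i<J. \<Sum>j<J. if N + i = N + j then 1 / 2 else 0)) {0..}"
    by (intro has_integral_sum lag_diff_orthogonal) auto
  moreover have "(\<Sum>i<J. \<Sum>j<J. if N + i = N + j then 1 / 2 else (0::real)) = real J / 2"
    by simp
  ultimately show ?thesis
    by (simp only: power2_eq_square sum_product)
qed

text \<open>Since first differences tend to \<open>0\<close>, \<open>\<lambda>\<^sub>N\<close> is close in \<open>L\<^sup>2(0,T)\<close> to each of its next \<open>J\<close> neighbours, hence to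
their average. By orthogonality the average has squared norm \<open>1/(2J)\<close> on the whole half-line, and \<open>J\<close> is arbitrary.\<close>
lemma l2_vanishing_lag_diff_0:
  assumes "T \<ge> 0" shows "l2_vanishing T (\<lambda>N. lag_diff 0 (int N))"
proof -
  have c: "continuous_on {0..T} (lag_diff 0 (int N))" for N
    using continuous_on_lag_diff[OF continuous_on_id] by blast
  have near: "l2_vanishing T (\<lambda>N t. lag_diff 0 (int N) t - lag_diff 0 (int (N + j)) t)" for j
  proof (induction j)
    case (Suc j)
    have "l2_vanishing T (\<lambda>N. lag_diff (Suc 0) (int (N + Suc j)))"
      by (rule l2_vanishing_shift[OF l2_vanishing_lag_diff_1[OF assms]])
    from l2_vanishing_add[OF Suc.IH this]
    show ?case by (simp del: lag_diff.simps(1))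
  qed (simp add: l2_vanishing_zero)
  have bound: "integral {0..T} (\<lambda>t. (lag_diff 0 (int N) t)\<^sup>2) \<le>
      2 / (real J)\<^sup>2 * integral {0..T} (\<lambda>t. (\<Sum>j<J. lag_diff 0 (int N) t - lag_diff 0 (int (N + j)) t)\<^sup>2) + 1 / real J"
    if "J > 0" for N J
  proof -
    define D where "D t = (\<Sum>j<J. lag_diff 0 (int N) t - lag_diff 0 (int (N + j)) t)" for t
    define S where "S t = (\<Sum>j<J. lag_diff 0 (int (N + j)) t)" for t
    have cD: "continuous_on {0..T} D" and cS: "continuous_on {0..T} S"
      unfolding D_def S_def by (intro continuous_intros c)+
    have Sle: "integral {0..T} (\<lambda>t. (S t)\<^sup>2) \<le> real J / 2"
    proof -
      have "integral {0..T} (\<lambda>t. (S t)\<^sup>2) \<le> integral {0..} (\<lambda>t. (S t)\<^sup>2)"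
        using norm_lag_diff_sum[where J = J and N = N] unfolding S_def[symmetric]
        by (intro integral_subset_le square_integrable cS) auto
      also have "\<dots> = real J / 2"
        using norm_lag_diff_sum[where J = J and N = N] unfolding S_def[symmetric] by (rule integral_unique)
      finally show ?thesis .
    qed
    have "integral {0..T} (\<lambda>t. (lag_diff 0 (int N) t)\<^sup>2)
      \<le> integral {0..T} (\<lambda>t. 2 / (real J)\<^sup>2 * (D t)\<^sup>2 + 2 / (real J)\<^sup>2 * (S t)\<^sup>2)"
    proof (rule integral_le)
      show "(\<lambda>t. (lag_diff 0 (int N) t)\<^sup>2) integrable_on {0..T}" by (intro square_integrable c)
      show "(\<lambda>t. 2 / (real J)\<^sup>2 * (D t)\<^sup>2 + 2 / (real J)\<^sup>2 * (S t)\<^sup>2) integrable_on {0..T}"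
        by (intro integrable_continuous_interval continuous_intros cD cS)
      fix t
      have "real J * lag_diff 0 (int N) t = D t + S t"
        by (simp add: D_def S_def sum_subtractf del: lag_diff.simps)
      then have "(real J)\<^sup>2 * (lag_diff 0 (int N) t)\<^sup>2 = (D t + S t)\<^sup>2"
        by (metis power_mult_distrib)
      also have "\<dots> \<le> 2 * (D t)\<^sup>2 + 2 * (S t)\<^sup>2"
        using zero_le_power2[of "D t - S t"] by (simp add: power2_eq_square algebra_simps)
      finally have "(lag_diff 0 (int N) t)\<^sup>2 \<le> (2 * (D t)\<^sup>2 + 2 * (S t)\<^sup>2) / (real J)\<^sup>2"
        using \<open>J > 0\<close> by (simp add: pos_le_divide_eq mult.commute del: lag_diff.simps)
      then show "(lag_diff 0 (int N) t)\<^sup>2 \<le> 2 / (real J)\<^sup>2 * (D t)\<^sup>2 + 2 / (real J)\<^sup>2 * (S t)\<^sup>2"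
        by (simp add: add_divide_distrib del: lag_diff.simps)
    qed
    also have "\<dots> = 2 / (real J)\<^sup>2 * integral {0..T} (\<lambda>t. (D t)\<^sup>2) + 2 / (real J)\<^sup>2 * integral {0..T} (\<lambda>t. (S t)\<^sup>2)"
      using \<open>J > 0\<close>
      by (subst integral_add) (auto intro!: integrable_continuous_interval continuous_intros cD cS)
    also have "\<dots> \<le> 2 / (real J)\<^sup>2 * integral {0..T} (\<lambda>t. (D t)\<^sup>2) + 2 / (real J)\<^sup>2 * (real J / 2)"
      by (intro add_left_mono mult_left_mono Sle) simp
    also have "2 / (real J)\<^sup>2 * (real J / 2) = 1 / real J"
      using \<open>J > 0\<close> by (simp add: power2_eq_square)
    finally show ?thesis unfolding D_def .
  qed
  have "(\<lambda>N. integral {0..T} (\<lambda>t. (lag_diff 0 (int N) t)\<^sup>2)) \<longlonglongrightarrow> 0"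
  proof (rule LIMSEQ_I)
    fix r :: real assume "0 < r"
    define J where "J = Suc (nat \<lceil>2 / r\<rceil>)"
    have J: "J > 0" "1 / real J < r / 2"
    proof -
      have "2 / r < real J" unfolding J_def by linarith
      moreover have "0 < real J" by (simp add: J_def)
      ultimately show "1 / real J < r / 2" using \<open>0 < r\<close> by (simp add: field_simps)
    qed (simp add: J_def)
    have "l2_vanishing T (\<lambda>N t. \<Sum>j<J. lag_diff 0 (int N) t - lag_diff 0 (int (N + j)) t)"
      by (intro l2_vanishing_sum near)
    then have "(\<lambda>N. 2 / (real J)\<^sup>2 * integral {0..T} (\<lambda>t. (\<Sum>j<J. lag_diff 0 (int N) t - lag_diff 0 (int (N + j)) t)\<^sup>2)) \<longlonglongrightarrow> 0"
      unfolding l2_vanishing_def by (intro tendsto_mult_right_zero) blast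
    then have "\<forall>\<^sub>F N in sequentially. 2 / (real J)\<^sup>2 * integral {0..T}
        (\<lambda>t. (\<Sum>j<J. lag_diff 0 (int N) t - lag_diff 0 (int (N + j)) t)\<^sup>2) < r / 2"
      using \<open>0 < r\<close> by (intro order_tendstoD(2)) auto
    then have "\<forall>\<^sub>F N in sequentially. norm (integral {0..T} (\<lambda>t. (lag_diff 0 (int N) t)\<^sup>2) - 0) < r"
    proof (rule eventually_mono)
      fix N
      assume "2 / (real J)\<^sup>2 * integral {0..T}
        (\<lambda>t. (\<Sum>j<J. lag_diff 0 (int N) t - lag_diff 0 (int (N + j)) t)\<^sup>2) < r / 2"
      with bound[OF J(1), of N] J(2) have "integral {0..T} (\<lambda>t. (lag_diff 0 (int N) t)\<^sup>2) < r" by linarith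
      moreover have "0 \<le> integral {0..T} (\<lambda>t. (lag_diff 0 (int N) t)\<^sup>2)"
        by (intro integral_nonneg square_integrable c) auto
      ultimately show "norm (integral {0..T} (\<lambda>t. (lag_diff 0 (int N) t)\<^sup>2) - 0) < r" by simp
    qed
    then show "\<exists>N. \<forall>n\<ge>N. norm (integral {0..T} (\<lambda>t. (lag_diff 0 (int n) t)\<^sup>2) - 0) < r"
      by (simp add: eventually_sequentially)
  qed
  with c show ?thesis unfolding l2_vanishing_def by blast
qed

lemma l2_vanishing_lag_diff: "T \<ge> 0 \<Longrightarrow> l2_vanishing T (\<lambda>N. lag_diff p (int N))"
proof (induction p)
  case 0
  then show ?case by (rule l2_vanishing_lag_diff_0)
next
  case (Suc p)
  have "l2_vanishing T (\<lambda>N t. lag_diff p (int N) t - lag_diff p (int (N + 1)) t)"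
    using Suc by (intro l2_vanishing_diff l2_vanishing_shift) auto
  moreover have "lag_diff (Suc p) (int (N + 1)) = (\<lambda>t. lag_diff p (int N) t - lag_diff p (int (N + 1)) t)" for N
    by (simp add: fun_eq_iff)
  ultimately have "l2_vanishing T (\<lambda>N. lag_diff (Suc p) (int (N + 1)))" by (simp only:)
  then have "(\<lambda>N. integral {0..T} (\<lambda>t. (lag_diff (Suc p) (int (Suc N)) t)\<^sup>2)) \<longlonglongrightarrow> 0"
    unfolding l2_vanishing_def by simp
  then have "(\<lambda>N. integral {0..T} (\<lambda>t. (lag_diff (Suc p) (int N) t)\<^sup>2)) \<longlonglongrightarrow> 0"
    by (rule LIMSEQ_imp_Suc)
  then show ?case
    unfolding l2_vanishing_def using continuous_on_lag_diff[OF continuous_on_id, of "{0..T}" "Suc p"] by blast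
qed

lemma partial_kernel_diag_tendsto:
  assumes "T \<ge> 0"
  shows "(\<lambda>N. partial_kernel p N T T) \<longlonglongrightarrow> real ((2 * p) choose p)"
proof -
  have "partial_kernel p (Suc (p + N)) T T
      = real ((2 * p) choose p) - 2 * integral {0..T} (\<lambda>t. (lag_diff p (int (N + p)) t)\<^sup>2)" for N
  proof -
    have "((\<lambda>t. - 2 * (lag_diff p (int (Suc (p + N)) - 1) t * lag_diff p (int (Suc (p + N)) - 1) t)) has_integral
        (partial_kernel p (Suc (p + N)) T T - partial_kernel p (Suc (p + N)) 0 0)) {0..T}"
      using assms partial_kernel_deriv[OF DERIV_ident DERIV_ident, of p "Suc (p + N)"]
      by (intro fundamental_theorem_of_calculus)
        (auto simp: has_real_derivative_iff_has_vector_derivative[symmetric] intro: has_field_derivative_at_within)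
    note eq = integral_unique[OF this]
    have idx: "int (Suc (p + N)) - 1 = int (N + p)" by simp
    have Q0: "partial_kernel p (Suc (p + N)) 0 0 = real ((2 * p) choose p)"
      by (simp only: partial_kernel_eventually[of p "Suc (p + N)", simplified] partial_kernel_0_0)
    show ?thesis
      using eq unfolding idx Q0 power2_eq_square integral_mult_right by simp
  qed
  moreover have "(\<lambda>N. real ((2 * p) choose p) - 2 * integral {0..T} (\<lambda>t. (lag_diff p (int (N + p)) t)\<^sup>2))
      \<longlonglongrightarrow> real ((2 * p) choose p) - 2 * 0"
    using l2_vanishing_shift[OF l2_vanishing_lag_diff[OF assms, of p], of p] unfolding l2_vanishing_def
    by (intro tendsto_intros) blast
  ultimately have "(\<lambda>N. partial_kernel p (N + Suc p) T T) \<longlonglongrightarrow> real ((2 * p) choose p)"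
    by (simp add: add.commute)
  then show ?thesis by (rule LIMSEQ_offset)
qed

text \<open>Write \<open>\<alpha>\<close> and \<open>\<beta>\<close> for the two boundary terms at \<open>(x+r, r)\<close>. The derivatives of \<open>Q(x+r, r)\<close>, \<open>Q(x+r, x+r)\<close> and
\<open>Q(r, r)\<close> are \<open>-2\<alpha>\<beta>\<close>, \<open>-2\<alpha>\<^sup>2\<close> and \<open>-2\<beta>\<^sup>2\<close>, so that the increment of \<open>2Q(x+r, r)\<close> is dominated by the two
diagonal decrements, which tend to \<open>0\<close>.\<close>
lemma partial_kernel_tendsto_ordered:
  assumes "0 \<le> x" "0 \<le> s"
  shows "(\<lambda>N. partial_kernel p N (x + s) s) \<longlonglongrightarrow> partial_kernel p (Suc p) x 0"
proof -
  define Q where "Q N = partial_kernel p N" for N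
  have bound: "\<bar>2 * (Q N (x + s) s - Q N x 0)\<bar> \<le> (Q N x x - Q N (x + s) (x + s)) + (Q N 0 0 - Q N s s)" for N
  proof -
    define a where "a r = lag_diff p (int N - 1) (x + r)" for r
    define b where "b r = lag_diff p (int N - 1) r" for r
    have d: "((\<lambda>r. Q N (x + r) r) has_real_derivative - 2 * (a r * b r)) (at r)"
      "((\<lambda>r. Q N (x + r) (x + r)) has_real_derivative - 2 * (a r * a r)) (at r)"
      "((\<lambda>r. Q N r r) has_real_derivative - 2 * (b r * b r)) (at r)" for r
      unfolding Q_def a_def b_def
      by (rule partial_kernel_deriv; auto intro!: derivative_eq_intros)+
    have "c * (2 * Q N (x + s) s) + Q N (x + s) (x + s) + Q N s s
        \<le> c * (2 * Q N (x + 0) 0) + Q N (x + 0) (x + 0) + Q N 0 0" if "c * c = 1" for c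
    proof (rule DERIV_nonpos_imp_nonincreasing[OF \<open>0 \<le> s\<close>])
      fix r
      have "((\<lambda>r. c * (2 * Q N (x + r) r) + Q N (x + r) (x + r) + Q N r r) has_real_derivative
        c * (2 * (- 2 * (a r * b r))) + - 2 * (a r * a r) + - 2 * (b r * b r)) (at r)"
        by (intro DERIV_add DERIV_cmult d)
      also have "c * (2 * (- 2 * (a r * b r))) + - 2 * (a r * a r) + - 2 * (b r * b r)
          = - 2 * (c * a r + b r)\<^sup>2"
      proof -
        have "(c * a r + b r)\<^sup>2 = (c * c) * (a r * a r) + 2 * c * (a r * b r) + b r * b r"
          by (simp add: power2_eq_square algebra_simps)
        then show ?thesis by (simp add: that)
      qed
      finally show "\<exists>y. ((\<lambda>r. c * (2 * Q N (x + r) r) + Q N (x + r) (x + r) + Q N r r)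
          has_real_derivative y) (at r) \<and> y \<le> 0" by (intro exI conjI) (assumption, simp)
    qed
    \<comment> \<open>The signs \<open>c = 1\<close> and \<open>c = -1\<close> give the two halves of the absolute value.\<close>
    from this[of 1] this[of "- 1"] show ?thesis by (simp add: abs_le_iff)
  qed
  have "(\<lambda>N. Q N (x + s) s - Q N x 0) \<longlonglongrightarrow> 0"
  proof (rule Lim_null_comparison[OF always_eventually])
    show "\<forall>N. norm (Q N (x + s) s - Q N x 0)
        \<le> (Q N x x - Q N (x + s) (x + s)) + (Q N 0 0 - Q N s s)"
    proof
      fix N show "norm (Q N (x + s) s - Q N x 0)
        \<le> (Q N x x - Q N (x + s) (x + s)) + (Q N 0 0 - Q N s s)"
        by (rule order_trans[OF _ bound[of N]]) (simp only: real_norm_def abs_mult, simp)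
    qed
    let ?c = "real ((2 * p) choose p)"
    have "(\<lambda>N. (Q N x x - Q N (x + s) (x + s)) + (Q N 0 0 - Q N s s)) \<longlonglongrightarrow> (?c - ?c) + (?c - ?c)"
      unfolding Q_def using assms by (intro tendsto_intros partial_kernel_diag_tendsto) auto
    then show "(\<lambda>N. (Q N x x - Q N (x + s) (x + s)) + (Q N 0 0 - Q N s s)) \<longlonglongrightarrow> 0" by simp
  qed
  moreover have "(\<lambda>N. Q N x 0) \<longlonglongrightarrow> Q (Suc p) x 0"
    unfolding Q_def
    by (rule Lim_transform_eventually[OF tendsto_const eventually_mono[OF eventually_gt_at_top[of p]]])
      (rule partial_kernel_eventually[symmetric])
  ultimately have "(\<lambda>N. (Q N (x + s) s - Q N x 0) + Q N x 0) \<longlonglongrightarrow> 0 + Q (Suc p) x 0"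
    by (rule tendsto_add)
  then show ?thesis by (simp add: Q_def)
qed

lemma partial_kernel_commute: "partial_kernel p N t u = partial_kernel p N u t"
  by (simp add: partial_kernel_def mult.commute)

lemma partial_kernel_tendsto:
  assumes "0 \<le> t" "0 \<le> u"
  shows "(\<lambda>N. partial_kernel p N t u) \<longlonglongrightarrow> partial_kernel p (Suc p) \<bar>t - u\<bar> 0"
proof (cases "u \<le> t")
  case True
  then show ?thesis using partial_kernel_tendsto_ordered[of "t - u" u p] assms by simp
next
  case False
  then show ?thesis using partial_kernel_tendsto_ordered[of "u - t" t p] assms
    by (simp add: partial_kernel_commute[of p _ t u])
qed

text \<open>For arguments \<open>t\<close> and \<open>-v\<close> of opposite signs the kernel is this finite sum. It is constant when
\<open>t + v\<close> is fixed, again by telescoping, and can be evaluated at \<open>v = 0\<close>.\<close>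
lemma lag_diff_reflection_sum:
  "(\<Sum>m\<le>p. lag_diff (Suc p) (int m) t * ((-1) ^ p * lag_diff (Suc p) (int p - int m) v))
    = partial_kernel p (Suc p) (t + v) 0"
proof -
  define x where "x = t + v"
  define G where "G s = (\<Sum>m\<le>p. lag_diff (Suc p) (int m) (x - s) * lag_diff (Suc p) (int p - int m) s)" for s
  have "\<forall>s. (G has_real_derivative 0) (at s)"
  proof
    fix s
    define h where "h m = 2 * (lag_diff p (int m - 1) (x - s) * lag_diff p (int p - int m) s)" for m
    have "((\<lambda>s. lag_diff (Suc p) (int m) (x - s) * lag_diff (Suc p) (int p - int m) s) has_real_derivative
        h m - h (Suc m)) (at s)" for m
    proof -
      have d: "((\<lambda>s. x - s) has_real_derivative - 1) (at s)" by (auto intro!: derivative_eq_intros)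
      show ?thesis
        by (rule DERIV_cong[OF DERIV_mult[OF lag_diff_deriv_chain[OF d] lag_diff_deriv]])
          (simp add: h_def algebra_simps)
    qed
    then have "(G has_real_derivative (\<Sum>m\<le>p. h m - h (Suc m))) (at s)"
      unfolding G_def by (intro DERIV_sum)
    moreover have "(\<Sum>m\<le>p. h m - h (Suc m)) = 0"
      unfolding lessThan_Suc_atMost[symmetric] sum_lessThan_telescope' by (simp add: h_def lag_diff_neg)
    ultimately show "(G has_real_derivative 0) (at s)" by simp
  qed
  from DERIV_isconst_all[OF this, of v 0]
  have "(-1) ^ p * G v = (-1) ^ p * G 0" by simp
  moreover have "(\<Sum>m\<le>p. lag_diff (Suc p) (int m) t * ((-1) ^ p * lag_diff (Suc p) (int p - int m) v))
      = (-1) ^ p * G v"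
    by (simp add: G_def x_def sum_distrib_left mult_ac del: lag_diff.simps)
  moreover have "(-1) ^ p * G 0 = partial_kernel p (Suc p) x 0"
    unfolding partial_kernel_def lessThan_Suc_atMost G_def sum_distrib_left
  proof (rule sum.cong)
    fix m assume "m \<in> {..p}"
    then have m: "int p - int m = int (p - m)" "p choose (p - m) = p choose m" "m \<le> p"
      using binomial_symmetric[of m p] by (auto simp: of_nat_diff)
    have "(-1::real) ^ p * (-1) ^ (Suc p + (p - m)) = (-1) ^ (Suc p + m)"
    proof -
      have "(-1::real) ^ p * (-1) ^ (Suc p + (p - m)) = (-1) ^ (p + (Suc p + (p - m)))"
        by (simp only: power_add)
      also have "p + (Suc p + (p - m)) = (Suc p + m) + 2 * (p - m)" using m(3) by simp
      finally show ?thesis by (simp add: power_add)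
    qed
    then have "(-1) ^ p * lag_diff (Suc p) (int p - int m) 0 = lag_diff (Suc p) (int m) 0"
      unfolding m(1) lag_diff_at_0 m(2) by (simp only: mult.assoc[symmetric])
    then show "(-1) ^ p * (lag_diff (Suc p) (int m) (x - 0) * lag_diff (Suc p) (int p - int m) 0)
        = lag_diff (Suc p) (int m) x * lag_diff (Suc p) (int m) 0"
      by (simp only: mult.left_commute[of "(-1) ^ p"] diff_zero)
  qed simp
  ultimately show ?thesis by (simp add: x_def)
qed

section \<open>Independence of the differences\<close>

definition finite_difference :: "(nat \<Rightarrow> real) \<Rightarrow> nat \<Rightarrow> real" where
  "finite_difference c = (\<lambda>m. c (Suc m) - c m)"

text \<open>A sequence annihilated by an iterated difference operator is a polynomial in the index, and a polynomial that tends to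
\<open>0\<close> vanishes.\<close>
lemma null_sequence_polynomial:
  "c \<longlonglongrightarrow> 0 \<Longrightarrow> (\<And>n. (finite_difference ^^ k) c n = 0) \<Longrightarrow> c n = 0"
proof (induction k arbitrary: c n)
  case (Suc k)
  have "finite_difference c \<longlonglongrightarrow> 0"
    using tendsto_diff[OF LIMSEQ_Suc[OF Suc.prems(1)] Suc.prems(1)] by (simp add: finite_difference_def)
  moreover have "(finite_difference ^^ k) (finite_difference c) n = 0" for n
    using Suc.prems(2)[of n] by (simp add: funpow_swap1)
  ultimately have "finite_difference c n = 0" for n by (rule Suc.IH)
  then have "c n = c 0" for n by (induction n) (simp_all add: finite_difference_def)
  then have "c = (\<lambda>n. c 0)" by (simp add: fun_eq_iff)
  with Suc.prems(1) have "c 0 = 0" using LIMSEQ_const_iff by metis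
  with \<open>\<And>n. c n = c 0\<close> show ?case by simp
qed simp

text \<open>The inner products of the \<open>p\<close>-th differences with \<open>\<lambda>\<^sub>n\<close> on the half-line.\<close>
fun gram :: "nat \<Rightarrow> int \<Rightarrow> nat \<Rightarrow> real" where
  "gram 0 m n = (if m = int n then 1 / 2 else 0)"
| "gram (Suc p) m n = gram p (m - 1) n - gram p m n"

lemma has_integral_gram:
  "((\<lambda>t. lag_diff p m t * lag_diff 0 (int n) t) has_integral gram p m n) {0..}"
proof (induction p arbitrary: m)
  case 0
  show ?case
  proof (cases "m < 0")
    case True
    then show ?thesis by simp
  next
    case False
    then obtain k where "m = int k" using nonneg_int_cases by (metis not_less)
    then show ?thesis using lag_diff_orthogonal[of k n] by simp
  qed
next
  case (Suc p)
  from has_integral_diff[OF Suc.IH[of "m - 1"] Suc.IH[of m]]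
  show ?case by (simp only: lag_diff.simps(2) left_diff_distrib gram.simps)
qed

lemma gram_neg: "m < 0 \<Longrightarrow> gram p m n = 0"
  by (induction p arbitrary: m) auto

lemma gram_large: "m > int n + int p \<Longrightarrow> gram p m n = 0"
  by (induction p arbitrary: m) auto

text \<open>Summation by parts moves the differences from the functions to the coefficients; the inner products have finite support,
so no boundary terms remain.\<close>
lemma sum_gram: "N > n + p \<Longrightarrow> (\<Sum>m<N. c m * gram p (int m) n) = 1 / 2 * (finite_difference ^^ p) c n"
proof (induction p arbitrary: N c)
  case 0
  have "(\<Sum>m<N. c m * gram 0 (int m) n) = (\<Sum>m<N. if m = n then c m / 2 else 0)"
    by (intro sum.cong) auto
  also have "\<dots> = c n / 2" using 0 by simp
  finally show ?case by simp
next
  case (Suc p)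
  then obtain M where M: "N = Suc M" "M > n + p" by (cases N) auto
  have "(\<Sum>m<N. c m * gram (Suc p) (int m) n)
      = (\<Sum>m<Suc M. c m * gram p (int m - 1) n) - (\<Sum>m<Suc M. c m * gram p (int m) n)"
    unfolding M(1) by (simp only: gram.simps right_diff_distrib sum_subtractf)
  also have "(\<Sum>m<Suc M. c m * gram p (int m - 1) n) = (\<Sum>m<M. c (Suc m) * gram p (int m) n)"
    unfolding sum.lessThan_Suc_shift by (simp add: gram_neg)
  also have "(\<Sum>m<Suc M. c m * gram p (int m) n) = (\<Sum>m<M. c m * gram p (int m) n)"
    using M(2) by (simp add: gram_large)
  also have "(\<Sum>m<M. c (Suc m) * gram p (int m) n) - (\<Sum>m<M. c m * gram p (int m) n)
      = (\<Sum>m<M. finite_difference c m * gram p (int m) n)"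
    by (simp only: finite_difference_def left_diff_distrib sum_subtractf)
  also have "\<dots> = 1 / 2 * (finite_difference ^^ p) (finite_difference c) n" by (rule Suc.IH[OF M(2)])
  finally show ?case by (simp add: funpow_swap1)
qed

text \<open>The partial sums of the combination are bounded uniformly on the half-line, by the Cauchy-Schwarz inequality and the bound
on the diagonal of the kernel. So dominated convergence allows integrating the series against \<open>\<lambda>\<^sub>n\<close>.\<close>
lemma lag_diff_independent:
  assumes c: "summable (\<lambda>m. (c m)\<^sup>2)"
    and sums: "\<And>t. t \<ge> 0 \<Longrightarrow> (\<lambda>m. c m * lag_diff (Suc p) (int m) t) sums 0"
  shows "c n = 0"
proof (rule null_sequence_polynomial[of c "Suc p"])
  show "c \<longlonglongrightarrow> 0"
    by (rule null_sequence_if_square_le[OF order_refl summable_LIMSEQ_zero[OF c]])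
  fix n
  define S where "S N t = (\<Sum>m<N. c m * lag_diff (Suc p) (int m) t)" for N t
  define B where "B = sqrt ((\<Sum>m. (c m)\<^sup>2) * real ((2 * p) choose p))"
  have SB: "\<bar>S N t\<bar> \<le> B" if "t \<ge> 0" for N t
  proof -
    have "(S N t)\<^sup>2 \<le> (\<Sum>m<N. (c m)\<^sup>2) * (\<Sum>m<N. (lag_diff (Suc p) (int m) t)\<^sup>2)"
      unfolding S_def by (rule Cauchy_Schwarz_ineq_sum)
    also have "\<dots> \<le> (\<Sum>m. (c m)\<^sup>2) * real ((2 * p) choose p)"
    proof (rule mult_mono)
      show "(\<Sum>m<N. (c m)\<^sup>2) \<le> (\<Sum>m. (c m)\<^sup>2)" by (rule sum_le_suminf[OF c]) auto
      show "(\<Sum>m<N. (lag_diff (Suc p) (int m) t)\<^sup>2) \<le> real ((2 * p) choose p)"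
        using partial_kernel_diag_le[OF that, of p N] by (simp add: partial_kernel_def power2_eq_square del: lag_diff.simps)
    qed (auto intro: suminf_nonneg c sum_nonneg)
    finally have "(S N t)\<^sup>2 \<le> (\<Sum>m. (c m)\<^sup>2) * real ((2 * p) choose p)" .
    then show ?thesis unfolding B_def by (intro real_le_rsqrt) simp
  qed
  have B: "B \<ge> 0" using SB[of 0 0] by linarith
  obtain D where D: "\<And>t. t \<ge> 0 \<Longrightarrow> \<bar>lag_diff 0 (int n) t\<bar> \<le> D * exp (- t / 2)"
    using exp_bounded_lag_diff[of 0 "int n"] unfolding exp_bounded_def by blast
  have int: "((\<lambda>t. S N t * lag_diff 0 (int n) t) has_integral (\<Sum>m<N. c m * gram (Suc p) (int m) n)) {0..}" for N
  proof -
    have "((\<lambda>t. \<Sum>m<N. c m * (lag_diff (Suc p) (int m) t * lag_diff 0 (int n) t)) has_integral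
        (\<Sum>m<N. c m * gram (Suc p) (int m) n)) {0..}"
      by (intro has_integral_sum has_integral_mult_right has_integral_gram) simp
    then show ?thesis by (simp only: S_def sum_distrib_right mult.assoc)
  qed
  have "(\<lambda>N. integral {0..} (\<lambda>t. S N t * lag_diff 0 (int n) t)) \<longlonglongrightarrow> integral {0..} (\<lambda>t::real. 0 :: real)"
  proof (rule dominated_convergence(2))
    show "(\<lambda>t. S N t * lag_diff 0 (int n) t) integrable_on {0..}" for N
      using int by (rule has_integral_integrable)
    show "(\<lambda>t. B * D * exp (- (1 / 2) * t)) integrable_on {0..}"
      by (intro integrable_on_mult_right integrable_on_exp_minus_to_infinity) simp
    show "norm (S N t * lag_diff 0 (int n) t) \<le> B * D * exp (- (1 / 2) * t)" if "t \<in> {0..}" for N t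
    proof -
      have "\<bar>S N t\<bar> * \<bar>lag_diff 0 (int n) t\<bar> \<le> B * (D * exp (- t / 2))"
        using SB[of t N] D[of t] B that by (intro mult_mono) auto
      then show ?thesis by (simp add: abs_mult mult.assoc del: lag_diff.simps)
    qed
    show "(\<lambda>N. S N t * lag_diff 0 (int n) t) \<longlonglongrightarrow> 0" if "t \<in> {0..}" for t
    proof -
      have "(\<lambda>N. S N t) \<longlonglongrightarrow> 0" using sums[of t] that by (simp add: S_def sums_def del: lag_diff.simps)
      then show ?thesis by (rule tendsto_mult_left_zero)
    qed
  qed
  then have "(\<lambda>N. \<Sum>m<N. c m * gram (Suc p) (int m) n) \<longlonglongrightarrow> 0"
    unfolding integral_unique[OF int] by simp
  moreover have "\<forall>\<^sub>F N in sequentially. (\<Sum>m<N. c m * gram (Suc p) (int m) n)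
      = 1 / 2 * (finite_difference ^^ Suc p) c n"
    by (rule eventually_mono[OF eventually_gt_at_top[of "n + Suc p"]]) (rule sum_gram)
  ultimately have "(\<lambda>N::nat. 1 / 2 * (finite_difference ^^ Suc p) c n) \<longlonglongrightarrow> 0"
    by (rule Lim_transform_eventually)
  then show "(finite_difference ^^ Suc p) c n = 0"
    using LIMSEQ_unique[OF tendsto_const] by fastforce
qed

section \<open>Identification of the sum\<close>

text \<open>The equation factors as \<open>(D + 1)(D - 1) w = 0\<close>, which leaves two first-order equations.\<close>
lemma ode_unique:
  fixes w v :: "real \<Rightarrow> real"
  assumes w: "\<And>x. (w has_real_derivative v x) (at x)" and v: "\<And>x. (v has_real_derivative w x) (at x)"
    and "w 0 = 0" "v 0 = 0"
  shows "w x = 0"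
proof -
  have "\<forall>x. ((\<lambda>x. (w x + v x) * exp (- x)) has_real_derivative 0) (at x)"
    by (auto intro!: derivative_eq_intros w v simp: algebra_simps)
  from DERIV_isconst_all[OF this, of _ 0] have vw: "v x = - w x" for x
    using assms(3,4) by (simp add: add_eq_0_iff)
  have "\<forall>x. ((\<lambda>x. w x * exp x) has_real_derivative 0) (at x)"
    by (auto intro!: derivative_eq_intros w simp: vw)
  from DERIV_isconst_all[OF this, of x 0] show ?thesis
    using assms(3) by simp
qed

lemma central_binomial_Suc:
  "real ((2 * Suc q) choose Suc q) * (2 * real q + 2) / (2 * real q + 1) = 4 * real ((2 * q) choose q)"
proof -
  have 1: "real ((2 * Suc q) choose Suc q) = fact (2 * Suc q) / (fact (Suc q) * fact (Suc q))"
    using binomial_fact[of "Suc q" "2 * Suc q", where 'a = real] by simp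
  have 2: "real ((2 * q) choose q) = fact (2 * q) / (fact q * fact q)"
    using binomial_fact[of q "2 * q", where 'a = real] by simp
  have 3: "fact (2 * Suc q) = 2 * (real q + 1) * ((2 * real q + 1) * fact (2 * q))"
    by (simp add: add.commute)
  have 4: "fact (Suc q) = (real q + 1) * fact q" by simp
  have 5: "2 * real q + 2 = 2 * (real q + 1)" by simp
  have "2 * r * (s * F) / (r * f * (r * f)) * (2 * r) / s = 4 * (F / (f * f))"
    if "r > 0" "s > 0" "f > 0" for r s f F :: real
    using that by (simp add: field_simps)
  note 6 = this
  show ?thesis unfolding 1 2 3 4 5 by (rule 6; simp add: add_nonneg_pos)
qed

text \<open>Both sides satisfy the same second-order equation, whose inhomogeneity is the case of order one lower, and have
the same value and derivative at \<open>0\<close>. For the left-hand side, summation by parts yields the equation, and the derivative at \<open>0\<close> is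
a telescoping sum of differences of squares.\<close>
lemma partial_kernel_eq_matern:
  "partial_kernel p (Suc p) x 0 = real ((2 * p) choose p) * matern_entire p x"
proof (induction p arbitrary: x)
  case 0
  have "partial_kernel 0 (Suc 0) x 0 = exp (- x)"
    by (simp add: partial_kernel_def laguerre_def)
  then show ?case by (simp add: matern_entire_0)
next
  case (Suc q)
  \<comment> \<open>One more index than the support of \<open>b\<close>, so that the upper boundary terms vanish.\<close>
  define N where "N = Suc (Suc q)"
  define b where "b m = lag_diff (Suc q) m 0" for m
  define B where "B m = b (int m - 1) - b (int m)" for m
  have b0: "b (-1) = 0" "b (int (Suc q)) = 0"
    unfolding b_def by (rule lag_diff_neg, simp) (simp only: lag_diff_at_0, simp)
  define M where "M x = (\<Sum>m<N. lag_diff (Suc (Suc q)) (int m) x * B m)" for x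
  define V where "V x = (\<Sum>m<N. (lag_diff (Suc q) (int m - 1) x + lag_diff (Suc q) (int m) x) * B m)" for x
  have M: "M = (\<lambda>x. partial_kernel (Suc q) (Suc (Suc q)) x 0)"
    by (rule ext) (simp only: M_def partial_kernel_def B_def b_def N_def lag_diff.simps(2)[of "Suc q" _ 0])
  have Mq: "(\<Sum>m<N. lag_diff (Suc q) (int m) x * b (int m)) = partial_kernel q (Suc q) x 0" for x
    unfolding partial_kernel_eventually[of q N x, symmetric, unfolded N_def, simplified]
    by (simp only: partial_kernel_def b_def N_def)
  have dM: "(M has_real_derivative V x) (at x)" for x
    unfolding M_def V_def by (intro DERIV_sum DERIV_cmult_right lag_diff_deriv)
  have dV: "(V has_real_derivative M x - 4 * partial_kernel q (Suc q) x 0) (at x)" for x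
  proof -
    define h where "h m = 4 * (b (int m - 1) * lag_diff q (int m - 1) x)" for m
    have "(V has_real_derivative (\<Sum>m<N. ((lag_diff q (int m - 1 - 1) x + lag_diff q (int m - 1) x)
        + (lag_diff q (int m - 1) x + lag_diff q (int m) x)) * B m)) (at x)"
      unfolding V_def by (intro DERIV_sum DERIV_cmult_right DERIV_add lag_diff_deriv)
    also have "(\<Sum>m<N. ((lag_diff q (int m - 1 - 1) x + lag_diff q (int m - 1) x)
        + (lag_diff q (int m - 1) x + lag_diff q (int m) x)) * B m)
       = (\<Sum>m<N. lag_diff (Suc (Suc q)) (int m) x * B m - 4 * (lag_diff (Suc q) (int m) x * b (int m)) + (h m - h (Suc m)))"
      by (rule sum.cong) (simp_all add: h_def B_def algebra_simps)
    also have "\<dots> = M x - 4 * partial_kernel q (Suc q) x 0 + (\<Sum>m<N. h m - h (Suc m))"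
      unfolding M_def Mq[symmetric] sum_distrib_left by (simp only: sum.distrib sum_subtractf)
    also have "(\<Sum>m<N. h m - h (Suc m)) = 0"
      unfolding sum_lessThan_telescope' using b0 by (simp add: h_def N_def)
    finally show ?thesis by simp
  qed
  have "V 0 = (\<Sum>m<N. (b (int m - 1))\<^sup>2 - (b (int (Suc m) - 1))\<^sup>2)"
    unfolding V_def B_def b_def by (rule sum.cong) (simp_all add: power2_eq_square algebra_simps)
  also have "\<dots> = 0"
    using sum_lessThan_telescope'[of "\<lambda>m. (b (int m - 1))\<^sup>2" N] b0 by (simp add: N_def)
  finally have V0: "V 0 = 0" .
  define C where "C = real ((2 * Suc q) choose Suc q)"
  have M0: "M 0 = C" unfolding M C_def by (rule partial_kernel_0_0)
  define w where "w x = M x - C * matern_entire (Suc q) x" for x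
  define v where "v x = V x - C * matern_deriv (Suc q) x" for x
  have "w x = 0"
  proof (rule ode_unique[where w = w and v = v])
    show "(w has_real_derivative v x) (at x)" for x
      unfolding w_def v_def by (intro DERIV_diff DERIV_cmult dM matern_entire_deriv)
    show "(v has_real_derivative w x) (at x)" for x
    proof -
      have "(v has_real_derivative (M x - 4 * partial_kernel q (Suc q) x 0)
         - C * (matern_entire (Suc q) x - (2 * real q + 2) / (2 * real q + 1) * matern_entire q x)) (at x)"
        unfolding v_def by (intro DERIV_diff DERIV_cmult dV matern_deriv_deriv)
      also have "(M x - 4 * partial_kernel q (Suc q) x 0)
         - C * (matern_entire (Suc q) x - (2 * real q + 2) / (2 * real q + 1) * matern_entire q x)
         = w x + (C * (2 * real q + 2) / (2 * real q + 1) - 4 * real ((2 * q) choose q)) * matern_entire q x"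
        unfolding Suc.IH w_def by (simp add: algebra_simps)
      finally show ?thesis unfolding C_def central_binomial_Suc by simp
    qed
    show "w 0 = 0" by (simp add: w_def M0 matern_entire_at_0)
    show "v 0 = 0" by (simp add: v_def V0 matern_deriv_def)
  qed
  then show ?case by (simp add: w_def M C_def)
qed

section \<open>The three families on the two half-lines\<close>

text \<open>Restricted to the half-line, the sequence \<open>half_psi \<nu> 0, half_psi \<nu> 1, \<dots>\<close> runs through the functions with
index \<open>Zero 0, \<dots>, Zero \<nu>, Plus 0, Plus 1, \<dots>\<close>; up to the sign \<open>(-1)\<^sup>\<nu>\<close> and a reflection, it also
runs through those with index \<open>Zero \<nu>, \<dots>, Zero 0, Minus 0, Minus 1, \<dots>\<close> on the other half-line.\<close>
definition half_psi :: "nat \<Rightarrow> nat \<Rightarrow> real \<Rightarrow> real" where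
  "half_psi \<nu> m t = fact \<nu> / sqrt (fact (2 * \<nu>)) * lag_diff (Suc \<nu>) (int m) t"

lemma scale_square: "(fact \<nu> / sqrt (fact (2 * \<nu>)))\<^sup>2 * real ((2 * \<nu>) choose \<nu>) = 1"
proof -
  have "real ((2 * \<nu>) choose \<nu>) = fact (2 * \<nu>) / (fact \<nu> * fact \<nu>)"
    using binomial_fact[of \<nu> "2 * \<nu>", where 'a = real] by simp
  then show ?thesis by (simp add: power_divide power2_eq_square)
qed

lemma scaled_partial_kernel:
  "(fact \<nu> / sqrt (fact (2 * \<nu>)))\<^sup>2 * partial_kernel \<nu> (Suc \<nu>) x 0 = matern_entire \<nu> x"
  unfolding partial_kernel_eq_matern mult.assoc[symmetric] scale_square by simp

lemma half_psi_sums: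
  assumes "0 \<le> t" "0 \<le> u"
  shows "(\<lambda>m. half_psi \<nu> m t * half_psi \<nu> m u) sums matern_entire \<nu> \<bar>t - u\<bar>"
proof -
  let ?c = "fact \<nu> / sqrt (fact (2 * \<nu>)) :: real"
  have "(\<lambda>m. lag_diff (Suc \<nu>) (int m) t * lag_diff (Suc \<nu>) (int m) u) sums partial_kernel \<nu> (Suc \<nu>) \<bar>t - u\<bar> 0"
    using partial_kernel_tendsto[OF assms, of \<nu>] unfolding sums_def partial_kernel_def .
  from sums_mult[OF this, of "?c\<^sup>2"]
  have "(\<lambda>m. ?c\<^sup>2 * (lag_diff (Suc \<nu>) (int m) t * lag_diff (Suc \<nu>) (int m) u)) sums matern_entire \<nu> \<bar>t - u\<bar>"
    by (simp only: scaled_partial_kernel)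
  then show ?thesis
    by (rule back_subst[of "\<lambda>f. f sums _"]) (simp add: half_psi_def power2_eq_square fun_eq_iff mult_ac del: lag_diff.simps)
qed

lemma half_psi_independent:
  assumes "summable (\<lambda>m. (c m)\<^sup>2)" "\<And>t. t \<ge> 0 \<Longrightarrow> (\<lambda>m. c m * half_psi \<nu> m t) sums 0"
  shows "c n = 0"
proof (rule lag_diff_independent[OF assms(1)])
  fix t :: real assume "t \<ge> 0"
  let ?c = "fact \<nu> / sqrt (fact (2 * \<nu>)) :: real"
  have "(\<lambda>m. inverse ?c * (c m * half_psi \<nu> m t)) sums (inverse ?c * 0)"
    by (rule sums_mult[OF assms(2)[OF \<open>t \<ge> 0\<close>]])
  then show "(\<lambda>m. c m * lag_diff (Suc \<nu>) (int m) t) sums 0"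
    by (simp add: half_psi_def del: lag_diff.simps)
qed

lemma laguerre_fun_nonneg: "t \<ge> 0 \<Longrightarrow> laguerre_fun n t = sqrt 2 * lag_diff 0 n t"
  by (simp add: laguerre_fun_def)

lemma laguerre_fun_neg: "t > 0 \<Longrightarrow> laguerre_fun n (- t) = - sqrt 2 * lag_diff 0 (- n - 1) t"
  by (simp add: laguerre_fun_def)

lemma psi_plus_nonneg: "t \<ge> 0 \<Longrightarrow> psi_plus \<nu> m t = half_psi \<nu> (m + Suc \<nu>) t"
  unfolding half_psi_def lag_diff_eq_laguerre psi_plus_def by simp

lemma psi_plus_neg: "t \<ge> 0 \<Longrightarrow> psi_plus \<nu> m (- t) = 0"
  by (cases "t = 0") (simp_all add: psi_plus_def)

lemma psi_zero_nonneg: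
  assumes "t \<ge> 0" shows "psi_zero \<nu> m t = half_psi \<nu> m t"
proof -
  have "(\<Sum>k\<le>\<nu> + 1. real ((\<nu> + 1) choose k) * (-1) ^ k * laguerre_fun (int m + int k - int \<nu> - 1) t)
      = (\<Sum>k\<le>Suc \<nu>. sqrt 2 * (real (Suc \<nu> choose k) * (-1) ^ k * lag_diff 0 (int m + int k - int (Suc \<nu>)) t))"
    using assms by (intro sum.cong) (simp_all add: laguerre_fun_nonneg algebra_simps del: lag_diff.simps binomial_Suc_Suc)
  also have "\<dots> = sqrt 2 * lag_diff (Suc \<nu>) (int m) t"
    unfolding lag_diff_sum[of "Suc \<nu>"] sum_distrib_left ..
  finally show ?thesis by (simp add: psi_zero_def half_psi_def del: lag_diff.simps)
qed

lemma half_psi_reflect_0: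
  assumes "m \<le> \<nu>" shows "half_psi \<nu> m 0 = (-1) ^ \<nu> * half_psi \<nu> (\<nu> - m) 0"
proof -
  have "(-1::real) ^ \<nu> * (-1) ^ (Suc \<nu> + (\<nu> - m)) = (-1) ^ (Suc \<nu> + m)"
  proof -
    have "(-1::real) ^ \<nu> * (-1) ^ (Suc \<nu> + (\<nu> - m)) = (-1) ^ (\<nu> + (Suc \<nu> + (\<nu> - m)))"
      by (simp only: power_add)
    also have "\<nu> + (Suc \<nu> + (\<nu> - m)) = (Suc \<nu> + m) + 2 * (\<nu> - m)" using assms by simp
    finally show ?thesis by (simp add: power_add)
  qed
  then show ?thesis
    unfolding half_psi_def lag_diff_at_0 using binomial_symmetric[OF assms] by simp
qed

lemma sum_atMost_rev: "(\<Sum>k\<le>n. f k) = (\<Sum>k\<le>n. f (n - k))" for n :: nat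
  by (rule sum.reindex_bij_witness[of _ "\<lambda>k. n - k" "\<lambda>k. n - k"]) auto

text \<open>The Laguerre functions satisfy \<open>\<phi>\<^sub>-\<^sub>n\<^sub>-\<^sub>1(-t) = -\<phi>\<^sub>n(t)\<close> for \<open>t > 0\<close>, so the reflection reverses the
alternating binomial sum. At \<open>t = 0\<close> this fails for the
individual functions, and the alternating sum is evaluated there directly.\<close>
lemma psi_zero_neg:
  assumes "t \<ge> 0" "m \<le> \<nu>"
  shows "psi_zero \<nu> m (- t) = (-1) ^ \<nu> * half_psi \<nu> (\<nu> - m) t"
proof (cases "t = 0")
  case True
  then show ?thesis using psi_zero_nonneg[of 0 \<nu> m] half_psi_reflect_0[OF assms(2)] by simp
next
  case False
  then have "t > 0" using assms by simp
  let ?f = "\<lambda>k. real ((\<nu> + 1) choose k) * (-1) ^ k * laguerre_fun (int m + int k - int \<nu> - 1) (- t)"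
  let ?g = "\<lambda>k. real (Suc \<nu> choose k) * (-1) ^ k * lag_diff 0 (int (\<nu> - m) + int k - int (Suc \<nu>)) t"
  have "?f (\<nu> + 1 - k) = sqrt 2 * (-1) ^ \<nu> * ?g k" if "k \<le> \<nu> + 1" for k
  proof -
    have s: "(-1::real) ^ (\<nu> + 1 - k) = - ((-1) ^ \<nu>) * (-1) ^ k"
    proof -
      have "(-1::real) ^ (\<nu> + 1 - k) * (-1) ^ k * (-1) ^ k = (-1) ^ (\<nu> + 1) * (-1) ^ k"
        using that by (simp flip: power_add)
      then show ?thesis by (simp add: mult.assoc flip: power_mult_distrib)
    qed
    have "int m + int (\<nu> + 1 - k) - int \<nu> - 1 = int m - int k" using that by (simp add: of_nat_diff)
    moreover have "- (int m - int k) - 1 = int (\<nu> - m) + int k - int (Suc \<nu>)"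
      using assms(2) by (simp add: of_nat_diff)
    ultimately have "laguerre_fun (int m + int (\<nu> + 1 - k) - int \<nu> - 1) (- t)
        = - sqrt 2 * lag_diff 0 (int (\<nu> - m) + int k - int (Suc \<nu>)) t"
      by (simp only: laguerre_fun_neg[OF \<open>t > 0\<close>])
    moreover have "(\<nu> + 1) choose (\<nu> + 1 - k) = Suc \<nu> choose k"
      using binomial_symmetric[OF that] by simp
    ultimately show ?thesis unfolding s by (simp del: lag_diff.simps binomial_Suc_Suc)
  qed
  then have "(\<Sum>k\<le>\<nu> + 1. ?f (\<nu> + 1 - k)) = (\<Sum>k\<le>Suc \<nu>. sqrt 2 * (-1) ^ \<nu> * ?g k)"
    by (intro sum.cong) auto
  then have "(\<Sum>k\<le>\<nu> + 1. ?f k) = (\<Sum>k\<le>Suc \<nu>. sqrt 2 * (-1) ^ \<nu> * ?g k)"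
    by (simp only: sum_atMost_rev[of ?f "\<nu> + 1"])
  also have "\<dots> = sqrt 2 * (-1) ^ \<nu> * lag_diff (Suc \<nu>) (int (\<nu> - m)) t"
    unfolding lag_diff_sum[of "Suc \<nu>"] sum_distrib_left ..
  finally show ?thesis by (simp add: psi_zero_def half_psi_def del: lag_diff.simps)
qed

lemma psi_minus_nonneg: "t \<ge> 0 \<Longrightarrow> psi_minus \<nu> m t = 0"
  by (simp add: psi_minus_def psi_plus_neg)

lemma psi_minus_neg: "t \<ge> 0 \<Longrightarrow> psi_minus \<nu> m (- t) = (-1) ^ \<nu> * half_psi \<nu> (m + Suc \<nu>) t"
  by (simp add: psi_minus_def psi_plus_nonneg)

lemma psi_kernel:
  "summable (\<lambda>m. psi_minus \<nu> m t * psi_minus \<nu> m u) \<and>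
   summable (\<lambda>m. psi_plus \<nu> m t * psi_plus \<nu> m u) \<and>
   matern_entire \<nu> \<bar>t - u\<bar> = (\<Sum>m\<le>\<nu>. psi_zero \<nu> m t * psi_zero \<nu> m u)
     + (\<Sum>m. psi_minus \<nu> m t * psi_minus \<nu> m u) + (\<Sum>m. psi_plus \<nu> m t * psi_plus \<nu> m u)"
proof -
  have sq: "(-1) ^ \<nu> * x * ((-1) ^ \<nu> * y) = x * y" for x y :: real
  proof -
    have "(-1::real) ^ \<nu> * (-1) ^ \<nu> = 1" by (simp flip: power_mult_distrib)
    then show ?thesis by (metis mult.assoc mult.left_commute mult_1)
  qed
  have split: "summable (\<lambda>m. half_psi \<nu> (m + Suc \<nu>) a * half_psi \<nu> (m + Suc \<nu>) b)"
    "matern_entire \<nu> \<bar>a - b\<bar> = (\<Sum>m\<le>\<nu>. half_psi \<nu> m a * half_psi \<nu> m b)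
       + (\<Sum>m. half_psi \<nu> (m + Suc \<nu>) a * half_psi \<nu> (m + Suc \<nu>) b)"
    if "a \<ge> 0" "b \<ge> 0" for a b
  proof -
    let ?f = "\<lambda>m. half_psi \<nu> m a * half_psi \<nu> m b"
    note s = half_psi_sums[OF that, of \<nu>]
    from sums_summable[OF s] show "summable (\<lambda>m. ?f (m + Suc \<nu>))"
      by (rule summable_ignore_initial_segment)
    show "matern_entire \<nu> \<bar>a - b\<bar> = (\<Sum>m\<le>\<nu>. ?f m) + (\<Sum>m. ?f (m + Suc \<nu>))"
      unfolding sums_unique[OF s] suminf_split_initial_segment[OF sums_summable[OF s], of "Suc \<nu>"]
      by (simp add: lessThan_Suc_atMost)
  qed
  have mixed: "(\<Sum>m\<le>\<nu>. psi_zero \<nu> m a * psi_zero \<nu> m (- b)) = matern_entire \<nu> (a + b)"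
    if "a \<ge> 0" "b \<ge> 0" for a b
  proof -
    let ?c = "fact \<nu> / sqrt (fact (2 * \<nu>)) :: real"
    have "(\<Sum>m\<le>\<nu>. psi_zero \<nu> m a * psi_zero \<nu> m (- b))
        = (\<Sum>m\<le>\<nu>. ?c\<^sup>2 * (lag_diff (Suc \<nu>) (int m) a * ((-1) ^ \<nu> * lag_diff (Suc \<nu>) (int \<nu> - int m) b)))"
      using that
      by (intro sum.cong) (simp_all add: psi_zero_nonneg psi_zero_neg half_psi_def of_nat_diff
          power2_eq_square del: lag_diff.simps)
    also have "\<dots> = matern_entire \<nu> (a + b)"
      unfolding sum_distrib_left[symmetric] lag_diff_reflection_sum scaled_partial_kernel ..
    finally show ?thesis .
  qed
  consider "t \<ge> 0" "u \<ge> 0" | "t \<ge> 0" "u \<le> 0" | "t \<le> 0" "u \<ge> 0" | "t \<le> 0" "u \<le> 0" by linarith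
  then show ?thesis
  proof cases
    case 1
    then show ?thesis
      using split[OF 1] by (simp add: psi_minus_nonneg psi_plus_nonneg psi_zero_nonneg)
  next
    case 2
    define b where "b = - u"
    have b: "u = - b" "b \<ge> 0" using 2 by (simp_all add: b_def)
    show ?thesis
      unfolding b(1) using mixed[OF 2(1) b(2)] 2(1) b(2) by (simp add: psi_minus_nonneg psi_plus_neg)
  next
    case 3
    define b where "b = - t"
    have b: "t = - b" "b \<ge> 0" using 3 by (simp_all add: b_def)
    show ?thesis
      unfolding b(1) using mixed[OF 3(2) b(2)] 3(2) b(2)
      by (simp add: psi_minus_nonneg psi_plus_neg mult.commute add.commute)
  next
    case 4
    define a b where "a = - t" and "b = - u"
    have ab: "t = - a" "a \<ge> 0" "u = - b" "b \<ge> 0" using 4 by (simp_all add: a_def b_def)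
    have "(\<Sum>m\<le>\<nu>. psi_zero \<nu> m (- a) * psi_zero \<nu> m (- b))
        = (\<Sum>m\<le>\<nu>. half_psi \<nu> (\<nu> - m) a * half_psi \<nu> (\<nu> - m) b)"
      using ab by (intro sum.cong) (simp_all add: psi_zero_neg sq)
    also have "\<dots> = (\<Sum>m\<le>\<nu>. half_psi \<nu> m a * half_psi \<nu> m b)"
      by (rule sum_atMost_rev[symmetric])
    finally show ?thesis
      unfolding ab(1,3) using split[OF ab(2,4)] ab(2,4)
      by (simp add: psi_minus_neg psi_plus_neg sq abs_minus_commute)
  qed
qed

lemma has_sum_psi_indices:
  fixes f :: "psi_index \<Rightarrow> real"
  assumes "(\<lambda>m. f (Minus m)) summable_on UNIV" "(\<lambda>m. f (Plus m)) summable_on UNIV"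
  shows "(f has_sum (\<Sum>m\<le>\<nu>. f (Zero m)) + (\<Sum>m. f (Minus m)) + (\<Sum>m. f (Plus m))) (psi_indices \<nu>)"
proof -
  have fam: "(f has_sum (\<Sum>m. f (C m))) (range C)"
    if "inj C" "(\<lambda>m. f (C m)) summable_on (UNIV :: nat set)" for C
  proof -
    have "((\<lambda>m. f (C m)) has_sum (\<Sum>\<^sub>\<infinity>m. f (C m))) UNIV" using that(2) by (rule has_sum_infsum)
    moreover from has_sum_imp_sums[OF this] have "(\<Sum>\<^sub>\<infinity>m. f (C m)) = (\<Sum>m. f (C m))" by (rule sums_unique)
    ultimately show ?thesis using that(1) by (simp add: has_sum_reindex o_def)
  qed
  have "(f has_sum (\<Sum>m\<le>\<nu>. f (Zero m))) (Zero ` {..\<nu>})"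
    by (rule has_sum_finiteI) (auto simp: sum.reindex inj_on_def)
  then show ?thesis
    unfolding psi_indices_def using assms
    by (intro has_sum_Un_disjoint fam) (auto simp: inj_on_def)
qed

lemma psi_square_summable:
  "(\<lambda>m. (psi_minus \<nu> m t)\<^sup>2) summable_on UNIV" "(\<lambda>m. (psi_plus \<nu> m t)\<^sup>2) summable_on UNIV"
  using psi_kernel[of \<nu> t t]
  by (auto simp: power2_eq_square intro!: summable_nonneg_imp_summable_on)

text \<open>For independence, a vanishing combination is restricted to each half-line. The restriction to \<open>t \<ge> 0\<close>
sees only the coefficients of \<open>Zero\<close> and \<open>Plus\<close>, the other one those of \<open>Zero\<close> and \<open>Minus\<close>.\<close>
lemma psi_features: "l2_features (psi_indices \<nu>) (psi \<nu>) (matern (real \<nu> + 1 / 2))"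
proof
  fix s t :: real
  show "(\<lambda>i. (psi \<nu> i t)\<^sup>2) summable_on psi_indices \<nu>"
    using has_sum_psi_indices[of "\<lambda>i. (psi \<nu> i t)\<^sup>2" \<nu>] psi_square_summable[of \<nu> t]
    by (auto intro: has_sum_imp_summable)
  have "((\<lambda>i. psi \<nu> i s * psi \<nu> i t) has_sum matern_entire \<nu> \<bar>s - t\<bar>) (psi_indices \<nu>)"
    using has_sum_psi_indices[of "\<lambda>i. psi \<nu> i s * psi \<nu> i t" \<nu>] psi_kernel[of \<nu> s t]
      psi_square_summable[of \<nu>] by (simp add: summable_on_mult_of_squares)
  then show "matern (real \<nu> + 1 / 2) s t = (\<Sum>\<^sub>\<infinity>i\<in>psi_indices \<nu>. psi \<nu> i s * psi \<nu> i t)"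
    unfolding matern_eq by (rule infsumI[symmetric])
next
  fix c and i
  assume c: "c \<in> l2 (psi_indices \<nu>)"
    and zero: "\<And>t. (\<Sum>\<^sub>\<infinity>i\<in>psi_indices \<nu>. c i * psi \<nu> i t) = 0" and i: "i \<in> psi_indices \<nu>"
  have csum: "(\<lambda>i. (c i)\<^sup>2) summable_on psi_indices \<nu>" using c by (simp add: l2_def)
  have cC: "(\<lambda>m. (c (C m))\<^sup>2) summable_on (UNIV :: nat set)"
    if "inj C" "range C \<subseteq> psi_indices \<nu>" for C
    using summable_on_subset[OF csum that(2)] summable_on_reindex[OF that(1), of "\<lambda>i. (c i)\<^sup>2"]
    by (simp add: o_def)
  have cM: "(\<lambda>m. (c (Minus m))\<^sup>2) summable_on UNIV" and cP: "(\<lambda>m. (c (Plus m))\<^sup>2) summable_on UNIV"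
    by (rule cC; auto simp: inj_on_def psi_indices_def)+
  have vanish: "(\<Sum>m\<le>\<nu>. c (Zero m) * psi_zero \<nu> m t) + (\<Sum>m. c (Minus m) * psi_minus \<nu> m t)
      + (\<Sum>m. c (Plus m) * psi_plus \<nu> m t) = 0"
    and sM: "summable (\<lambda>m. c (Minus m) * psi_minus \<nu> m t)"
    and sP: "summable (\<lambda>m. c (Plus m) * psi_plus \<nu> m t)" for t
  proof -
    have M: "(\<lambda>m. c (Minus m) * psi_minus \<nu> m t) summable_on UNIV"
      and P: "(\<lambda>m. c (Plus m) * psi_plus \<nu> m t) summable_on UNIV"
      by (rule summable_on_mult_of_squares cM cP psi_square_summable)+
    show "summable (\<lambda>m. c (Minus m) * psi_minus \<nu> m t)" "summable (\<lambda>m. c (Plus m) * psi_plus \<nu> m t)"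
      using M P by (auto intro: summable_on_imp_summable)
    show "(\<Sum>m\<le>\<nu>. c (Zero m) * psi_zero \<nu> m t) + (\<Sum>m. c (Minus m) * psi_minus \<nu> m t)
      + (\<Sum>m. c (Plus m) * psi_plus \<nu> m t) = 0"
      using infsumI[OF has_sum_psi_indices[of "\<lambda>i. c i * psi \<nu> i t" \<nu>]] M P zero[of t] by simp
  qed
  have half: "d m = 0"
    if "summable (\<lambda>m. (d (m + Suc \<nu>))\<^sup>2)"
      "\<And>t. t \<ge> 0 \<Longrightarrow> summable (\<lambda>m. d (m + Suc \<nu>) * half_psi \<nu> (m + Suc \<nu>) t)"
      "\<And>t. t \<ge> 0 \<Longrightarrow> (\<Sum>m\<le>\<nu>. d m * half_psi \<nu> m t) + (\<Sum>m. d (m + Suc \<nu>) * half_psi \<nu> (m + Suc \<nu>) t) = 0"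
    for d :: "nat \<Rightarrow> real" and m
  proof (rule half_psi_independent)
    show "summable (\<lambda>m. (d m)\<^sup>2)"
      using that(1) summable_iff_shift[of "\<lambda>m. (d m)\<^sup>2" "Suc \<nu>"] by simp
    fix t :: real assume t: "t \<ge> 0"
    from sums_iff_shift[THEN iffD1, OF summable_sums[OF that(2)[OF t]]]
    have "(\<lambda>m. d m * half_psi \<nu> m t) sums ((\<Sum>m. d (m + Suc \<nu>) * half_psi \<nu> (m + Suc \<nu>) t)
        + (\<Sum>m<Suc \<nu>. d m * half_psi \<nu> m t))" by simp
    then show "(\<lambda>m. d m * half_psi \<nu> m t) sums 0"
      using that(3)[OF t] by (simp add: lessThan_Suc_atMost add.commute)
  qed
  define d where "d m = (if m \<le> \<nu> then c (Zero m) else c (Plus (m - Suc \<nu>)))" for m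
  \<comment> \<open>The signs and the reversal of the first \<open>\<nu> + 1\<close> coefficients are those of \<open>psi_zero_neg\<close> and \<open>psi_minus_neg\<close>.\<close>
  define d' where "d' m = (if m \<le> \<nu> then (-1) ^ \<nu> * c (Zero (\<nu> - m)) else (-1) ^ \<nu> * c (Minus (m - Suc \<nu>)))" for m
  have "d m = 0" for m
  proof (rule half)
    show "summable (\<lambda>m. (d (m + Suc \<nu>))\<^sup>2)" using summable_on_imp_summable[OF cP] by (simp add: d_def)
    fix t :: real assume t: "t \<ge> 0"
    show "summable (\<lambda>m. d (m + Suc \<nu>) * half_psi \<nu> (m + Suc \<nu>) t)"
      using sP[of t] t by (simp add: d_def psi_plus_nonneg)
    show "(\<Sum>m\<le>\<nu>. d m * half_psi \<nu> m t) + (\<Sum>m. d (m + Suc \<nu>) * half_psi \<nu> (m + Suc \<nu>) t) = 0"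
      using vanish[of t] t by (simp add: d_def psi_zero_nonneg psi_plus_nonneg psi_minus_nonneg)
  qed
  from this have d: "d m = 0" for m .
  have d': "d' m = 0" for m
  proof (rule half)
    have "(\<lambda>m. (d' (m + Suc \<nu>))\<^sup>2) = (\<lambda>m. (c (Minus m))\<^sup>2)"
      by (simp add: d'_def fun_eq_iff power_mult_distrib flip: power_mult)
    then show "summable (\<lambda>m. (d' (m + Suc \<nu>))\<^sup>2)" using summable_on_imp_summable[OF cM] by simp
    fix t :: real assume t: "t \<ge> 0"
    have tail: "(\<lambda>m. d' (m + Suc \<nu>) * half_psi \<nu> (m + Suc \<nu>) t) = (\<lambda>m. c (Minus m) * psi_minus \<nu> m (- t))"
      using t by (simp add: d'_def psi_minus_neg fun_eq_iff)
    show "summable (\<lambda>m. d' (m + Suc \<nu>) * half_psi \<nu> (m + Suc \<nu>) t)"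
      unfolding tail by (rule sM)
    have "(\<Sum>m\<le>\<nu>. d' m * half_psi \<nu> m t) = (\<Sum>m\<le>\<nu>. d' (\<nu> - m) * half_psi \<nu> (\<nu> - m) t)"
      by (rule sum_atMost_rev)
    also have "\<dots> = (\<Sum>m\<le>\<nu>. c (Zero m) * psi_zero \<nu> m (- t))"
      using t by (intro sum.cong) (simp_all add: d'_def psi_zero_neg)
    finally show "(\<Sum>m\<le>\<nu>. d' m * half_psi \<nu> m t) + (\<Sum>m. d' (m + Suc \<nu>) * half_psi \<nu> (m + Suc \<nu>) t) = 0"
      unfolding tail using vanish[of "- t"] t by (simp add: psi_plus_neg)
  qed
  from i show "c i = 0"
    unfolding psi_indices_def
  proof (elim UnE imageE)
    fix m assume "i = Zero m" "m \<in> {..\<nu>}"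
    then show ?thesis using d[of m] by (simp add: d_def)
  next
    fix m assume "i = Minus m"
    then show ?thesis using d'[of "m + Suc \<nu>"] by (simp add: d'_def)
  next
    fix m assume "i = Plus m"
    then show ?thesis using d[of "m + Suc \<nu>"] by (simp add: d_def)
  qed
qed

theorem mainTheorem2:
  fixes \<nu> :: nat
  shows "(\<exists>H ip. rkhs H ip (matern (real \<nu> + 1 / 2))) \<and>
    (\<forall>H ip. rkhs H ip (matern (real \<nu> + 1 / 2)) \<longrightarrow>
       orthonormal_basis H ip (psi_indices \<nu>) (psi \<nu>)) \<and>
    (\<forall>t u.
       summable (\<lambda>m. psi_minus \<nu> m t * psi_minus \<nu> m u) \<and>
       summable (\<lambda>m. psi_plus \<nu> m t * psi_plus \<nu> m u) \<and>
       matern (real \<nu> + 1 / 2) t u =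
         (\<Sum>m\<le>\<nu>. psi_zero \<nu> m t * psi_zero \<nu> m u)
         + (\<Sum>m. psi_minus \<nu> m t * psi_minus \<nu> m u)
         + (\<Sum>m. psi_plus \<nu> m t * psi_plus \<nu> m u))"
proof -
  interpret l2_features "psi_indices \<nu>" "psi \<nu>" "matern (real \<nu> + 1 / 2)"
    by (rule psi_features)
  show ?thesis
    using rkhs_synth orthonormal_basis_rkhs psi_kernel[of \<nu>] unfolding matern_eq by blast
qed

end
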